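(* Let $R=R'_1$. For $t\ge0$ write $t=11\ell+r$, $0\le r\le 10$, $m=\lfloor r/2\rfloor$. Then: (a) $\dim_K\mathrm{HH}^0(R)=3$. (b) $\dim_K\mathrm{HH}^t(R)=2$ if $r\in\{0,10\}$, $t>0$, $\ell+m$ even, $\mathrm{char}K=3$; or if $r\in\{4,6\}$, $\ell+m$ odd, $\mathrm{char}K=3$. (c) $\dim_K\mathrm{HH}^t(R)=1$ if one of: $r\in\{0,10\}$, $t>0$, $\ell+m$ even, $\mathrm{char}K\ne3$; $r\in\{1,9\}$; $r\in\{2,8\}$, $\ell+m$ even; $r=3$ and ($\ell+m$ even or $\mathrm{char}K=2$); $r\in\{4,6\}$, $\ell+m$ even, $\mathrm{char}K=2$; $r\in\{4,6\}$, $\ell+m$ odd, $\mathrm{char}K\ne3$; $r=5$, $\mathrm{char}K=3$; $r=7$ and ($\ell+m$ odd or $\mathrm{char}K=2$). (d) In all other cases $\dim_K\mathrm{HH}^t(R)=0$.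
   Context: Let $K$ be a field, $s=1$, $n=6$. Let $\mathcal Q_s$ be the quiver with $6s$ vertices labelled by integers: for $j\in\mathbb Z$ the labels $4j$ and $4j+3$ depend only on $j$ modulo $s$, and the labels $4j+1$, $4j+2$ depend only on $j$ modulo $2s$. Arrows, for $t\in\mathbb Z$ (indices of $\alpha$ modulo $6s$, of $\gamma$ modulo $s$): $\alpha_{3t}:4t\to 4t+1$, $\alpha_{3t+1}:4t+1\to4t+2$, $\alpha_{3t+2}:4t+2\to 4t+3$, $\gamma_t:4t+3\to 4(t+1)$. Paths are composed right to left. $R=R'_s=K\mathcal Q_s/I'$, $I'$ generated by all paths of length $5$, by $\alpha_{3t+2}\alpha_{3t+1}\alpha_{3t}-\alpha_{3(t+s)+2}\alpha_{3(t+s)+1}\alpha_{3(t+s)}$ and by $\alpha_{3t}\gamma_{t-1}\alpha_{3(t+s)-1}$ ($t\in\mathbb Z$). $\mathrm{HH}^t(R)$ is the $t$-th Hochschild cohomology group of $R$ with coefficients in $R$. *)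

theory Defs
  imports Complex_Main "HOL-Library.Function_Algebras"
begin

datatype arrow = Alpha int | Gamma int

text \<open>A path is a pair (starting vertex, list of arrows in the order they are traversed).
  The trivial path at v is (v, []).\<close>
type_synonym path = "int \<times> arrow list"

definition vtx :: "int \<Rightarrow> int \<Rightarrow> int" where
  "vtx s v = (let j = v div 4; c = v mod 4 in
     if c = 0 \<or> c = 3 then 4 * (j mod s) + c else 4 * (j mod (2 * s)) + c)"

definition vertices :: "int \<Rightarrow> int set" where
  "vertices s = range (vtx s)"

definition alpha :: "int \<Rightarrow> int \<Rightarrow> arrow" where
  "alpha s i = Alpha (i mod (6 * s))"

definition gamma :: "int \<Rightarrow> int \<Rightarrow> arrow" where
  "gamma s t = Gamma (t mod s)"

definition arrows :: "int \<Rightarrow> arrow set" where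
  "arrows s = {Alpha i | i. 0 \<le> i \<and> i < 6 * s} \<union> {Gamma t | t. 0 \<le> t \<and> t < s}"

text \<open>alpha_{3t}: 4t -> 4t+1, alpha_{3t+1}: 4t+1 -> 4t+2, alpha_{3t+2}: 4t+2 -> 4t+3,
  gamma_t: 4t+3 -> 4(t+1).\<close>
fun src :: "int \<Rightarrow> arrow \<Rightarrow> int" where
  "src s (Alpha i) = vtx s (4 * (i div 3) + i mod 3)"
| "src s (Gamma t) = vtx s (4 * t + 3)"

fun tgt :: "int \<Rightarrow> arrow \<Rightarrow> int" where
  "tgt s (Alpha i) = vtx s (4 * (i div 3) + i mod 3 + 1)"
| "tgt s (Gamma t) = vtx s (4 * (t + 1))"

fun walk :: "int \<Rightarrow> int \<Rightarrow> arrow list \<Rightarrow> bool" where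
  "walk s v [] = True"
| "walk s v (a # as) = (src s a = v \<and> walk s (tgt s a) as)"

fun endv :: "int \<Rightarrow> int \<Rightarrow> arrow list \<Rightarrow> int" where
  "endv s v [] = v"
| "endv s v (a # as) = endv s (tgt s a) as"

definition valid :: "int \<Rightarrow> path \<Rightarrow> bool" where
  "valid s p = (fst p \<in> vertices s \<and> set (snd p) \<subseteq> arrows s \<and> walk s (fst p) (snd p))"

text \<open>The path written (right to left) as a_k ... a_1 in the paper, i.e. a_1 first.
  The argument list is in the paper's written order.\<close>
definition pth :: "int \<Rightarrow> arrow list \<Rightarrow> path" where
  "pth s ws = (src s (last ws), rev ws)"

definition kq :: "int \<Rightarrow> (path \<Rightarrow> 'k::field) \<Rightarrow> bool" where
  "kq s x = (finite {p. x p \<noteq> 0} \<and> (\<forall>p. x p \<noteq> 0 \<longrightarrow> valid s p))"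

definition bp :: "path \<Rightarrow> path \<Rightarrow> 'k::field" where
  "bp p = (\<lambda>q. if q = p then 1 else 0)"

definition kadd :: "(path \<Rightarrow> 'k::field) \<Rightarrow> (path \<Rightarrow> 'k) \<Rightarrow> path \<Rightarrow> 'k" where
  "kadd x y = (\<lambda>p. x p + y p)"

definition ksub :: "(path \<Rightarrow> 'k::field) \<Rightarrow> (path \<Rightarrow> 'k) \<Rightarrow> path \<Rightarrow> 'k" where
  "ksub x y = (\<lambda>p. x p - y p)"

definition kscale :: "'k::field \<Rightarrow> (path \<Rightarrow> 'k) \<Rightarrow> path \<Rightarrow> 'k" where
  "kscale c x = (\<lambda>p. c * x p)"

text \<open>Multiplication of KQ_s (paths composed right to left): for paths p, q the product
  p q is "first q, then p"; kmult x y is the bilinear extension.\<close>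
definition kmult :: "int \<Rightarrow> (path \<Rightarrow> 'k::field) \<Rightarrow> (path \<Rightarrow> 'k) \<Rightarrow> path \<Rightarrow> 'k" where
  "kmult s x y = (\<lambda>(v, ws). if valid s (v, ws) then
      (\<Sum>k\<in>{0..length ws}. x (endv s v (take k ws), drop k ws) * y (v, take k ws)) else 0)"

definition gens :: "int \<Rightarrow> (path \<Rightarrow> 'k::field) set" where
  "gens s =
     {bp p | p. valid s p \<and> length (snd p) = 5}
   \<union> {ksub (bp (pth s [alpha s (3*t+2), alpha s (3*t+1), alpha s (3*t)]))
            (bp (pth s [alpha s (3*(t+s)+2), alpha s (3*(t+s)+1), alpha s (3*(t+s))])) | t. True}
   \<union> {bp (pth s [alpha s (3*t), gamma s (t-1), alpha s (3*(t+s) - 1)]) | t. True}"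

inductive_set idl :: "int \<Rightarrow> (path \<Rightarrow> 'k::field) set" for s where
  gen: "g \<in> gens s \<Longrightarrow> g \<in> idl s"
| zero: "(\<lambda>p. 0) \<in> idl s"
| add: "x \<in> idl s \<Longrightarrow> y \<in> idl s \<Longrightarrow> kadd x y \<in> idl s"
| scale: "x \<in> idl s \<Longrightarrow> kscale c x \<in> idl s"
| lmult: "x \<in> idl s \<Longrightarrow> kq s a \<Longrightarrow> kmult s a x \<in> idl s"
| rmult: "x \<in> idl s \<Longrightarrow> kq s a \<Longrightarrow> kmult s x a \<in> idl s"

definition rel :: "int \<Rightarrow> (path \<Rightarrow> 'k::field) \<Rightarrow> (path \<Rightarrow> 'k) \<Rightarrow> bool" where
  "rel s x y = (kq s x \<and> kq s y \<and> ksub x y \<in> idl s)"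

lemma ksub_self: "ksub x x = (\<lambda>p. 0)" by (simp add: ksub_def)

lemma ksub_swap: "ksub y x = kscale (-1) (ksub x y)"
  by (simp add: ksub_def kscale_def fun_eq_iff)

lemma ksub_trans: "ksub x z = kadd (ksub x y) (ksub y z)"
  by (simp add: ksub_def kadd_def fun_eq_iff)

lemma kq_zero: "kq s (\<lambda>p. 0)" by (simp add: kq_def)

lemma rel_part_equivp: "part_equivp (rel s :: (path \<Rightarrow> 'k::field) \<Rightarrow> _)"
proof (rule part_equivpI)
  show "\<exists>x::path \<Rightarrow> 'k. rel s x x"
    by (rule exI[of _ "\<lambda>p. 0"]) (simp add: rel_def kq_zero ksub_self idl.zero)
  show "symp (rel s :: (path \<Rightarrow> 'k) \<Rightarrow> _)"
    by (rule sympI) (metis rel_def ksub_swap idl.scale)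
  show "transp (rel s :: (path \<Rightarrow> 'k) \<Rightarrow> _)"
    by (rule transpI) (metis rel_def ksub_trans idl.add)
qed

quotient_type (overloaded) 'k R1 = "path \<Rightarrow> 'k::field" / partial: "rel 1"
  by (rule rel_part_equivp)

lemma kq_add: "kq s x \<Longrightarrow> kq s y \<Longrightarrow> kq s (kadd x y)"
proof -
  assume a: "kq s x" "kq s y"
  have "{p. kadd x y p \<noteq> 0} \<subseteq> {p. x p \<noteq> 0} \<union> {p. y p \<noteq> 0}" by (auto simp: kadd_def)
  then show ?thesis using a unfolding kq_def by (auto simp: kadd_def intro: finite_subset)
qed

lemma kq_scale: "kq s x \<Longrightarrow> kq s (kscale c x)"
proof -
  assume a: "kq s x"
  have "{p. kscale c x p \<noteq> 0} \<subseteq> {p. x p \<noteq> 0}" by (auto simp: kscale_def)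
  then show ?thesis using a unfolding kq_def by (auto simp: kscale_def intro: finite_subset)
qed

lemma kq_sub: "kq s x \<Longrightarrow> kq s y \<Longrightarrow> kq s (ksub x y)"
proof -
  assume a: "kq s x" "kq s y"
  have "{p. ksub x y p \<noteq> 0} \<subseteq> {p. x p \<noteq> 0} \<union> {p. y p \<noteq> 0}" by (auto simp: ksub_def)
  then show ?thesis using a unfolding kq_def by (auto simp: ksub_def intro: finite_subset)
qed

lemma kq_mult: "kq s x \<Longrightarrow> kq s y \<Longrightarrow> kq s (kmult s x y)"
proof -
  assume a: "kq s x" "kq s y"
  let ?S = "(\<lambda>(p, q). (fst q, snd q @ snd p)) ` ({p. x p \<noteq> 0} \<times> {p. y p \<noteq> 0})"
  have "{p. kmult s x y p \<noteq> 0} \<subseteq> ?S"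
  proof
    fix p assume "p \<in> {p. kmult s x y p \<noteq> 0}"
    then obtain v ws where p: "p = (v, ws)" and "kmult s x y (v, ws) \<noteq> 0"
      by (cases p) auto
    then obtain k where "x (endv s v (take k ws), drop k ws) * y (v, take k ws) \<noteq> 0"
      unfolding kmult_def by (auto split: if_splits intro: sum.not_neutral_contains_not_neutral)
    then have "((endv s v (take k ws), drop k ws), (v, take k ws))
        \<in> {p. x p \<noteq> 0} \<times> {p. y p \<noteq> 0}" by auto
    then show "p \<in> ?S" unfolding p by (force intro: image_eqI)
  qed
  moreover have "finite ?S" using a by (auto simp: kq_def)
  ultimately show ?thesis by (auto simp: kq_def kmult_def intro: finite_subset)
qed

lemma kmult_sub:
  "ksub (kmult s x y) (kmult s x' y') = kadd (kmult s (ksub x x') y) (kmult s x' (ksub y y'))"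
  by (auto simp: fun_eq_iff ksub_def kadd_def kmult_def algebra_simps
      sum_subtractf[symmetric] sum.distrib[symmetric] intro!: sum.cong)

lift_definition r1_zero :: "'k::field R1" is "\<lambda>p. 0"
  by (simp add: rel_def kq_zero ksub_self idl.zero)

lift_definition r1_add :: "'k::field R1 \<Rightarrow> 'k R1 \<Rightarrow> 'k R1" is kadd
proof -
  fix x x' y y' :: "path \<Rightarrow> 'k"
  assume "rel 1 x x'" "rel 1 y y'"
  moreover have "ksub (kadd x y) (kadd x' y') = kadd (ksub x x') (ksub y y')"
    by (simp add: fun_eq_iff ksub_def kadd_def)
  ultimately show "rel 1 (kadd x y) (kadd x' y')"
    by (auto simp: rel_def kq_add intro: idl.add)
qed

lift_definition r1_scale :: "'k::field \<Rightarrow> 'k R1 \<Rightarrow> 'k R1" is kscale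
proof -
  fix c :: 'k and x x' :: "path \<Rightarrow> 'k"
  assume "rel 1 x x'"
  moreover have "ksub (kscale c x) (kscale c x') = kscale c (ksub x x')"
    by (simp add: fun_eq_iff ksub_def kscale_def algebra_simps)
  ultimately show "rel 1 (kscale c x) (kscale c x')"
    by (auto simp: rel_def kq_scale intro: idl.scale)
qed

lift_definition r1_sub :: "'k::field R1 \<Rightarrow> 'k R1 \<Rightarrow> 'k R1" is ksub
proof -
  fix x x' y y' :: "path \<Rightarrow> 'k"
  assume "rel 1 x x'" "rel 1 y y'"
  moreover have "ksub (ksub x y) (ksub x' y') = kadd (ksub x x') (kscale (-1) (ksub y y'))"
    by (simp add: fun_eq_iff ksub_def kadd_def kscale_def)
  ultimately show "rel 1 (ksub x y) (ksub x' y')"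
    by (auto simp: rel_def kq_sub intro: idl.add idl.scale)
qed

lift_definition r1_mult :: "'k::field R1 \<Rightarrow> 'k R1 \<Rightarrow> 'k R1" is "kmult 1"
proof -
  fix x x' y y' :: "path \<Rightarrow> 'k"
  assume "rel 1 x x'" "rel 1 y y'"
  then show "rel 1 (kmult 1 x y) (kmult 1 x' y')"
    by (auto simp: rel_def kq_mult kmult_sub intro: idl.add idl.lmult idl.rmult)
qed

lemma rel_eqI: "kq s x \<Longrightarrow> x = y \<Longrightarrow> rel s x y"
  by (simp add: rel_def ksub_self idl.zero)

instantiation R1 :: (field) ab_group_add
begin
definition "0 = r1_zero"
definition "a + b = r1_add a b"
definition "a - b = r1_sub a b"
definition "- a = r1_sub r1_zero a"
instance
proof
  fix a b c :: "'a R1"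
  show "a + b + c = a + (b + c)" unfolding plus_R1_def
    by transfer (intro rel_eqI kq_add kq_sub kq_zero; auto simp: rel_def kadd_def ksub_def fun_eq_iff algebra_simps)
  show "a + b = b + a" unfolding plus_R1_def
    by transfer (intro rel_eqI kq_add kq_sub kq_zero; auto simp: rel_def kadd_def ksub_def fun_eq_iff algebra_simps)
  show "0 + a = a" unfolding plus_R1_def zero_R1_def
    by transfer (intro rel_eqI kq_add kq_sub kq_zero; auto simp: rel_def kadd_def ksub_def fun_eq_iff algebra_simps)
  show "- a + a = 0" unfolding plus_R1_def zero_R1_def uminus_R1_def
    by transfer (intro rel_eqI kq_add kq_sub kq_zero; auto simp: rel_def kadd_def ksub_def fun_eq_iff algebra_simps)
  show "a - b = a + - b" unfolding plus_R1_def zero_R1_def uminus_R1_def minus_R1_def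
    by transfer (intro rel_eqI kq_add kq_sub kq_zero; auto simp: rel_def kadd_def ksub_def fun_eq_iff algebra_simps)
qed
end

lift_definition r1_one :: "'k::field R1" is "\<lambda>p. if snd p = [] \<and> fst p \<in> vertices 1 then 1 else 0"
proof -
  have "{p :: path. (if snd p = [] \<and> fst p \<in> vertices 1 then 1 else (0::'k)) \<noteq> 0}
        \<subseteq> (\<lambda>v. (v, [])) ` vertices 1" by auto
  moreover have "vertices 1 \<subseteq> {0..7}"
    unfolding vertices_def vtx_def by (auto simp: Let_def)
  hence "finite (vertices 1)" by (rule finite_subset) simp
  ultimately have "kq 1 (\<lambda>p::path. if snd p = [] \<and> fst p \<in> vertices 1 then 1 else (0::'k))"
    unfolding kq_def valid_def by (auto intro: finite_subset split: if_splits)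
  then show "rel 1 (\<lambda>p::path. if snd p = [] \<and> fst p \<in> vertices 1 then 1 else (0::'k))
                   (\<lambda>p. if snd p = [] \<and> fst p \<in> vertices 1 then 1 else 0)"
    by (rule rel_eqI) simp
qed

text \<open>For a K-algebra A (scalar multiplication sc, multiplication mu), the t-cochains
  C^t(A,A) = Hom_K(A^{\<otimes>t}, A) are represented as the K-multilinear maps A^t -> A,
  encoded as functions on lists which vanish on lists of length different from t.\<close>
definition cochain :: "('k::field \<Rightarrow> 'a::ab_group_add \<Rightarrow> 'a) \<Rightarrow> nat \<Rightarrow> ('a list \<Rightarrow> 'a) \<Rightarrow> bool" where
  "cochain sc t f =
     ((\<forall>xs. length xs \<noteq> t \<longrightarrow> f xs = 0) \<and>
      (\<forall>xs i a b c. length xs = t \<and> i < t \<longrightarrow>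
          f (xs[i := a + b]) = f (xs[i := a]) + f (xs[i := b]) \<and>
          f (xs[i := sc c a]) = sc c (f (xs[i := a]))))"

definition sgnv :: "nat \<Rightarrow> 'a::ab_group_add \<Rightarrow> 'a" where
  "sgnv i v = (if even i then v else - v)"

definition hoch_d :: "('a::ab_group_add \<Rightarrow> 'a \<Rightarrow> 'a) \<Rightarrow> nat \<Rightarrow> ('a list \<Rightarrow> 'a) \<Rightarrow> 'a list \<Rightarrow> 'a" where
  "hoch_d mu t f xs =
     (if length xs = Suc t then
        mu (xs ! 0) (f (drop 1 xs))
        + (\<Sum>i\<in>{1..t}. sgnv i (f (take (i - 1) xs @ [mu (xs ! (i - 1)) (xs ! i)] @ drop (i + 1) xs)))
        + sgnv (t + 1) (mu (f (take t xs)) (xs ! t))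
      else 0)"

definition cocycles :: "('k::field \<Rightarrow> 'a::ab_group_add \<Rightarrow> 'a) \<Rightarrow> ('a \<Rightarrow> 'a \<Rightarrow> 'a) \<Rightarrow> nat \<Rightarrow> ('a list \<Rightarrow> 'a) set" where
  "cocycles sc mu t = {f. cochain sc t f \<and> hoch_d mu t f = (\<lambda>xs. 0)}"

definition coboundaries :: "('k::field \<Rightarrow> 'a::ab_group_add \<Rightarrow> 'a) \<Rightarrow> ('a \<Rightarrow> 'a \<Rightarrow> 'a) \<Rightarrow> nat \<Rightarrow> ('a list \<Rightarrow> 'a) set" where
  "coboundaries sc mu t =
     (if t = 0 then {\<lambda>xs. 0} else hoch_d mu (t - 1) ` {f. cochain sc (t - 1) f})"

definition cscale :: "('k::field \<Rightarrow> 'a::ab_group_add \<Rightarrow> 'a) \<Rightarrow> 'k \<Rightarrow> ('a list \<Rightarrow> 'a) \<Rightarrow> 'a list \<Rightarrow> 'a" where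
  "cscale sc c f = (\<lambda>xs. sc c (f xs))"

text \<open>dim_K HH^t(A) = dim_K (Z^t / B^t) = dim_K Z^t - dim_K B^t (all spaces are
  finite dimensional when A is).\<close>
definition HH_dim :: "('k::field \<Rightarrow> 'a::ab_group_add \<Rightarrow> 'a) \<Rightarrow> ('a \<Rightarrow> 'a \<Rightarrow> 'a) \<Rightarrow> nat \<Rightarrow> nat" where
  "HH_dim sc mu t =
     vector_space.dim (cscale sc) (cocycles sc mu t) - vector_space.dim (cscale sc) (coboundaries sc mu t)"

end

theory Submission
  imports Defs
begin

text \<open>
  The algebra \<open>A = R'\<^sub>1\<close> has a basis of 34 paths in which a product of basis elements is a basis
  element or \<open>0\<close>. Its minimal projective bimodule resolution \<open>P\<^sub>q\<close> is defined over the integers and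
  multiplicity free: \<open>P\<^sub>q\<close> is the sum of \<open>Ae\<^sub>i \<otimes> e\<^sub>jA\<close> over a set of pairs \<open>(i,j)\<close>. The eleventh
  syzygy of \<open>A\<close> is \<open>A\<close> twisted on the right by the automorphism swapping the two branches of the
  quiver, so the resolution has period 22.

  The bar complex is compared with this resolution through the double complex of multilinear maps
  \<open>A\<^sup>p \<rightarrow> Hom\<^sub>-\<^sub>A(P\<^sub>q, A)\<close>. Its rows are exact because \<open>P\<^sub>q \<rightarrow> A\<close> has a right linear contracting homotopy,
  its columns because \<open>Ae\<^sub>i\<close> is projective. Hence \<open>HH\<^sup>n(A)\<close> is the cohomology of the complex of the
  spaces \<open>\<Oplus> e\<^sub>iAe\<^sub>j\<close>. Over the integers the latter splits into complexes of rank one with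
  differentials \<open>1\<close>, \<open>3\<close> or \<open>4\<close>; the last two account for characteristic 3 and 2.
\<close>

section \<open>Dimensions of quotients and double complexes\<close>

text \<open>A right linear map out of \<open>Ae_i \<otimes> e_jA\<close> is determined by its values
  on the elements \<open>x \<otimes> e_j\<close>, so a cochain with values in
  \<open>Hom(P_q, A)\<close> is a multilinear function with one more argument. As no pair
  \<open>(i,j)\<close> repeats in \<open>P_q\<close>, the summands can share a single such function,
  and the whole double complex lives in one space of functions on lists, without tensor products or
  modules.

  The resolution enters as a table together with a homotopy: once \<open>d d = 0\<close> and
  \<open>d h + h d = 1\<close> are known as identities of integral tensors, exactness follows over
  every field at the same time. The period 22 leaves finitely many such identities, and they are
  decided by evaluation. Likewise the diagonal form of the final complex is certified by integral
  bases and their dual bases.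

  \<open>HH_dim\<close> subtracts two values of \<open>dim\<close>, which are cardinalities of bases
  and become 0 for infinite ones, so the cochain spaces must be shown to be finite dimensional
  before a comparison of quotients says anything about it.\<close>

locale kspace = vector_space scale for scale :: "'k::field \<Rightarrow> 'b::ab_group_add \<Rightarrow> 'b"
begin

text \<open>\<open>Z / B\<close> has dimension \<open>n\<close>. In contrast to a difference of values of \<^const>\<open>vector_space.dim\<close>, which is
  \<open>0\<close> on infinite dimensional spaces, this needs no finiteness assumption.\<close>

definition quot_dim :: "'b set \<Rightarrow> 'b set \<Rightarrow> nat \<Rightarrow> bool" where
  "quot_dim Z B n \<longleftrightarrow> (\<exists>I x. finite I \<and> card I = n \<and> (\<forall>i\<in>I. x (i::nat) \<in> Z) \<and>
     (\<forall>z\<in>Z. \<exists>u. z - (\<Sum>i\<in>I. scale (u i) (x i)) \<in> B) \<and>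
     (\<forall>u. (\<Sum>i\<in>I. scale (u i) (x i)) \<in> B \<longrightarrow> (\<forall>i\<in>I. u i = 0)))"

text \<open>A basis of \<open>B\<close> together with the representatives \<open>x i\<close> is a
  basis of \<open>Z\<close>. The spanning set \<open>S\<close> makes the basis of \<open>B\<close>
  finite; otherwise \<open>dim\<close> would be the cardinality 0 of an infinite set.\<close>

lemma quot_dim_imp_dim_diff:
  assumes Z: "subspace Z" and B: "subspace B" and BZ: "B \<subseteq> Z"
    and fin: "finite S" "B \<subseteq> span S" and q: "quot_dim Z B n"
  shows "dim Z - dim B = n"
proof -
  from q obtain I :: "nat set" and x where I: "finite I" "card I = n"
    and *: "\<forall>i\<in>I. x i \<in> Z" "\<forall>z\<in>Z. \<exists>u. z - (\<Sum>i\<in>I. scale (u i) (x i)) \<in> B"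
      "\<forall>u. (\<Sum>i\<in>I. scale (u i) (x i)) \<in> B \<longrightarrow> (\<forall>i\<in>I. u i = 0)"
    unfolding quot_dim_def by (elim exE conjE)
  note x = *(1)[rule_format] and sp = *(2)[rule_format] and ind = *(3)[rule_format]
  obtain b where b: "b \<subseteq> B" "independent b" "B \<subseteq> span b"
    by (rule maximal_independent_subset)
  have finb: "finite b"
    using independent_span_bound[OF fin(1) b(2) subset_trans[OF b(1) fin(2)]] by simp
  have spb: "span b = B" using span_minimal[OF b(1) B] b(3) by (rule subset_antisym)
  \<comment> \<open>The representatives form an indexed family while bases are sets, so repetitions
    have to be excluded; one would give the forbidden relation \<open>x i - x j = 0\<close>.\<close>
  have inj: "inj_on x I"
  proof (rule inj_onI, rule ccontr)
    fix i j assume ij: "i \<in> I" "j \<in> I" "x i = x j" "i \<noteq> j"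
    let ?u = "\<lambda>k. if k = i then 1 else if k = j then - 1 else 0 :: 'k"
    have "(\<Sum>k\<in>I. scale (?u k) (x k)) = (\<Sum>k\<in>{i,j}. scale (?u k) (x k))"
      using ij I by (intro sum.mono_neutral_right) auto
    also have "\<dots> = 0" using ij by simp
    finally have "?u i = 0" using ind[of ?u i] ij subspace_0[OF B] by simp
    then show False by simp
  qed
  have ind_x: "independent (x ` J \<union> b)" if "J \<subseteq> I" for J
    using finite_subset[OF that I(1)] that
  proof (induction J rule: finite_induct)
    case empty then show ?case using b by simp
  next
    case (insert j J)
    have "x j \<notin> span (x ` J \<union> b)"
    proof
      assume "x j \<in> span (x ` J \<union> b)"
      then obtain y z where yz: "x j = y + z" "y \<in> span (x ` J)" "z \<in> span b"
        unfolding span_Un by blast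
      have "inj_on x J" using inj insert.prems by (auto intro: inj_on_subset)
      obtain w where w: "y = (\<Sum>v\<in>x ` J. scale (w v) v)"
        using yz(2) span_finite[of "x ` J"] insert.hyps by auto
      then have y: "y = (\<Sum>k\<in>J. scale (w (x k)) (x k))"
        using \<open>inj_on x J\<close> by (simp add: sum.reindex)
      let ?u = "\<lambda>k. if k = j then 1 else if k \<in> J then - w (x k) else 0"
      have "(\<Sum>k\<in>I. scale (?u k) (x k)) = (\<Sum>k\<in>insert j J. scale (?u k) (x k))"
        using insert.prems I by (intro sum.mono_neutral_right) auto
      also have "\<dots> = x j + (\<Sum>k\<in>J. scale (?u k) (x k))"
        using insert.hyps by simp
      also have "(\<Sum>k\<in>J. scale (?u k) (x k)) = (\<Sum>k\<in>J. - scale (w (x k)) (x k))"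
        using insert.hyps by (intro sum.cong) auto
      also have "\<dots> = - y" unfolding y by (simp add: sum_negf)
      finally have "(\<Sum>k\<in>I. scale (?u k) (x k)) = z" using yz(1) by simp
      then have "?u j = 0" using ind[of ?u j] insert.prems yz(3) spb by auto
      then show False by simp
    qed
    then show ?case using insert independent_insertI[of "x j" "x ` J \<union> b"] by simp
  qed
  have disj: "x ` I \<inter> b = {}"
  proof (rule ccontr)
    assume "x ` I \<inter> b \<noteq> {}"
    then obtain i where i: "i \<in> I" "x i \<in> b" by auto
    let ?u = "\<lambda>k. if k = i then 1 else 0 :: 'k"
    have "(\<Sum>k\<in>I. scale (?u k) (x k)) = x i"
      using i I by (subst sum.mono_neutral_right[of "I" "{i}"]) auto
    then have "?u i = 0" using ind[of ?u i] i b(1) by auto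
    then show False by simp
  qed
  have "dim Z = card (x ` I \<union> b)"
  proof (rule dim_unique)
    show "x ` I \<union> b \<subseteq> Z" using x b(1) BZ by auto
    show "Z \<subseteq> span (x ` I \<union> b)"
    proof
      fix z assume "z \<in> Z"
      then obtain u where u: "z - (\<Sum>i\<in>I. scale (u i) (x i)) \<in> B" using sp by blast
      have "(\<Sum>i\<in>I. scale (u i) (x i)) \<in> span (x ` I \<union> b)"
        by (intro span_sum span_scale span_base) auto
      moreover have "z - (\<Sum>i\<in>I. scale (u i) (x i)) \<in> span (x ` I \<union> b)"
        using u spb span_mono[of b "x ` I \<union> b"] by auto
      ultimately have "(z - (\<Sum>i\<in>I. scale (u i) (x i))) + (\<Sum>i\<in>I. scale (u i) (x i)) \<in> span (x ` I \<union> b)"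
        by (intro span_add)
      then show "z \<in> span (x ` I \<union> b)" by simp
    qed
  qed (use ind_x in auto)
  also have "\<dots> = n + card b"
    using I finb disj inj by (simp add: card_Un_disjoint card_image)
  finally have "dim Z = n + card b" .
  moreover have "dim B = card b" by (rule dim_unique[OF b(1,3,2) refl])
  ultimately show ?thesis by simp
qed

text \<open>\<open>R\<close> is a linear relation instead of a map because a zigzag through a double
  complex involves choices. Totality in both directions and compatibility with \<open>B\<close> and
  \<open>B'\<close> make it induce an isomorphism of the quotients.\<close>

lemma quot_dim_transfer:
  assumes R: "\<And>(I :: nat set) u x y. finite I \<Longrightarrow> (\<And>i. i \<in> I \<Longrightarrow> R (x i) (y i)) \<Longrightarrow>
      R (\<Sum>i\<in>I. scale (u i) (x i)) (\<Sum>i\<in>I. scale (u i) (y i))"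
    and Rdiff: "\<And>x y x' y'. R x y \<Longrightarrow> R x' y' \<Longrightarrow> R (x - x') (y - y')"
    and fwd: "\<And>z. z \<in> Z \<Longrightarrow> \<exists>z'\<in>Z'. R z z'"
    and bwd: "\<And>z'. z' \<in> Z' \<Longrightarrow> \<exists>z\<in>Z. R z z'"
    and B: "\<And>z z'. R z z' \<Longrightarrow> z \<in> B \<longleftrightarrow> z' \<in> B'"
    and q: "quot_dim Z B n"
  shows "quot_dim Z' B' n"
proof -
  from q obtain I :: "nat set" and x where I: "finite I" "card I = n"
    and *: "\<forall>i\<in>I. x i \<in> Z" "\<forall>z\<in>Z. \<exists>u. z - (\<Sum>i\<in>I. scale (u i) (x i)) \<in> B"
      "\<forall>u. (\<Sum>i\<in>I. scale (u i) (x i)) \<in> B \<longrightarrow> (\<forall>i\<in>I. u i = 0)"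
    unfolding quot_dim_def by (elim exE conjE)
  note x = *(1)[rule_format] and sp = *(2)[rule_format] and ind = *(3)[rule_format]
  have "\<forall>i. \<exists>y. i \<in> I \<longrightarrow> y \<in> Z' \<and> R (x i) y" using x fwd by blast
  then obtain y where y: "\<And>i. i \<in> I \<Longrightarrow> y i \<in> Z' \<and> R (x i) (y i)" by metis
  then have Ry: "R (\<Sum>i\<in>I. scale (u i) (x i)) (\<Sum>i\<in>I. scale (u i) (y i))" for u
    using I by (intro R) auto
  show ?thesis unfolding quot_dim_def
  proof (intro exI[of _ I] exI[of _ y] conjI ballI allI impI)
    fix z' assume "z' \<in> Z'"
    then obtain z where z: "z \<in> Z" "R z z'" using bwd by blast
    then obtain u where "z - (\<Sum>i\<in>I. scale (u i) (x i)) \<in> B" using sp by blast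
    then have "z' - (\<Sum>i\<in>I. scale (u i) (y i)) \<in> B'" using B[OF Rdiff[OF z(2) Ry]] by blast
    then show "\<exists>u. z' - (\<Sum>i\<in>I. scale (u i) (y i)) \<in> B'" by blast
  next
    fix u i assume "(\<Sum>i\<in>I. scale (u i) (y i)) \<in> B'" "i \<in> I"
    then show "u i = 0" using ind B[OF Ry] by blast
  qed (use y I in auto)
qed

text \<open>Each functional costs at most one dimension: \<open>S\<close> is spanned by the kernel
  of one functional and a single vector outside of it.\<close>

lemma finite_span_of_separating_functionals:
  assumes "finite I" and "subspace S"
    and "\<And>i x y. i \<in> I \<Longrightarrow> \<phi> i (x + y) = \<phi> i x + (\<phi> i y :: 'k)"
    and "\<And>i c x. i \<in> I \<Longrightarrow> \<phi> i (scale c x) = c * \<phi> i x"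
    and "\<And>x. x \<in> S \<Longrightarrow> (\<And>i. i \<in> I \<Longrightarrow> \<phi> i x = 0) \<Longrightarrow> x = 0"
  shows "\<exists>T. finite T \<and> S \<subseteq> span T"
  using assms
proof (induction I arbitrary: S rule: finite_induct)
  case empty
  then have "S \<subseteq> span {}" by auto
  then show ?case by blast
next
  case (insert i I)
  let ?S = "{x \<in> S. \<phi> i x = 0}"
  have z: "\<phi> i 0 = 0" using insert.prems(3)[of i 0 0] by simp
  have "subspace ?S"
    using insert.prems(1) by (auto simp: subspace_def insert.prems(2,3) z)
  moreover have "x = 0" if "x \<in> ?S" "\<And>j. j \<in> I \<Longrightarrow> \<phi> j x = 0" for x
    using insert.prems(4)[of x] that by auto
  ultimately obtain T where T: "finite T" "?S \<subseteq> span T"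
    using insert.IH[of ?S] insert.prems(2,3) by auto
  show ?case
  proof (cases "S \<subseteq> ?S")
    case True then show ?thesis using T by blast
  next
    case False
    then obtain s where s: "s \<in> S" "\<phi> i s \<noteq> 0" by auto
    have "x \<in> span (insert s T)" if x: "x \<in> S" for x
    proof -
      let ?c = "\<phi> i x / \<phi> i s"
      have "\<phi> i (x + scale (- ?c) s) = 0"
        using s by (simp add: insert.prems(2,3) del: scale_minus_left)
      moreover have "x + scale (- ?c) s \<in> S"
        using x s insert.prems(1) by (simp add: subspace_def del: scale_minus_left)
      ultimately have "x + scale (- ?c) s \<in> span (insert s T)"
        using T(2) span_mono[of T "insert s T"] by blast
      moreover have "scale ?c s \<in> span (insert s T)" by (simp add: span_base span_scale)
      ultimately have "(x + scale (- ?c) s) + scale ?c s \<in> span (insert s T)" by (rule span_add)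
      then show ?thesis by (simp add: scale_minus_left)
    qed
    then show ?thesis using T(1) by (intro exI[of _ "insert s T"]) auto
  qed
qed

text \<open>Both spaces are coordinate subspaces for the independent family \<open>X\<close>, with
  index sets \<open>I \<union> T\<close> and \<open>T\<close>, so the vectors with index in
  \<open>I\<close> represent a basis of the quotient.\<close>

lemma quot_dim_span:
  fixes X :: "nat \<Rightarrow> 'b"
  assumes ind: "\<And>u. (\<Sum>i<n. scale (u i) (X i)) = 0 \<Longrightarrow> \<forall>i<n. u i = 0"
    and IT: "I \<union> T \<subseteq> {..<n}" "I \<inter> T = {}"
    and Z: "Z = {(\<Sum>i<n. scale (u i) (X i)) | u. \<forall>i<n. i \<notin> I \<union> T \<longrightarrow> u i = 0}"
    and B: "B = {(\<Sum>i<n. scale (u i) (X i)) | u. \<forall>i<n. i \<notin> T \<longrightarrow> u i = 0}"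
  shows "quot_dim Z B (card I)"
proof -
  have I: "finite I" using IT finite_subset by blast
  have ext: "(\<Sum>i\<in>I. scale (u i) (X i)) = (\<Sum>i<n. scale (if i \<in> I then u i else 0) (X i))" for u
    using IT by (intro sum.mono_neutral_cong_left) auto
  have eq: "\<forall>i<n. u i = v i" if "(\<Sum>i<n. scale (u i) (X i)) = (\<Sum>i<n. scale (v i) (X i))" for u v
    using ind[of "\<lambda>i. u i - v i"] that by (simp add: scale_left_diff_distrib sum_subtractf)
  show ?thesis unfolding quot_dim_def
  proof (intro exI[of _ I] exI[of _ X] conjI ballI allI impI I refl)
    fix i assume i: "i \<in> I"
    have "X i = (\<Sum>j\<in>I. scale (if j = i then 1 else 0) (X j))"
      using i I by (simp add: if_distrib[of "\<lambda>c. scale c _"] cong: if_cong)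
    also note ext
    finally show "X i \<in> Z" unfolding Z by fastforce
  next
    fix z assume "z \<in> Z"
    then obtain u where u: "z = (\<Sum>i<n. scale (u i) (X i))" "\<forall>i<n. i \<notin> I \<union> T \<longrightarrow> u i = 0"
      unfolding Z by blast
    have "z - (\<Sum>i\<in>I. scale (u i) (X i)) = (\<Sum>i<n. scale (u i - (if i \<in> I then u i else 0)) (X i))"
      unfolding u(1) ext by (simp add: scale_left_diff_distrib sum_subtractf)
    also have "\<dots> \<in> B"
      unfolding B using u(2) by (auto intro!: exI[of _ "\<lambda>i. u i - (if i \<in> I then u i else 0)"])
    finally show "\<exists>u. z - (\<Sum>i\<in>I. scale (u i) (X i)) \<in> B" by blast
  next
    fix u i assume "(\<Sum>i\<in>I. scale (u i) (X i)) \<in> B" and i: "i \<in> I"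
    then obtain v where v: "(\<Sum>i\<in>I. scale (u i) (X i)) = (\<Sum>i<n. scale (v i) (X i))"
        "\<forall>i<n. i \<notin> T \<longrightarrow> v i = 0" unfolding B by blast
    have "i < n" "i \<notin> T" using i IT by auto
    with eq[OF v(1)[unfolded ext]] v(2) i show "u i = 0" by auto
  qed
qed

end

section \<open>Double complexes with exact rows and columns\<close>

locale double_complex = kspace scale
  for scale :: "'k::field \<Rightarrow> 'b::ab_group_add \<Rightarrow> 'b" +
  fixes C :: "nat \<Rightarrow> nat \<Rightarrow> 'b set" and \<delta> d :: "nat \<Rightarrow> nat \<Rightarrow> 'b \<Rightarrow> 'b"
  assumes C: "subspace (C p q)"
    and \<delta>_lin: "Vector_Spaces.linear scale scale (\<delta> p q)" and d_lin: "Vector_Spaces.linear scale scale (d p q)"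
    and \<delta>_C: "x \<in> C p q \<Longrightarrow> \<delta> p q x \<in> C (Suc p) q"
    and d_C: "x \<in> C p q \<Longrightarrow> d p q x \<in> C p (Suc q)"
    and \<delta>\<delta>: "x \<in> C p q \<Longrightarrow> \<delta> (Suc p) q (\<delta> p q x) = 0"
    and dd: "x \<in> C p q \<Longrightarrow> d p (Suc q) (d p q x) = 0"
    and \<delta>d: "x \<in> C p q \<Longrightarrow> \<delta> p (Suc q) (d p q x) = d (Suc p) q (\<delta> p q x)"
    and \<delta>_exact: "x \<in> C (Suc p) q \<Longrightarrow> \<delta> (Suc p) q x = 0 \<Longrightarrow> \<exists>y\<in>C p q. \<delta> p q y = x"
    and d_exact: "x \<in> C p (Suc q) \<Longrightarrow> d p (Suc q) x = 0 \<Longrightarrow> \<exists>y\<in>C p q. d p q y = x"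
begin

definition Z :: "nat \<Rightarrow> nat \<Rightarrow> 'b set" where
  "Z p q = {x \<in> C p q. \<delta> p q x = 0 \<and> d p q x = 0}"

text \<open>Away from the edges the image of \<open>ker d\<close> under \<open>\<delta>\<close> and
  the image of \<open>ker \<delta>\<close> under \<open>d\<close> coincide by exactness, so either
  may serve as the boundaries. The second one is chosen only for \<open>p = 0\<close>, where no
  \<open>\<delta>\<close> comes in.\<close>

fun B :: "nat \<Rightarrow> nat \<Rightarrow> 'b set" where
  "B 0 0 = {0}"
| "B 0 (Suc q) = d 0 q ` {y \<in> C 0 q. \<delta> 0 q y = 0}"
| "B (Suc p) q = \<delta> p q ` {y \<in> C p q. d p q y = 0}"

text \<open>The zigzag \<open>d y \<leftarrow> y \<rightarrow> \<delta> y\<close> identifies the two quotients.\<close>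

lemma quot_dim_shift:
  assumes "quot_dim (Z p (Suc q)) (B p (Suc q)) n"
  shows "quot_dim (Z (Suc p) q) (B (Suc p) q) n"
proof (rule quot_dim_transfer[where R = "\<lambda>z x. z \<in> Z p (Suc q) \<and> x \<in> Z (Suc p) q \<and>
    (\<exists>y\<in>C p q. \<delta> p q y = x \<and> d p q y = z)" and Z = "Z p (Suc q)" and B = "B p (Suc q)"], goal_cases)
  interpret \<delta>: Vector_Spaces.linear scale scale "\<delta> a b" for a b by (rule \<delta>_lin)
  interpret d: Vector_Spaces.linear scale scale "d a b" for a b by (rule d_lin)
  have Zsum: "(\<Sum>i\<in>I. scale (u i) (x i)) \<in> Z p q" if "\<And>i. i \<in> I \<Longrightarrow> x i \<in> Z p q" for p q u x and I :: "nat set"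
  proof -
    have "(\<Sum>i\<in>I. scale (u i) (x i)) \<in> C p q"
      using that by (intro subspace_sum[OF C] subspace_scale[OF C]) (simp add: Z_def)
    then show ?thesis using that by (simp add: Z_def \<delta>.sum d.sum \<delta>.scale d.scale)
  qed
  {
    case (1 I u x y)
    have "\<forall>i\<in>I. \<exists>w. w \<in> C p q \<and> \<delta> p q w = y i \<and> d p q w = x i"
      using 1(2)[THEN conjunct2, THEN conjunct2] by fast
    from bchoice[OF this] obtain w
      where w: "\<And>i. i \<in> I \<Longrightarrow> w i \<in> C p q \<and> \<delta> p q (w i) = y i \<and> d p q (w i) = x i"
      by blast
    then have "(\<Sum>i\<in>I. scale (u i) (w i)) \<in> C p q"
      by (intro subspace_sum[OF C] subspace_scale[OF C]) blast
    moreover have "\<delta> p q (\<Sum>i\<in>I. scale (u i) (w i)) = (\<Sum>i\<in>I. scale (u i) (y i))"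
      "d p q (\<Sum>i\<in>I. scale (u i) (w i)) = (\<Sum>i\<in>I. scale (u i) (x i))"
      using w by (auto simp: \<delta>.sum d.sum \<delta>.scale d.scale)
    moreover have "(\<Sum>i\<in>I. scale (u i) (x i)) \<in> Z p (Suc q)" "(\<Sum>i\<in>I. scale (u i) (y i)) \<in> Z (Suc p) q"
      using 1(2) by (auto intro!: Zsum)
    ultimately show ?case by blast
  next
    case (2 x y x' y')
    then obtain w w' where w: "w \<in> C p q" "\<delta> p q w = y" "d p q w = x"
       "w' \<in> C p q" "\<delta> p q w' = y'" "d p q w' = x'" by blast
    then have "w - w' \<in> C p q" "\<delta> p q (w - w') = y - y'" "d p q (w - w') = x - x'"
      by (auto simp: \<delta>.diff d.diff subspace_diff[OF C])
    moreover have "x - x' \<in> Z p (Suc q)" "y - y' \<in> Z (Suc p) q"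
      using 2 by (auto simp: Z_def \<delta>.diff d.diff subspace_diff[OF C])
    ultimately show ?case by blast
  next
    case (3 z)
    then obtain y where y: "y \<in> C p q" "d p q y = z" using d_exact[of z p q] by (auto simp: Z_def)
    then have "\<delta> p q y \<in> Z (Suc p) q"
      using 3 \<delta>d[of y p q] by (auto simp: Z_def \<delta>_C \<delta>\<delta>)
    with y 3 show ?case by blast
  next
    case (4 x)
    then obtain y where y: "y \<in> C p q" "\<delta> p q y = x" using \<delta>_exact[of x p q] by (auto simp: Z_def)
    then have "d p q y \<in> Z p (Suc q)"
      using 4 \<delta>d[of y p q] by (auto simp: Z_def d_C dd)
    with y 4 show ?case by blast
  next
    case (5 z x)
    then obtain y where y: "y \<in> C p q" "\<delta> p q y = x" "d p q y = z" by blast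
    show ?case
    proof
      assume "z \<in> B p (Suc q)"
      then obtain w where w: "w \<in> C p q" "\<delta> p q w = 0" "d p q w = z"
      proof (cases p)
        case 0
        with \<open>z \<in> B p (Suc q)\<close> obtain w where "w \<in> C p q" "\<delta> p q w = 0" "z = d p q w" by auto
        then show thesis by (intro that[of w]) auto
      next
        \<comment> \<open>Here the boundary is given as \<open>\<delta>\<close> of a
          \<open>d\<close>-cocycle; lifting that cocycle through \<open>d\<close> and commuting the
          square rewrites it as \<open>d\<close> of a \<open>\<delta>\<close>-cocycle.\<close>
        case (Suc p')
        with \<open>z \<in> B p (Suc q)\<close> obtain u where u: "u \<in> C p' (Suc q)" "d p' (Suc q) u = 0" "z = \<delta> p' (Suc q) u"
          by auto
        then obtain v where v: "v \<in> C p' q" "d p' q v = u" using d_exact by blast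
        have "\<delta> p' q v \<in> C p q" "\<delta> p q (\<delta> p' q v) = 0" "d p q (\<delta> p' q v) = z"
          using v u Suc \<delta>d[of v p' q] by (simp_all add: \<delta>\<delta> \<delta>_C)
        then show thesis by (rule that)
      qed
      then have "d p q (y - w) = 0" "\<delta> p q (y - w) = x" "y - w \<in> C p q"
        using y by (auto simp: d.diff \<delta>.diff subspace_diff[OF C])
      then have "x \<in> \<delta> p q ` {y \<in> C p q. d p q y = 0}" by (intro image_eqI[of _ _ "y - w"]) simp_all
      then show "x \<in> B (Suc p) q" by simp
    next
      assume "x \<in> B (Suc p) q"
      then obtain w where w: "w \<in> C p q" "d p q w = 0" "x = \<delta> p q w" by auto
      let ?w = "y - w"
      have v: "?w \<in> C p q" "\<delta> p q ?w = 0" "d p q ?w = z"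
        using y w by (auto simp: d.diff \<delta>.diff subspace_diff[OF C])
      show "z \<in> B p (Suc q)"
      proof (cases p)
        case 0
        then have "z \<in> d 0 q ` {y \<in> C 0 q. \<delta> 0 q y = 0}" using v by (intro image_eqI[of _ _ ?w]) simp_all
        then show ?thesis using 0 by simp
      next
        case (Suc p')
        then obtain v' where v': "v' \<in> C p' q" "\<delta> p' q v' = ?w" using \<delta>_exact v by blast
        then have "z = \<delta> p' (Suc q) (d p' q v')" using \<delta>d[of v' p' q] v Suc by simp
        moreover have "d p' q v' \<in> {y \<in> C p' (Suc q). d p' (Suc q) y = 0}" using v' by (simp add: d_C dd)
        ultimately show ?thesis using Suc by auto
      qed
    qed
  }
qed (rule assms)

text \<open>The shift keeps \<open>p + q\<close> fixed, so \<open>n\<close> shifts lead along an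
  antidiagonal from one edge of the double complex to the other.\<close>

lemma quot_dim_row_column:
  assumes "quot_dim (Z 0 n) (B 0 n) k" shows "quot_dim (Z n 0) (B n 0) k"
proof -
  have "p \<le> n \<Longrightarrow> quot_dim (Z p (n - p)) (B p (n - p)) k" for p
  proof (induction p)
    case (Suc p)
    then have "n - p = Suc (n - Suc p)" by simp
    with Suc have "quot_dim (Z p (Suc (n - Suc p))) (B p (Suc (n - Suc p))) k" by (metis Suc_leD)
    then show ?case by (rule quot_dim_shift)
  qed (use assms in simp)
  from this[of n] show ?thesis by simp
qed

end

section \<open>The bar complex and bimodule resolutions\<close>

text \<open>The alternating sum of the inner faces, starting with a plus sign, hence opposite to the
  inner sum in \<open>hoch_d\<close>. Recursion on the list replaces the positions and the
  \<open>take\<close> and \<open>drop\<close> pieces used there.\<close>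

fun merge_sum :: "('a::ring_1 list \<Rightarrow> 'a) \<Rightarrow> 'a list \<Rightarrow> 'a" where
  "merge_sum f [] = 0"
| "merge_sum f [a] = 0"
| "merge_sum f (a # b # L) = f (a * b # L) - merge_sum (\<lambda>K. f (a # K)) (b # L)"

text \<open>The bar differential without its last face: for coefficients in \<open>Hom\<^sub>K(X, M)\<close> the right action is
  absorbed by treating the argument in \<open>X\<close> as the last entry of the list.\<close>

fun left_d :: "('a::ring_1 list \<Rightarrow> 'a) \<Rightarrow> 'a list \<Rightarrow> 'a" where
  "left_d f [] = 0"
| "left_d f (a # L) = a * f L - merge_sum f (a # L)"

lemma merge_sum_cong:
  "(\<And>K. Suc (length K) = length L \<Longrightarrow> f K = g K) \<Longrightarrow> merge_sum f L = merge_sum g L"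
  by (induction f L arbitrary: g rule: merge_sum.induct) auto

lemma left_d_cong:
  "(\<And>K. Suc (length K) = length L \<Longrightarrow> f K = g K) \<Longrightarrow> left_d f L = left_d g L"
  by (cases L) (auto intro: merge_sum_cong)

lemma merge_sum_add: "merge_sum (\<lambda>K. f K + g K) L = merge_sum f L + merge_sum g L"
  by (induction f L arbitrary: g rule: merge_sum.induct) (simp_all add: add_diff_add)

lemma merge_sum_diff: "merge_sum (\<lambda>K. f K - g K) L = merge_sum f L - merge_sum g L"
  by (induction f L arbitrary: g rule: merge_sum.induct) (auto simp: algebra_simps)

lemma merge_sum_0: "merge_sum (\<lambda>K. 0) L = 0"
  using merge_sum_diff[of "\<lambda>K. 0" "\<lambda>K. 0" L] by simp

lemma merge_sum_uminus: "merge_sum (\<lambda>K. - f K) L = - merge_sum f L"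
  using merge_sum_diff[of "\<lambda>K. 0" f L] by (simp add: merge_sum_0)

lemma merge_sum_mult_left: "merge_sum (\<lambda>K. x * f K) L = x * merge_sum f L"
  by (induction f L rule: merge_sum.induct) (auto simp: algebra_simps)

lemma merge_sum_mult_right: "merge_sum (\<lambda>K. f K * x) L = merge_sum f L * x"
  by (induction f L rule: merge_sum.induct) (auto simp: algebra_simps)

lemma left_d_add: "left_d (\<lambda>K. f K + g K) L = left_d f L + left_d g L"
  by (cases L) (auto simp: algebra_simps merge_sum_add)

lemma left_d_0: "left_d (\<lambda>K. 0) L = 0"
  by (cases L) (auto simp: merge_sum_0)

lemma left_d_uminus: "left_d (\<lambda>K. - f K) L = - left_d f L"
  by (cases L) (auto simp: merge_sum_uminus)

lemma left_d_mult_right: "left_d (\<lambda>K. f K * x) L = left_d f L * x"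
  by (cases L) (auto simp: algebra_simps merge_sum_mult_right)

lemma left_d_sum: "left_d (\<lambda>K. \<Sum>i\<in>I. f i K) L = (\<Sum>i\<in>I. left_d (f i) L)"
  by (induction I rule: infinite_finite_induct) (auto simp: left_d_0 left_d_add)

lemma left_d_sum_list: "left_d (\<lambda>K. \<Sum>t\<leftarrow>ts. f t K) L = (\<Sum>t\<leftarrow>ts. left_d (f t) L)"
  by (induction ts) (auto simp: left_d_0 left_d_add)

lemma left_d_sgnv: "left_d (\<lambda>K. sgnv n (f K)) L = sgnv n (left_d f L)"
  by (simp add: sgnv_def left_d_uminus)

text \<open>The simplicial identities for the inner faces: merges of disjoint pairs cancel in the
  two possible orders, and the two ways to merge three consecutive entries agree by
  associativity.\<close>

lemma merge_sum_merge_sum: "merge_sum (merge_sum f) L = 0"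
proof (induction L arbitrary: f rule: induct_list012)
  case (3 a b L)
  show ?case
  proof (cases L)
    case (Cons c K)
    have "merge_sum (merge_sum (\<lambda>K. f (a # K))) (b # c # K) = 0"
      using 3 Cons by blast
    then show ?thesis using Cons
      by (simp add: merge_sum_diff mult.assoc)
  qed simp
qed simp_all

lemma left_d_left_d: "left_d (left_d f) L = 0"
proof (cases L)
  case (Cons a K)
  show ?thesis
  proof (cases K)
    case (Cons b M)
    have "merge_sum (merge_sum f) (a # b # M) = 0" by (rule merge_sum_merge_sum)
    then show ?thesis using \<open>L = a # K\<close> Cons
      by (simp add: merge_sum_diff merge_sum_mult_left algebra_simps)
  qed (simp add: Cons)
qed simp

lemma merge_sum_mult_last:
  "K \<noteq> [] \<Longrightarrow> merge_sum (\<lambda>L. f (butlast L @ [last L * u])) K = merge_sum f (butlast K @ [last K * u])"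
proof (induction K arbitrary: f rule: induct_list012)
  case (3 a b K)
  show ?case
  proof (cases K)
    case Nil then show ?thesis by (simp add: mult.assoc)
  next
    case (Cons c M)
    have "merge_sum (\<lambda>L. f (butlast (a # L) @ [last (a # L) * u])) (b # K)
        = merge_sum (\<lambda>L. f (a # butlast L @ [last L * u])) (b # K)"
      by (rule merge_sum_cong) (auto simp: Cons)
    also have "\<dots> = merge_sum (\<lambda>K. f (a # K)) (butlast (b # K) @ [last (b # K) * u])"
      using 3(2)[of "\<lambda>K. f (a # K)"] by simp
    finally show ?thesis by (simp add: Cons)
  qed
qed simp_all

text \<open>The faces of \<open>left_d\<close> touch the last entry only by multiplying it from the
  left, so they commute with right multiplication by \<open>u\<close>. In a list with one entry the
  outer face would remove that entry, which explains the bound on the length.\<close>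

lemma left_d_mult_last:
  assumes "length K \<ge> 2"
  shows "left_d (\<lambda>L. f (butlast L @ [last L * u])) K = left_d f (butlast K @ [last K * u])"
proof -
  obtain a b M where "K = a # b # M" using assms by (auto simp: numeral_2_eq_2 Suc_le_length_iff)
  then show ?thesis using merge_sum_mult_last[of K f u] by simp
qed

lemma merge_sum_snoc:
  "merge_sum f (L @ [x, y]) = merge_sum (\<lambda>K. f (K @ [y])) (L @ [x]) + sgnv (length L) (f (L @ [x * y]))"
proof (induction L arbitrary: f rule: induct_list012)
  case (3 a b L)
  from 3(2)[of "\<lambda>K. f (a # K)"] show ?case by (simp add: sgnv_def)
qed (simp_all add: sgnv_def)

lemma hoch_d_merges:
  assumes "length xs = Suc t"
  shows "(\<Sum>i\<in>{1..t}. sgnv i (f (take (i - 1) xs @ [xs ! (i - 1) * xs ! i] @ drop (i + 1) xs)))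
    = - merge_sum f xs"
  using assms
proof (induction xs arbitrary: t f rule: induct_list012)
  case (3 a b L)
  then obtain t' where t: "t = Suc t'" by (cases t) auto
  let ?xs = "a # b # L"
  have "(\<Sum>i\<in>{1..t}. sgnv i (f (take (i - 1) ?xs @ [?xs ! (i - 1) * ?xs ! i] @ drop (i + 1) ?xs)))
     = - f (a * b # L) + (\<Sum>i\<in>{Suc 1..Suc t'}. sgnv i (f (take (i - 1) ?xs @ [?xs ! (i - 1) * ?xs ! i] @ drop (i + 1) ?xs)))"
    unfolding t by (subst sum.atLeast_Suc_atMost) (auto simp: sgnv_def)
  also have "(\<Sum>i\<in>{Suc 1..Suc t'}. sgnv i (f (take (i - 1) ?xs @ [?xs ! (i - 1) * ?xs ! i] @ drop (i + 1) ?xs)))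
     = (\<Sum>i\<in>{1..t'}. - sgnv i (f (a # (take (i - 1) (b # L) @ [(b # L) ! (i - 1) * (b # L) ! i] @ drop (i + 1) (b # L)))))"
    unfolding sum.shift_bounds_cl_Suc_ivl
  proof (rule sum.cong)
    fix i assume "i \<in> {1..t'}"
    then obtain j where "i = Suc j" by (cases i) auto
    then show "sgnv (Suc i) (f (take (Suc i - 1) ?xs @ [?xs ! (Suc i - 1) * ?xs ! Suc i] @ drop (Suc i + 1) ?xs)) =
         - sgnv i (f (a # (take (i - 1) (b # L) @ [(b # L) ! (i - 1) * (b # L) ! i] @ drop (i + 1) (b # L))))"
      by (simp add: sgnv_def)
  qed simp
  also have "\<dots> = - (\<Sum>i\<in>{1..t'}. sgnv i (f (a # (take (i - 1) (b # L) @ [(b # L) ! (i - 1) * (b # L) ! i] @ drop (i + 1) (b # L)))))"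
    by (rule sum_negf)
  also have "(\<Sum>i\<in>{1..t'}. sgnv i (f (a # (take (i - 1) (b # L) @ [(b # L) ! (i - 1) * (b # L) ! i] @ drop (i + 1) (b # L)))))
      = - merge_sum (\<lambda>K. f (a # K)) (b # L)"
    by (rule 3(2)[of t' "\<lambda>K. f (a # K)"]) (use 3(3) t in simp)
  finally show ?case by simp
qed simp_all

lemma hoch_d_snoc:
  assumes "length L = t"
  shows "hoch_d (*) t f (L @ [x]) = left_d f (L @ [x]) + sgnv (Suc t) (f L * x)"
proof -
  have "hoch_d (*) t f (L @ [x]) = (L @ [x]) ! 0 * f (drop 1 (L @ [x])) - merge_sum f (L @ [x])
      + sgnv (Suc t) (f L * x)"
    unfolding hoch_d_def using assms by (subst hoch_d_merges) auto
  also have "(L @ [x]) ! 0 * f (drop 1 (L @ [x])) - merge_sum f (L @ [x]) = left_d f (L @ [x])"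
    by (cases L) auto
  finally show ?thesis .
qed

text \<open>The augmentation of the double complex: \<open>f L\<close> is read as the right linear
  map \<open>x \<mapsto> f L * x\<close> on \<open>A\<close>, composed with the multiplication map
  \<open>P_0 \<rightarrow> A\<close>.\<close>

definition tensor_last :: "('a::ring_1 list \<Rightarrow> 'a) \<Rightarrow> 'a list \<Rightarrow> 'a" where
  "tensor_last f L = (if L = [] then 0 else f (butlast L) * last L)"

text \<open>The last face \<open>f K * x\<close> of \<open>hoch_d\<close>, once multiplied by a
  further last entry \<open>y\<close>, is the face that merges \<open>x\<close> and
  \<open>y\<close>; all other faces correspond directly.\<close>

lemma left_d_tensor_last:
  assumes "\<And>xs. length xs \<noteq> t \<Longrightarrow> f xs = 0"
  shows "left_d (tensor_last f) L = tensor_last (hoch_d (*) t f) L"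
proof (cases "length L = Suc (Suc t)")
  case True
  then obtain M y where M: "L = M @ [y]" "length M = Suc t" by (cases L rule: rev_cases) auto
  then obtain K x where "M = K @ [x]" "length K = t" by (cases M rule: rev_cases) auto
  with M have L: "L = K @ [x, y]" "length K = t" by simp_all
  have "left_d (tensor_last f) L = hd L * tensor_last f (tl L) - merge_sum (tensor_last f) L"
    using L by (cases K) auto
  also have "merge_sum (tensor_last f) L = merge_sum f (K @ [x]) * y + sgnv t (f K * (x * y))"
    unfolding L merge_sum_snoc using L by (simp add: tensor_last_def merge_sum_mult_right)
  also have "hd L * tensor_last f (tl L) = hd (K @ [x]) * f (tl (K @ [x])) * y"
    using L by (cases K) (auto simp: tensor_last_def mult.assoc butlast_append)
  also have "hd (K @ [x]) * f (tl (K @ [x])) * y - (merge_sum f (K @ [x]) * y + sgnv t (f K * (x * y)))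
    = (left_d f (K @ [x]) + sgnv (Suc t) (f K * x)) * y"
    by (cases K) (auto simp: algebra_simps sgnv_def)
  also have "\<dots> = hoch_d (*) t f (K @ [x]) * y" using hoch_d_snoc[OF L(2), of f x] by simp
  also have "\<dots> = tensor_last (hoch_d (*) t f) L"
    unfolding L by (simp add: tensor_last_def butlast_append)
  finally show ?thesis .
next
  case False
  have "left_d (tensor_last f) L = left_d (\<lambda>K. 0) L"
  proof (rule left_d_cong)
    fix K :: "'a list" assume "Suc (length K) = length L"
    with False assms[of "butlast K"] show "tensor_last f K = 0"
      by (cases K rule: rev_cases) (auto simp: tensor_last_def)
  qed
  also have "\<dots> = tensor_last (hoch_d (*) t f) L"
    using False by (auto simp: left_d_0 tensor_last_def hoch_d_def)
  finally show ?thesis .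
qed

section \<open>Multilinear cochains over an algebra\<close>

locale kalgebra =
  fixes sc :: "'k::field \<Rightarrow> 'a::ring_1 \<Rightarrow> 'a"
  assumes vector_space_sc: "vector_space sc"
    and sc_mult_left: "sc c (x * y) = sc c x * y" and sc_mult_right: "sc c (x * y) = x * sc c y"
begin

sublocale A: kspace sc by (simp add: kspace_def vector_space_sc)

definition lin :: "('a \<Rightarrow> 'a) \<Rightarrow> bool" where
  "lin f \<longleftrightarrow> (\<forall>a b. f (a + b) = f a + f b) \<and> (\<forall>c a. f (sc c a) = sc c (f a))"

lemma lin_0: "lin (\<lambda>a. 0)" by (simp add: lin_def)

lemma lin_add: "lin f \<Longrightarrow> lin g \<Longrightarrow> lin (\<lambda>a. f a + g a)"
  by (simp add: lin_def A.scale_right_distrib algebra_simps)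

lemma lin_diff: "lin f \<Longrightarrow> lin g \<Longrightarrow> lin (\<lambda>a. f a - g a)"
  by (simp add: lin_def A.scale_right_diff_distrib algebra_simps)

lemma lin_sgnv: "lin f \<Longrightarrow> lin (\<lambda>a. sgnv n (f a))"
  by (simp add: lin_def sgnv_def A.scale_minus_right)

lemma lin_scale: "lin f \<Longrightarrow> lin (\<lambda>a. sc c (f a))"
  by (simp add: lin_def A.scale_right_distrib mult.commute)

lemma lin_mult: "lin f \<Longrightarrow> lin (\<lambda>a. x * f a * y)"
  by (simp add: lin_def algebra_simps sc_mult_right[symmetric] sc_mult_left[symmetric])

lemma lin_mult_left: "lin f \<Longrightarrow> lin (\<lambda>a. x * f a)"
  using lin_mult[of f x 1] by simp

lemma lin_mult_right: "lin f \<Longrightarrow> lin (\<lambda>a. f a * x)"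
  using lin_mult[of f 1 x] by simp

lemma lin_comp_mult: "lin f \<Longrightarrow> lin (\<lambda>a. f (x * a * y))"
  by (simp add: lin_def algebra_simps sc_mult_right[symmetric] sc_mult_left[symmetric])

lemma lin_comp_mult_left: "lin f \<Longrightarrow> lin (\<lambda>a. f (x * a))"
  using lin_comp_mult[of f x 1] by simp

lemma lin_comp_mult_right: "lin f \<Longrightarrow> lin (\<lambda>a. f (a * x))"
  using lin_comp_mult[of f 1 x] by simp

lemma lin_id: "lin (\<lambda>a. a)" by (simp add: lin_def)

lemma lin_sum: "(\<And>i. i \<in> I \<Longrightarrow> lin (f i)) \<Longrightarrow> lin (\<lambda>a. \<Sum>i\<in>I. f i a)"
  by (induction I rule: infinite_finite_induct) (auto simp: lin_0 lin_add)

lemma lin_sum_list: "(\<And>t. t \<in> set ts \<Longrightarrow> lin (f t)) \<Longrightarrow> lin (\<lambda>a. \<Sum>t\<leftarrow>ts. f t a)"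
  by (induction ts) (auto simp: lin_0 lin_add)

text \<open>Splitting the list around the varying argument fits the recursive faces better than the
  updates \<open>xs[i := a]\<close> in \<open>cochain\<close>.\<close>

lemma cochain_iff:
  "cochain sc n f \<longleftrightarrow> (\<forall>xs. length xs \<noteq> n \<longrightarrow> f xs = 0) \<and>
     (\<forall>xs ys. Suc (length xs + length ys) = n \<longrightarrow> lin (\<lambda>a. f (xs @ a # ys)))"
proof -
  have "f (xs[i := a + b]) = f (xs[i := a]) + f (xs[i := b]) \<and> f (xs[i := sc c a]) = sc c (f (xs[i := a]))"
    if "length xs = n" "i < n" "\<And>xs ys. Suc (length xs + length ys) = n \<Longrightarrow> lin (\<lambda>a. f (xs @ a # ys))"
    for xs i a b c
    using that(3)[of "take i xs" "drop (Suc i) xs"] that(1,2)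
    by (simp add: lin_def upd_conv_take_nth_drop)
  moreover have "lin (\<lambda>a. f (xs @ a # ys))" if "Suc (length xs + length ys) = n" "cochain sc n f" for xs ys
  proof -
    have upd: "(xs @ 0 # ys)[length xs := a] = xs @ a # ys" for a by simp
    have "length (xs @ 0 # ys) = n \<and> length xs < n" using that by auto
    then show ?thesis unfolding lin_def using that(2) unfolding cochain_def
      by (metis upd)
  qed
  ultimately show ?thesis unfolding cochain_def by blast
qed

lemma cochain_length: "cochain sc n f \<Longrightarrow> length xs \<noteq> n \<Longrightarrow> f xs = 0"
  by (simp add: cochain_iff)

lemma cochain_lin: "cochain sc n f \<Longrightarrow> Suc (length xs + length ys) = n \<Longrightarrow> lin (\<lambda>a. f (xs @ a # ys))"
  by (simp add: cochain_iff)

lemma lin_merge_sum_param: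
  "(\<And>K. Suc (length K) = length L \<Longrightarrow> lin (\<lambda>a. g a K)) \<Longrightarrow> lin (\<lambda>a. merge_sum (g a) L)"
proof (induction L arbitrary: g rule: induct_list012)
  case (3 b c L)
  have "lin (\<lambda>a. merge_sum (\<lambda>K. g a (b # K)) (c # L))"
    by (rule 3(2)) (use 3(3) in auto)
  then show ?case using 3(3)[of "b * c # L"] by (auto intro: lin_diff)
qed (simp_all add: lin_0)

text \<open>The varying argument can be merged with either neighbour. Only for prefixes of length 0
  and 1 does it take part in the first merge; for longer ones the first merge leaves it alone and
  the induction hypothesis applies to the rest.\<close>

lemma lin_merge_sum:
  assumes "\<And>xs ys. Suc (Suc (length xs + length ys)) = n \<Longrightarrow> lin (\<lambda>a. f (xs @ a # ys))"
    and "Suc (length xs + length ys) = n"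
  shows "lin (\<lambda>a. merge_sum f (xs @ a # ys))"
  using assms
proof (induction xs arbitrary: f n rule: induct_list012)
  case 1
  show ?case
  proof (cases ys)
    case (Cons b L)
    have "lin (\<lambda>a. merge_sum (\<lambda>K. f (a # K)) (b # L))"
    proof (rule lin_merge_sum_param)
      fix K :: "'a list" assume "Suc (length K) = length (b # L)"
      then show "lin (\<lambda>a. f (a # K))" using 1(1)[of "[]" K] 1(2) Cons by simp
    qed
    then show ?thesis using 1(1)[of "[]" L] 1(2) Cons lin_comp_mult_right[of "\<lambda>a. f (a # L)" b]
      by (auto intro: lin_diff)
  qed (simp add: lin_0)
next
  case (2 x)
  have "lin (\<lambda>a. merge_sum (\<lambda>K. f (x # K)) (a # ys))"
  proof (cases ys)
    case (Cons b L)
    have "lin (\<lambda>a. merge_sum (\<lambda>K. f (x # a # K)) (b # L))"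
    proof (rule lin_merge_sum_param)
      fix K :: "'a list" assume "Suc (length K) = length (b # L)"
      then show "lin (\<lambda>a. f (x # a # K))" using 2(1)[of "[x]" K] 2(2) Cons by simp
    qed
    then show ?thesis using 2(1)[of "[x]" L] 2(2) Cons lin_comp_mult_right[of "\<lambda>a. f (x # a # L)" b]
      by (auto intro: lin_diff)
  qed (simp add: lin_0)
  then show ?case using 2(1)[of "[]" ys] 2(2) lin_comp_mult_left[of "\<lambda>a. f (a # ys)" x]
    by (auto intro: lin_diff)
next
  case (3 x y zs)
  have "lin (\<lambda>a. merge_sum (\<lambda>K. f (x # K)) ((y # zs) @ a # ys))"
    by (rule 3(2)[of "n - 1" "\<lambda>K. f (x # K)"]) (use 3(3)[of "x # _"] 3(4) in auto)
  then show ?case using 3(3)[of "x * y # zs" ys] 3(4) by (auto intro: lin_diff)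
qed

lemma cochain_left_d:
  assumes "cochain sc (Suc n) f"
  shows "cochain sc (Suc (Suc n)) (left_d f)"
  unfolding cochain_iff
proof (intro conjI allI impI)
  fix L :: "'a list" assume "length L \<noteq> Suc (Suc n)"
  then have "left_d f L = left_d (\<lambda>K. 0) L"
    by (intro left_d_cong) (use cochain_length[OF assms] in auto)
  then show "left_d f L = 0" by (simp add: left_d_0)
next
  fix xs ys :: "'a list" assume l: "Suc (length xs + length ys) = Suc (Suc n)"
  have m: "lin (\<lambda>a. merge_sum f (xs @ a # ys))"
    by (rule lin_merge_sum[OF _ l]) (use cochain_lin[OF assms] in simp)
  show "lin (\<lambda>a. left_d f (xs @ a # ys))"
  proof (cases xs)
    case Nil
    then show ?thesis using m lin_mult_right[OF lin_id, of "f ys"] by (auto intro: lin_diff)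
  next
    case (Cons x K)
    then show ?thesis using m cochain_lin[OF assms, of K ys] l by (auto intro: lin_diff lin_mult_left)
  qed
qed

end

context kalgebra
begin

lemma vector_space_cscale: "vector_space (cscale sc)"
  by unfold_locales (auto simp: cscale_def fun_eq_iff A.scale_right_distrib A.scale_left_distrib)

sublocale F: kspace "cscale sc" by (simp add: kspace_def vector_space_cscale)

lemma cochain_0: "cochain sc n 0"
  by (simp add: cochain_iff lin_0)

lemma cochain_add: "cochain sc n f \<Longrightarrow> cochain sc n g \<Longrightarrow> cochain sc n (f + g)"
  by (simp add: cochain_iff lin_add)

lemma cochain_scale: "cochain sc n f \<Longrightarrow> cochain sc n (cscale sc c f)"
  by (simp add: cochain_iff lin_scale cscale_def)

lemma subspace_cochain: "F.subspace {f. cochain sc n f}"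
  by (auto simp: F.subspace_def cochain_0 cochain_add cochain_scale)

lemma linear_cscale_iff:
  "Vector_Spaces.linear (cscale sc) (cscale sc) T \<longleftrightarrow>
    (\<forall>f g. T (f + g) = T f + T g) \<and> (\<forall>c f. T (cscale sc c f) = cscale sc c (T f))"
  using vector_space_cscale by (simp add: Vector_Spaces.linear_iff)

lemma merge_sum_scale: "merge_sum (\<lambda>K. sc c (f K)) L = sc c (merge_sum f L)"
  by (induction f L rule: merge_sum.induct) (auto simp: A.scale_right_diff_distrib)

lemma left_d_scale: "left_d (\<lambda>K. sc c (f K)) L = sc c (left_d f L)"
  by (cases L) (auto simp: merge_sum_scale A.scale_right_diff_distrib sc_mult_right)

lemma linear_left_d: "Vector_Spaces.linear (cscale sc) (cscale sc) left_d"
  by (auto simp: linear_cscale_iff fun_eq_iff left_d_add left_d_scale cscale_def plus_fun_def)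

lemma linear_tensor_last: "Vector_Spaces.linear (cscale sc) (cscale sc) tensor_last"
  by (auto simp: linear_cscale_iff fun_eq_iff tensor_last_def cscale_def algebra_simps sc_mult_left)

lemma cochain_tensor_last:
  assumes "cochain sc n f" shows "cochain sc (Suc n) (tensor_last f)"
  unfolding cochain_iff
proof (intro conjI allI impI)
  fix L :: "'a list" assume "length L \<noteq> Suc n"
  then show "tensor_last f L = 0" using cochain_length[OF assms] by (cases L rule: rev_cases) (auto simp: tensor_last_def)
next
  fix xs ys :: "'a list" assume l: "Suc (length xs + length ys) = Suc n"
  show "lin (\<lambda>a. tensor_last f (xs @ a # ys))"
  proof (cases ys rule: rev_cases)
    case Nil
    then show ?thesis using lin_mult_left[OF lin_id] by (simp add: tensor_last_def)
  next
    case (snoc zs y)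
    then show ?thesis using lin_mult_right[OF cochain_lin[OF assms, of xs zs]] l
      by (simp add: tensor_last_def butlast_append)
  qed
qed

lemma lin_zero: "lin f \<Longrightarrow> f 0 = 0"
  unfolding lin_def by (metis A.scale_zero_left)

lemma tensor_last_snoc: "tensor_last f (L @ [x]) = f L * x"
  by (simp add: tensor_last_def)

lemma tensor_last_eq_0_iff: "tensor_last f = 0 \<longleftrightarrow> f = 0"
proof
  assume "tensor_last f = 0"
  then have "f L = 0" for L using tensor_last_snoc[of f L 1] by simp
  then show "f = 0" by (simp add: fun_eq_iff)
qed (simp add: fun_eq_iff tensor_last_def)

end

section \<open>Cochains with values in duals of projective bimodules\<close>

locale idempotent_algebra = kalgebra sc
  for sc :: "'k::field \<Rightarrow> 'a::ring_1 \<Rightarrow> 'a" +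
  fixes V :: "'i set" and e :: "'i \<Rightarrow> 'a"
  assumes finite_V: "finite V" and e_sum: "(\<Sum>i\<in>V. e i) = 1"
    and e_e: "i \<in> V \<Longrightarrow> j \<in> V \<Longrightarrow> e i * e j = (if i = j then e i else 0)"
begin

text \<open>\<open>C G p\<close> are the multilinear maps \<open>A\<^sup>p \<rightarrow> Hom\<^sub>-\<^sub>A(P, A)\<close> where \<open>P\<close> is the sum of \<open>Ae\<^sub>i \<otimes> e\<^sub>jA\<close> over
  \<open>(i,j) \<in> G\<close>. The last list entry is the argument in \<open>Ae\<^sub>i\<close>; the components for different pairs
  are recovered from a single map by multiplying with idempotents.\<close>

definition supported :: "('i \<times> 'i) set \<Rightarrow> ('a list \<Rightarrow> 'a) \<Rightarrow> bool" where
  "supported G f \<longleftrightarrow> (\<forall>i\<in>V. \<forall>j\<in>V. (i, j) \<notin> G \<longrightarrow> (\<forall>xs x. f (xs @ [x * e i]) * e j = 0))"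

definition C :: "('i \<times> 'i) set \<Rightarrow> nat \<Rightarrow> ('a list \<Rightarrow> 'a) set" where
  "C G p = {f. cochain sc (Suc p) f \<and> supported G f}"

lemma C_cochain: "f \<in> C G p \<Longrightarrow> cochain sc (Suc p) f"
  by (simp add: C_def)

lemma subspace_C: "F.subspace (C G p)"
  by (auto simp: F.subspace_def C_def cochain_0 cochain_add cochain_scale supported_def
      algebra_simps cscale_def cochain_scale[unfolded cscale_def] sc_mult_left[symmetric])

lemma left_d_C:
  assumes f: "f \<in> C G p" shows "left_d f \<in> C G (Suc p)"
proof -
  have "left_d f (xs @ [x * e i]) * e j = 0" if "i \<in> V" "j \<in> V" "(i, j) \<notin> G" for i j xs x
  proof -
    have z: "f (ys @ [y * e i]) * e j = 0" for ys y using f that by (simp add: C_def supported_def)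
    show ?thesis
    proof (cases xs)
      case Nil
      have "f [] = 0" using cochain_length[OF C_cochain[OF f]] by simp
      then show ?thesis using Nil by simp
    next
      case (Cons a ys)
      have "left_d f (xs @ [x * e i]) * e j
          = left_d (\<lambda>L. f (butlast L @ [last L * e i])) (xs @ [x]) * e j"
        using Cons by (subst left_d_mult_last) auto
      also have "\<dots> = left_d (\<lambda>L. f (butlast L @ [last L * e i]) * e j) (xs @ [x])"
        by (simp add: left_d_mult_right)
      also have "\<dots> = 0" by (simp add: z left_d_0)
      finally show ?thesis .
    qed
  qed
  then show ?thesis using cochain_left_d[OF C_cochain[OF f]] by (auto simp: C_def supported_def)
qed

lemma lin_sum_idem: "lin f \<Longrightarrow> (\<Sum>i\<in>V. f (x * e i)) = f x"
proof -
  assume f: "lin f"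
  have "(\<Sum>i\<in>I. f (x * e i)) = f (x * (\<Sum>i\<in>I. e i))" if "finite I" for I
    using that
  proof induction
    case empty then show ?case using lin_zero[OF f] by simp
  next
    case (insert i I) then show ?case using f by (simp add: lin_def distrib_left)
  qed
  from this[OF finite_V] show ?thesis by (simp add: e_sum)
qed

text \<open>The left module \<open>Ae_i\<close> is projective:
  \<open>x \<mapsto> x \<otimes> e_i\<close> splits the multiplication
  \<open>A \<otimes> Ae_i \<rightarrow> Ae_i\<close>, and this splitting yields a contracting
  homotopy of the column.\<close>

lemma left_d_exact:
  assumes f: "f \<in> C G (Suc p)" and z: "left_d f = 0"
  shows "\<exists>g\<in>C G p. left_d g = f"
proof
  note c = C_cochain[OF f]
  define h where "h = (\<lambda>i K. f (K @ [e i]))"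
  \<comment> \<open>The last entry \<open>x\<close> is replaced by the two entries
    \<open>x * e i\<close> and \<open>e i\<close>. The sign undoes that of the face which merges
    them again, the last one in \<open>merge_sum_snoc\<close>.\<close>
  define g where "g L = (if L = [] then 0 else sgnv (Suc p) (\<Sum>i\<in>V. h i (butlast L @ [last L * e i])))" for L
  show "g \<in> C G p"
    unfolding C_def mem_Collect_eq cochain_iff supported_def
  proof (intro conjI allI impI ballI)
    fix xs :: "'a list" assume "length xs \<noteq> Suc p"
    then show "g xs = 0" using cochain_length[OF c] by (auto simp: g_def h_def sgnv_def)
  next
    fix xs ys :: "'a list" assume l: "Suc (length xs + length ys) = Suc p"
    have "lin (\<lambda>a. h i (butlast (xs @ a # ys) @ [last (xs @ a # ys) * e i]))" for i
    proof (cases ys rule: rev_cases)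
      case Nil
      then show ?thesis using lin_comp_mult_right[OF cochain_lin[OF c, of xs "[e i]"], of "e i"] l
        by (simp add: h_def)
    next
      case (snoc zs y)
      then show ?thesis using cochain_lin[OF c, of xs "zs @ [y * e i, e i]"] l
        by (simp add: h_def butlast_append)
    qed
    then show "lin (\<lambda>a. g (xs @ a # ys))" by (auto simp: g_def intro!: lin_sgnv lin_sum)
  next
    fix i j xs x assume ij: "i \<in> V" "j \<in> V" "(i, j) \<notin> G"
    \<comment> \<open>For \<open>k = i\<close> this is the support condition of \<open>f\<close> at
      its last entry \<open>e i\<close>; for every other \<open>k\<close> the entry before it
      vanishes.\<close>
    have "f (xs @ [x * e i * e k, e k]) * e j = 0" if "k \<in> V" for k
    proof (cases "k = i")
      case True
      have "\<And>ys y. f (ys @ [y * e i]) * e j = 0" using f ij by (simp add: C_def supported_def)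
      from this[of "xs @ [x * e i * e i]" 1] show ?thesis using True by simp
    next
      case False
      have "e i * e k = 0" using e_e ij that False by auto
      moreover have "f (xs @ 0 # ys) = 0" for ys
      proof (cases "Suc (length xs + length ys) = Suc (Suc p)")
        case True
        from lin_zero[OF cochain_lin[OF c this]] show ?thesis .
      qed (use cochain_length[OF c] in auto)
      ultimately show ?thesis by (simp add: mult.assoc)
    qed
    then show "g (xs @ [x * e i]) * e j = 0"
      by (simp add: g_def h_def sgnv_def sum_distrib_right)
  qed
  show "left_d g = f"
  proof
    fix K
    show "left_d g K = f K"
    proof (cases "length K = Suc (Suc p)")
      case True
      then obtain L x where K: "K = L @ [x]" "length L = Suc p" by (cases K rule: rev_cases) auto
      have "left_d g K = left_d (\<lambda>L. sgnv (Suc p) (\<Sum>i\<in>V. h i (butlast L @ [last L * e i]))) K"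
        using True by (intro left_d_cong) (auto simp: g_def)
      also have "\<dots> = sgnv (Suc p) (\<Sum>i\<in>V. left_d (h i) (L @ [x * e i]))"
        using K by (simp add: left_d_sgnv left_d_sum left_d_mult_last)
      also have "left_d (h i) (L @ [x * e i]) = sgnv (Suc p) (f (L @ [x * e i]))" if "i \<in> V" for i
      proof -
        obtain a M where L: "L = a # M" using K by (cases L) auto
        have "0 = left_d f (L @ [x * e i, e i])" using z by simp
        also have "\<dots> = left_d (h i) (L @ [x * e i]) - sgnv (length L) (f (L @ [x * e i * e i]))"
          using merge_sum_snoc[of f L "x * e i" "e i"] L by (simp add: h_def)
        finally show ?thesis using K e_e[OF that that] by (simp add: mult.assoc)
      qed
      then have "(\<Sum>i\<in>V. left_d (h i) (L @ [x * e i])) = sgnv (Suc p) (\<Sum>i\<in>V. f (L @ [x * e i]))"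
        by (simp add: sgnv_def sum_negf)
      also have "(\<Sum>i\<in>V. f (L @ [x * e i])) = f K"
        using lin_sum_idem[OF cochain_lin[OF c, of L "[]"], of x] K by simp
      finally show ?thesis by (simp add: sgnv_def split: if_splits)
    next
      case False
      have "left_d g K = left_d (\<lambda>K. 0) K"
      proof (rule left_d_cong)
        fix L :: "'a list" assume "Suc (length L) = length K"
        with False show "g L = 0" using cochain_length[OF c] by (auto simp: g_def h_def sgnv_def)
      qed
      then show ?thesis using cochain_length[OF c False] by (simp add: left_d_0)
    qed
  qed
qed

text \<open>Composition with the bimodule map \<open>x \<otimes> y \<mapsto> \<Sum> c xu \<otimes> vy\<close>, the sum ranging over the triples \<open>(c,u,v)\<close>.\<close>

definition pull :: "('k \<times> 'a \<times> 'a) list \<Rightarrow> ('a list \<Rightarrow> 'a) \<Rightarrow> 'a list \<Rightarrow> 'a" where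
  "pull ts f L = (if L = [] then 0 else \<Sum>(c, u, v)\<leftarrow>ts. sc c (f (butlast L @ [last L * u]) * v))"

lemma pull_snoc: "pull ts f (L @ [x]) = (\<Sum>(c, u, v)\<leftarrow>ts. sc c (f (L @ [x * u]) * v))"
  by (simp add: pull_def)

lemma linear_pull: "Vector_Spaces.linear (cscale sc) (cscale sc) (pull ts)"
proof -
  have "pull ts (f + g) L = pull ts f L + pull ts g L" for f g L
    by (induction ts) (auto simp: pull_def algebra_simps A.scale_right_distrib)
  moreover have "pull ts (cscale sc c f) L = sc c (pull ts f L)" for f c L
    by (induction ts) (auto simp: pull_def cscale_def sc_mult_left[symmetric] A.scale_right_distrib mult.commute)
  ultimately show ?thesis by (auto simp: linear_cscale_iff fun_eq_iff cscale_def)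
qed

lemma cochain_pull:
  assumes "cochain sc (Suc p) f" shows "cochain sc (Suc p) (pull ts f)"
  unfolding cochain_iff
proof (intro conjI allI impI)
  fix L :: "'a list" assume "length L \<noteq> Suc p"
  then have "L \<noteq> [] \<Longrightarrow> f (butlast L @ [y]) = 0" for y using cochain_length[OF assms] by simp
  then show "pull ts f L = 0" by (induction ts) (auto simp: pull_def)
next
  fix xs ys :: "'a list" assume l: "Suc (length xs + length ys) = Suc p"
  have "lin (\<lambda>a. f (butlast (xs @ a # ys) @ [last (xs @ a # ys) * u]))" for u
  proof (cases ys rule: rev_cases)
    case Nil
    then show ?thesis using lin_comp_mult_right[OF cochain_lin[OF assms, of xs "[]"]] l by simp
  next
    case (snoc zs y)
    then show ?thesis using cochain_lin[OF assms, of xs "zs @ [y * u]"] l by (simp add: butlast_append)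
  qed
  then show "lin (\<lambda>a. pull ts f (xs @ a # ys))"
    by (auto simp: pull_def split_def intro!: lin_sum_list lin_scale lin_mult_right)
qed

text \<open>A term \<open>(c,u,v)\<close> contributes to the generator \<open>(i,j)\<close> only if
  \<open>e i * u\<close> and \<open>v * e j\<close> are both nonzero, so the hypothesis on
  \<open>ts\<close> places all terms on generators in \<open>G'\<close>.\<close>

lemma pull_C:
  assumes f: "f \<in> C G p"
    and ts: "\<And>c u v i j. (c, u, v) \<in> set ts \<Longrightarrow> i \<in> V \<Longrightarrow> j \<in> V \<Longrightarrow> (i, j) \<notin> G' \<Longrightarrow> e i * u = 0 \<or> v * e j = 0"
  shows "pull ts f \<in> C G' p"
proof -
  note c = C_cochain[OF f]
  have f0: "f (xs @ [0]) = 0" for xs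
  proof (cases "Suc (length xs) = Suc p")
    case True
    with lin_zero[OF cochain_lin[OF c, of xs "[]"]] show ?thesis by simp
  qed (use cochain_length[OF c] in auto)
  have "pull ts f (xs @ [x * e i]) * e j = 0" if "i \<in> V" "j \<in> V" "(i, j) \<notin> G'" for i j xs x
  proof -
    have "(\<Sum>(c, u, v)\<leftarrow>us. sc c (f (xs @ [x * e i * u]) * v)) * e j = 0" if "set us \<subseteq> set ts" for us
      using that
    proof (induction us)
      case (Cons t us)
      obtain c u v where t: "t = (c, u, v)" by (cases t)
      with Cons ts[of c u v i j] \<open>i \<in> V\<close> \<open>j \<in> V\<close> \<open>(i, j) \<notin> G'\<close> have "e i * u = 0 \<or> v * e j = 0" by auto
      then show ?case using Cons t f0
        by (auto simp: distrib_right sc_mult_left[symmetric] mult.assoc)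
    qed simp
    then show ?thesis by (simp add: pull_snoc)
  qed
  then show ?thesis using cochain_pull[OF c] by (auto simp: C_def supported_def)
qed

text \<open>\<open>left_d\<close> multiplies from the left, whereas \<open>pull\<close> changes the
  last entry and the value from the right; hence the squares of the double complex commute without a
  sign.\<close>

lemma left_d_pull:
  assumes f: "f \<in> C G p" shows "left_d (pull ts f) = pull ts (left_d f)"
proof
  fix K
  show "left_d (pull ts f) K = pull ts (left_d f) K"
  proof (cases "length K \<ge> 2")
    case True
    have "left_d (pull ts f) K = left_d (\<lambda>L. \<Sum>(c, u, v)\<leftarrow>ts. sc c (f (butlast L @ [last L * u]) * v)) K"
      using True by (intro left_d_cong) (auto simp: pull_def)
    also have "\<dots> = (\<Sum>(c, u, v)\<leftarrow>ts. left_d (\<lambda>L. sc c (f (butlast L @ [last L * u]) * v)) K)"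
      by (simp add: split_def left_d_sum_list)
    also have "\<dots> = pull ts (left_d f) K"
      using True by (auto simp: pull_def left_d_scale left_d_mult_right left_d_mult_last)
    finally show ?thesis .
  next
    case False
    have f0: "f [] = 0" using cochain_length[OF C_cochain[OF f]] by simp
    from False consider "K = []" | a where "K = [a]" by (cases K; cases "tl K") auto
    then show ?thesis
    proof cases
      case 2
      have "(\<Sum>(c, u, v)\<leftarrow>ts. sc c (left_d f [a * u] * v)) = 0" by (induction ts) (auto simp: f0)
      then show ?thesis using 2 by (simp add: pull_def)
    qed (simp add: pull_def)
  qed
qed

end

section \<open>Cohomology of complexes with a monomial differential\<close>

context kspace
begin

text \<open>The first \<open>s\<close> basis vectors are sources, the next \<open>r\<close> are
  targets of the incoming differential with coefficients \<open>a j\<close>, the others are free. A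
  source is a cocycle when its coefficient \<open>c i\<close> vanishes, a target fails to be a
  boundary when its \<open>a j\<close> vanishes, and the count collects what is left.\<close>

lemma quot_dim_monomial:
  fixes X X' Y :: "nat \<Rightarrow> 'b" and a c :: "nat \<Rightarrow> 'k"
  assumes ind: "\<And>u. (\<Sum>i<n. scale (u i) (X i)) = 0 \<Longrightarrow> \<forall>i<n. u i = 0"
    and ind': "\<And>u. (\<Sum>i<n'. scale (u i) (X' i)) = 0 \<Longrightarrow> \<forall>i<n'. u i = 0"
    and d: "Vector_Spaces.linear scale scale d"
    and dX: "\<And>i. i < n \<Longrightarrow> d (X i) = (if i < s then scale (c i) (X' (s' + i)) else 0)"
    and s: "s \<le> n" "s' + s \<le> n'" "s + r \<le> n"
    and B: "B = {(\<Sum>j<r. scale (u j * a j) (X (s + j))) | u. True}"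
    and V: "V = {(\<Sum>i<n. scale (u i) (X i)) | u. True}"
  shows "quot_dim {x \<in> V. d x = 0} B
    (card {i. i < n \<and> (i < s \<longrightarrow> c i = 0) \<and> (s \<le> i \<and> i < s + r \<longrightarrow> a (i - s) = 0)})"
proof -
  interpret d: Vector_Spaces.linear scale scale d by (rule d)
  define T where "T = {i. s \<le> i \<and> i < s + r \<and> a (i - s) \<noteq> 0}"
  define I where "I = {i. i < n \<and> (i < s \<longrightarrow> c i = 0) \<and> (s \<le> i \<and> i < s + r \<longrightarrow> a (i - s) = 0)}"
  have "quot_dim {x \<in> V. d x = 0} B (card I)"
  proof (rule quot_dim_span[OF ind, where T = T])
    show "I \<union> T \<subseteq> {..<n}" "I \<inter> T = {}" using s by (auto simp: I_def T_def)
  next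
    have ker: "d (\<Sum>i<n. scale (u i) (X i)) = 0 \<longleftrightarrow> (\<forall>i<n. i \<notin> I \<union> T \<longrightarrow> u i = 0)" for u
    proof -
      define w where "w = (\<lambda>k. if s' \<le> k \<and> k < s' + s then u (k - s') * c (k - s') else 0)"
      have "d (\<Sum>i<n. scale (u i) (X i)) = (\<Sum>i<n. if i < s then scale (u i * c i) (X' (s' + i)) else 0)"
        unfolding d.sum by (rule sum.cong) (auto simp: d.scale dX)
      also have "\<dots> = (\<Sum>i<s. scale (u i * c i) (X' (s' + i)))"
        using s by (intro sum.mono_neutral_cong_right) auto
      also have "\<dots> = (\<Sum>k\<in>{s'..<s'+s}. scale (w k) (X' k))"
        by (rule sum.reindex_bij_witness[of _ "\<lambda>k. k - s'" "\<lambda>i. s' + i"]) (auto simp: w_def)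
      also have "\<dots> = (\<Sum>k<n'. scale (w k) (X' k))"
        using s by (intro sum.mono_neutral_cong_left) (auto simp: w_def)
      finally have e: "d (\<Sum>i<n. scale (u i) (X i)) = (\<Sum>k<n'. scale (w k) (X' k))" .
      have "(\<Sum>k<n'. scale (w k) (X' k)) = 0 \<longleftrightarrow> (\<forall>k<n'. w k = 0)"
        using ind'[of w] by auto
      also have "\<dots> \<longleftrightarrow> (\<forall>i<s. u i * c i = 0)"
      proof safe
        fix i assume "\<forall>k<n'. w k = 0" "i < s"
        from this(1)[rule_format, of "s' + i"] this(2) s show "u i * c i = 0" by (auto simp: w_def)
      next
        fix k assume *: "\<forall>i<s. u i * c i = 0" "k < n'"
        have "k - s' < s" if "s' \<le> k" "k < s' + s" using that by simp
        with *(1) show "w k = 0" by (simp add: w_def)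
      qed
      also have "\<dots> \<longleftrightarrow> (\<forall>i<n. i \<notin> I \<union> T \<longrightarrow> u i = 0)"
        using s by (auto simp: I_def T_def)
      finally show ?thesis using e by simp
    qed
    show "{x \<in> V. d x = 0} = {\<Sum>i<n. scale (u i) (X i) |u. \<forall>i<n. i \<notin> I \<union> T \<longrightarrow> u i = 0}"
      unfolding V using ker by blast
  next
    have "(\<exists>u. x = (\<Sum>j<r. scale (u j * a j) (X (s + j)))) \<longleftrightarrow>
        (\<exists>u. x = (\<Sum>i<n. scale (u i) (X i)) \<and> (\<forall>i<n. i \<notin> T \<longrightarrow> u i = 0))" for x
    proof safe
      fix u :: "nat \<Rightarrow> 'k"
      let ?w = "\<lambda>i. if s \<le> i \<and> i < s + r then u (i - s) * a (i - s) else 0"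
      have "(\<Sum>j<r. scale (u j * a j) (X (s + j))) = (\<Sum>i\<in>{s..<s+r}. scale (?w i) (X i))"
        by (rule sum.reindex_bij_witness[of _ "\<lambda>k. k - s" "\<lambda>i. s + i"]) auto
      also have "\<dots> = (\<Sum>i<n. scale (?w i) (X i))"
        using s by (intro sum.mono_neutral_cong_left) auto
      finally show "\<exists>v. (\<Sum>j<r. scale (u j * a j) (X (s + j))) = (\<Sum>i<n. scale (v i) (X i)) \<and> (\<forall>i<n. i \<notin> T \<longrightarrow> v i = 0)"
        by (intro exI[of _ ?w]) (auto simp: T_def)
    next
      fix u :: "nat \<Rightarrow> 'k" assume u: "\<forall>i<n. i \<notin> T \<longrightarrow> u i = 0"
      \<comment> \<open>Where \<open>a j = 0\<close>, the index \<open>s + j\<close> lies outside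
        \<open>T\<close> and \<open>u\<close> vanishes there, so the division is harmless.\<close>
      let ?w = "\<lambda>j. u (s + j) / a j"
      have "(\<Sum>j<r. scale (?w j * a j) (X (s + j))) = (\<Sum>j<r. scale (u (s + j)) (X (s + j)))"
        using u s by (intro sum.cong) (auto simp: T_def)
      also have "\<dots> = (\<Sum>i\<in>{s..<s+r}. scale (u i) (X i))"
        by (rule sum.reindex_bij_witness[of _ "\<lambda>k. k - s" "\<lambda>i. s + i"]) auto
      also have "\<dots> = (\<Sum>i<n. scale (u i) (X i))"
        using s u by (intro sum.mono_neutral_cong_left) (auto simp: T_def)
      finally show "\<exists>w. (\<Sum>i<n. scale (u i) (X i)) = (\<Sum>j<r. scale (w j * a j) (X (s + j)))" by metis
    qed
    then show "B = {\<Sum>i<n. scale (u i) (X i) |u. \<forall>i<n. i \<notin> T \<longrightarrow> u i = 0}"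
      unfolding B by blast
  qed
  then show ?thesis by (simp add: I_def)
qed

end

section \<open>From a bimodule resolution to Hochschild cohomology\<close>

locale bimodule_resolution = idempotent_algebra sc V e
  for sc :: "'k::field \<Rightarrow> 'a::ring_1 \<Rightarrow> 'a" and V :: "'i set" and e :: "'i \<Rightarrow> 'a" +
  fixes G :: "nat \<Rightarrow> ('i \<times> 'i) set" and ts :: "nat \<Rightarrow> ('k \<times> 'a \<times> 'a) list"
  assumes ts_support: "(c, u, v) \<in> set (ts q) \<Longrightarrow> i \<in> V \<Longrightarrow> j \<in> V \<Longrightarrow> (i, j) \<notin> G (Suc q) \<Longrightarrow>
      e i * u = 0 \<or> v * e j = 0"
    and pull_pull: "f \<in> C (G q) p \<Longrightarrow> pull (ts (Suc q)) (pull (ts q) f) = 0"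
    and pull_exact: "f \<in> C (G (Suc q)) p \<Longrightarrow> pull (ts (Suc q)) f = 0 \<Longrightarrow> \<exists>g\<in>C (G q) p. pull (ts q) g = f"
    and G_0: "i \<in> V \<Longrightarrow> (i, i) \<in> G 0"
    and pull_tensor_last: "cochain sc p f \<Longrightarrow> pull (ts 0) (tensor_last f) = 0"
    and tensor_last_exact: "f \<in> C (G 0) p \<Longrightarrow> pull (ts 0) f = 0 \<Longrightarrow> \<exists>g. cochain sc p g \<and> tensor_last g = f"
    and finite_dim: "\<exists>T. finite T \<and> {f. cochain sc p f} \<subseteq> F.span T"
begin

text \<open>\<open>p\<close> is the bar degree and \<open>q\<close> the degree in the resolution.
  The locale asks for exactness of the rows of cochains rather than of the complex
  \<open>P_q\<close> itself; this is the form in which a contracting homotopy delivers it.\<close>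

sublocale D: double_complex "cscale sc" "\<lambda>p q. C (G q) p" "\<lambda>p q. left_d" "\<lambda>p q. pull (ts q)"

proof (intro double_complex.intro double_complex_axioms.intro)
  show "kspace (cscale sc)" by (rule F.kspace_axioms)
next
  fix p q x
  show "F.subspace (C (G q) p)" by (rule subspace_C)
  show "Vector_Spaces.linear (cscale sc) (cscale sc) left_d" by (rule linear_left_d)
  show "Vector_Spaces.linear (cscale sc) (cscale sc) (pull (ts q))" by (rule linear_pull)
  show "x \<in> C (G q) p \<Longrightarrow> left_d x \<in> C (G q) (Suc p)" by (rule left_d_C)
  show "x \<in> C (G q) p \<Longrightarrow> pull (ts q) x \<in> C (G (Suc q)) p" by (erule pull_C) (rule ts_support)
  show "x \<in> C (G q) p \<Longrightarrow> left_d (left_d x) = 0" by (simp add: fun_eq_iff left_d_left_d)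
  show "x \<in> C (G q) p \<Longrightarrow> pull (ts (Suc q)) (pull (ts q) x) = 0" by (rule pull_pull)
  show "x \<in> C (G q) p \<Longrightarrow> left_d (pull (ts q) x) = pull (ts q) (left_d x)" by (rule left_d_pull)
  show "x \<in> C (G q) (Suc p) \<Longrightarrow> left_d x = 0 \<Longrightarrow> \<exists>y\<in>C (G q) p. left_d y = x" by (rule left_d_exact)
  show "x \<in> C (G (Suc q)) p \<Longrightarrow> pull (ts (Suc q)) x = 0 \<Longrightarrow> \<exists>y\<in>C (G q) p. pull (ts q) y = x"
    by (rule pull_exact)
qed

lemma tensor_last_C: "cochain sc p f \<Longrightarrow> tensor_last f \<in> C (G 0) p"
  using G_0 by (auto simp: C_def supported_def cochain_tensor_last tensor_last_snoc mult.assoc e_e)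

lemma left_d_tensor_last_cochain:
  "cochain sc p f \<Longrightarrow> left_d (tensor_last f) = tensor_last (hoch_d (*) p f)"
  by (rule ext, rule left_d_tensor_last) (simp add: cochain_length)

lemma linear_hoch_d: "Vector_Spaces.linear (cscale sc) (cscale sc) (hoch_d (*) p)"
proof -
  have "sgnv k (a + b) = sgnv k a + sgnv k b" "sgnv k (sc c a) = sc c (sgnv k a)" for k c and a b :: 'a
    by (simp_all add: sgnv_def)
  then show ?thesis unfolding linear_cscale_iff
    by (auto simp: fun_eq_iff hoch_d_def cscale_def algebra_simps sum.distrib A.scale_right_distrib
        A.scale_sum_right sc_mult_left[symmetric] sc_mult_right[symmetric])
qed

lemma tensor_last_inj:
  fixes f g :: "'a list \<Rightarrow> 'a"
  assumes "tensor_last f = tensor_last g" shows "f = g"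
proof -
  interpret t: Vector_Spaces.linear "cscale sc" "cscale sc" tensor_last by (rule linear_tensor_last)
  show "f = g" using assms using tensor_last_eq_0_iff[of "f - g"] t.diff[of f g] by simp
qed

lemma cocycles_iff: "f \<in> cocycles sc (*) n \<longleftrightarrow> cochain sc n f \<and> hoch_d (*) n f = 0"
  by (simp add: cocycles_def zero_fun_def)

lemma coboundaries_Suc: "coboundaries sc (*) (Suc p) = hoch_d (*) p ` {f. cochain sc p f}"
  by (simp add: coboundaries_def)

text \<open>By \<open>tensor_last_exact\<close> a preimage under \<open>left_d\<close> that is
  killed by \<open>pull (ts 0)\<close> is itself of the form \<open>tensor_last g\<close>, so a
  boundary on the edge \<open>q = 0\<close> comes from a Hochschild coboundary.\<close>

lemma tensor_last_coboundary:
  assumes f: "cochain sc n f"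
  shows "tensor_last f \<in> D.B n 0 \<longleftrightarrow> f \<in> coboundaries sc (*) n"
proof (cases n)
  case 0
  then show ?thesis using tensor_last_eq_0_iff by (auto simp: coboundaries_def zero_fun_def)
next
  case (Suc p)
  show ?thesis
  proof
    assume "tensor_last f \<in> D.B n 0"
    then obtain y where y: "y \<in> C (G 0) p" "pull (ts 0) y = 0" "tensor_last f = left_d y" using Suc by auto
    then obtain g where "cochain sc p g" "tensor_last g = y" using tensor_last_exact by blast
    then have "f = hoch_d (*) p g" using y left_d_tensor_last_cochain tensor_last_inj by metis
    then show "f \<in> coboundaries sc (*) n" using \<open>cochain sc p g\<close> Suc by (simp add: coboundaries_Suc)
  next
    assume "f \<in> coboundaries sc (*) n"
    then obtain g where g: "cochain sc p g" "f = hoch_d (*) p g" using Suc by (auto simp: coboundaries_Suc)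
    then have "tensor_last f = left_d (tensor_last g)" by (simp add: left_d_tensor_last_cochain)
    then have "tensor_last f \<in> left_d ` {y \<in> C (G 0) p. pull (ts 0) y = 0}"
      using tensor_last_C[OF g(1)] pull_tensor_last[OF g(1)] by blast
    then show "tensor_last f \<in> D.B n 0" using Suc by simp
  qed
qed

lemma cocycles_subspace: "F.subspace (cocycles sc (*) n)"
proof -
  interpret h: Vector_Spaces.linear "cscale sc" "cscale sc" "hoch_d (*) n" by (rule linear_hoch_d)
  show ?thesis unfolding F.subspace_def cocycles_def zero_fun_def[symmetric]
    by (auto simp: cochain_0 cochain_add cochain_scale h.add h.scale h.zero)
qed

lemma coboundaries_subspace: "F.subspace (coboundaries sc (*) n)"
proof (cases n)
  case 0
  then show ?thesis by (simp add: coboundaries_def zero_fun_def[symmetric] F.subspace_0 F.subspace_def)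
next
  case (Suc p)
  interpret h: Vector_Spaces.linear "cscale sc" "cscale sc" "hoch_d (*) p" by (rule linear_hoch_d)
  show ?thesis unfolding Suc coboundaries_Suc by (rule h.subspace_image[OF subspace_cochain])
qed

lemma cochain_tensor_last_imp:
  assumes "cochain sc (Suc (Suc n)) (tensor_last f)" shows "cochain sc (Suc n) f"
proof -
  have "f xs = 0" if "length xs \<noteq> Suc n" for xs
    using cochain_length[OF assms, of "xs @ [1]"] that by (simp add: tensor_last_snoc)
  moreover have "lin (\<lambda>a. f (xs @ a # ys))" if "Suc (length xs + length ys) = Suc n" for xs ys
    using cochain_lin[OF assms, of xs "ys @ [1]"] that tensor_last_snoc[of f "xs @ _ # ys" 1] by simp
  ultimately show ?thesis by (simp add: cochain_iff)
qed

text \<open>That the Hochschild differential squares to zero is inherited from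
  \<open>left_d_left_d\<close> through the injective map \<open>tensor_last\<close>.\<close>

lemma coboundaries_cocycles: "coboundaries sc (*) n \<subseteq> cocycles sc (*) n"
proof (cases n)
  case 0
  then show ?thesis using F.subspace_0[OF cocycles_subspace] by (simp add: coboundaries_def zero_fun_def)
next
  case (Suc p)
  have "hoch_d (*) p f \<in> cocycles sc (*) n" if f: "cochain sc p f" for f
  proof -
    note e = left_d_tensor_last_cochain[OF f]
    have "cochain sc (Suc (Suc p)) (tensor_last (hoch_d (*) p f))"
      unfolding e[symmetric] using C_cochain[OF left_d_C[OF tensor_last_C[OF f]]] .
    then have c: "cochain sc n (hoch_d (*) p f)" unfolding Suc by (rule cochain_tensor_last_imp)
    have "tensor_last (hoch_d (*) n (hoch_d (*) p f)) = left_d (left_d (tensor_last f))"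
      using left_d_tensor_last_cochain[OF c] e by simp
    also have "\<dots> = 0" by (simp add: fun_eq_iff left_d_left_d)
    finally show ?thesis using c by (simp add: cocycles_iff tensor_last_eq_0_iff)
  qed
  then show ?thesis by (auto simp: Suc coboundaries_Suc)
qed

text \<open>The edge \<open>p = 0\<close> carries the bimodule maps
  \<open>P_q \<rightarrow> A\<close>, the edge \<open>q = 0\<close> the Hochschild complex by way of
  \<open>tensor_last\<close>, and both edges have the same cohomology.\<close>

lemma HH_dim_eq:
  assumes "F.quot_dim (D.Z 0 n) (D.B 0 n) k"
  shows "HH_dim sc (*) n = k"
proof -
  interpret t: Vector_Spaces.linear "cscale sc" "cscale sc" tensor_last by (rule linear_tensor_last)
  have "F.quot_dim (cocycles sc (*) n) (coboundaries sc (*) n) k"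
  proof (rule F.quot_dim_transfer[where R = "\<lambda>F f. cochain sc n f \<and> tensor_last f = F"])
    show "F.quot_dim (D.Z n 0) (D.B n 0) k" using assms by (rule D.quot_dim_row_column)
  next
    fix I :: "nat set" and u x y assume "finite I" and xy: "\<And>i. i \<in> I \<Longrightarrow> cochain sc n (y i) \<and> tensor_last (y i) = x i"
    have "(\<Sum>i\<in>I. cscale sc (u i) (y i)) \<in> {f. cochain sc n f}"
      using xy by (intro F.subspace_sum[OF subspace_cochain] F.subspace_scale[OF subspace_cochain]) blast
    moreover have "tensor_last (\<Sum>i\<in>I. cscale sc (u i) (y i)) = (\<Sum>i\<in>I. cscale sc (u i) (x i))"
      unfolding t.sum t.scale using xy by (intro sum.cong) auto
    ultimately show "cochain sc n (\<Sum>i\<in>I. cscale sc (u i) (y i)) \<and>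
        tensor_last (\<Sum>i\<in>I. cscale sc (u i) (y i)) = (\<Sum>i\<in>I. cscale sc (u i) (x i))" by blast
  next
    fix x y x' y' assume "cochain sc n y \<and> tensor_last y = x" "cochain sc n y' \<and> tensor_last y' = x'"
    then show "cochain sc n (y - y') \<and> tensor_last (y - y') = x - x'"
      using F.subspace_diff[OF subspace_cochain, of y n y'] t.diff by blast
  next
    fix z assume z: "z \<in> D.Z n 0"
    then obtain f where f: "cochain sc n f" "tensor_last f = z"
      using tensor_last_exact unfolding D.Z_def by blast
    have "tensor_last (hoch_d (*) n f) = 0"
      using z f left_d_tensor_last_cochain unfolding D.Z_def by auto
    then have "f \<in> cocycles sc (*) n" using f by (simp add: cocycles_iff tensor_last_eq_0_iff)
    with f show "\<exists>f\<in>cocycles sc (*) n. cochain sc n f \<and> tensor_last f = z" by blast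
  next
    fix f assume "f \<in> cocycles sc (*) n"
    then have f: "cochain sc n f" "hoch_d (*) n f = 0" by (auto simp: cocycles_def zero_fun_def)
    have "tensor_last f \<in> D.Z n 0"
      unfolding D.Z_def using f tensor_last_C pull_tensor_last left_d_tensor_last_cochain tensor_last_eq_0_iff by simp
    with f show "\<exists>z\<in>D.Z n 0. cochain sc n f \<and> tensor_last f = z" by blast
  next
    fix F f assume "cochain sc n f \<and> tensor_last f = F"
    then show "F \<in> D.B n 0 \<longleftrightarrow> f \<in> coboundaries sc (*) n" using tensor_last_coboundary by blast
  qed
  moreover obtain T where "finite T" "{f. cochain sc n f} \<subseteq> F.span T" using finite_dim by blast
  moreover have "coboundaries sc (*) n \<subseteq> {f. cochain sc n f}"
    using coboundaries_cocycles by (auto simp: cocycles_def)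
  ultimately have "F.dim (cocycles sc (*) n) - F.dim (coboundaries sc (*) n) = k"
    by (intro F.quot_dim_imp_dim_diff[OF cocycles_subspace coboundaries_subspace coboundaries_cocycles]) auto
  then show ?thesis by (simp add: HH_dim_def)
qed

text \<open>The sum of the \<open>e_i A e_j\<close> over \<open>(i,j)\<close> in \<open>G q\<close>,
  cut out of \<open>A\<close> by the vanishing of the other components. It is the space of bimodule
  maps \<open>P_q \<rightarrow> A\<close>.\<close>

definition inv_space :: "nat \<Rightarrow> 'a set" where
  "inv_space q = {w. \<forall>i\<in>V. \<forall>j\<in>V. (i, j) \<notin> G q \<longrightarrow> e i * w * e j = 0}"

definition mult_by :: "'a \<Rightarrow> 'a list \<Rightarrow> 'a" where
  "mult_by w L = (case L of [x] \<Rightarrow> x * w | _ \<Rightarrow> 0)"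

text \<open>What \<open>pull\<close> becomes when bimodule maps are represented by elements
  \<open>w\<close> through \<open>mult_by\<close>.\<close>

definition sandwich :: "('k \<times> 'a \<times> 'a) list \<Rightarrow> 'a \<Rightarrow> 'a" where
  "sandwich us w = (\<Sum>(c, u, v)\<leftarrow>us. sc c (u * w * v))"

lemma mult_by_simps: "mult_by w [x] = x * w" "mult_by w [] = 0" "mult_by w (a # b # L) = 0"
  by (simp_all add: mult_by_def)

lemma mult_by_inj: "mult_by w = mult_by w' \<Longrightarrow> w = w'"
  by (drule fun_cong[of _ _ "[1]"]) (simp add: mult_by_simps)

lemma linear_mult_by: "Vector_Spaces.linear sc (cscale sc) mult_by"
  using vector_space_sc vector_space_cscale
  by (auto simp: Vector_Spaces.linear_iff fun_eq_iff mult_by_def cscale_def distrib_left sc_mult_right split: list.split)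

lemma mult_by_C: "w \<in> inv_space q \<longleftrightarrow> mult_by w \<in> C (G q) 0"
proof -
  have "cochain sc (Suc 0) (mult_by w)"
    unfolding cochain_iff
    using lin_mult_right[OF lin_id, of w] by (auto simp: mult_by_def split: list.split)
  moreover have "supported (G q) (mult_by w) \<longleftrightarrow> w \<in> inv_space q"
  proof
    assume "supported (G q) (mult_by w)"
    then have "\<forall>i\<in>V. \<forall>j\<in>V. (i, j) \<notin> G q \<longrightarrow> mult_by w ([] @ [1 * e i]) * e j = 0"
      unfolding supported_def by blast
    then show "w \<in> inv_space q" by (simp add: inv_space_def mult_by_simps)
  next
    assume w: "w \<in> inv_space q"
    show "supported (G q) (mult_by w)" unfolding supported_def
    proof (intro ballI impI allI)
      fix i j xs x assume "i \<in> V" "j \<in> V" "(i, j) \<notin> G q"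
      then have "e i * w * e j = 0" using w by (simp add: inv_space_def)
      then show "mult_by w (xs @ [x * e i]) * e j = 0"
        by (cases xs; cases "tl xs") (auto simp: mult_by_def mult.assoc)
    qed
  qed
  ultimately show ?thesis by (simp add: C_def)
qed

lemma left_d_mult_by: "left_d (mult_by w) = 0"
proof
  fix K :: "'a list"
  have m: "merge_sum (mult_by w) (a # b # c # L) = 0" for a b c L
  proof -
    have "merge_sum (mult_by w) (a # b # c # L) = merge_sum (\<lambda>K. 0) (a # b # c # L)"
      by (rule merge_sum_cong) (auto simp: mult_by_def split: list.split)
    then show ?thesis by (simp only: merge_sum_0)
  qed
  consider "K = []" | a where "K = [a]" | a b where "K = [a, b]" | a b c L where "K = a # b # c # L"
    by (metis neq_Nil_conv)
  then show "left_d (mult_by w) K = 0 K"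
  proof cases
    case (4 a b c L)
    then show ?thesis using m[of a b c L] by (simp add: mult_by_simps del: merge_sum.simps(3))
  qed (simp_all add: mult_by_simps mult.assoc)
qed

text \<open>For \<open>p = 0\<close> the equation \<open>left_d f = 0\<close> says
  \<open>f [a * b] = a * f [b]\<close>, so \<open>f\<close> is left linear and determined by
  \<open>f [1]\<close>.\<close>

lemma left_d_kernel: "{f \<in> C (G q) 0. left_d f = 0} = mult_by ` inv_space q"
proof safe
  fix f assume f: "f \<in> C (G q) 0" "left_d f = 0"
  note c = C_cochain[OF f(1)]
  have "f = mult_by (f [1])"
  proof
    fix L
    show "f L = mult_by (f [1]) L"
    proof (cases "length L = 1")
      case True
      then obtain x where x: "L = [x]" by (cases L) auto
      have "left_d f [x, 1] = 0" using f by simp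
      then show ?thesis by (simp add: x mult_by_simps)
    next
      case False
      then show ?thesis using cochain_length[OF c, of L] by (auto simp: mult_by_def split: list.split)
    qed
  qed
  then show "f \<in> mult_by ` inv_space q" using f mult_by_C by (metis image_eqI)
qed (auto simp: left_d_mult_by mult_by_C[symmetric])

lemma pull_mult_by: "pull us (mult_by w) = mult_by (sandwich us w)"
proof
  fix L
  show "pull us (mult_by w) L = mult_by (sandwich us w) L"
  proof (cases L rule: remdups_adj.cases)
    case (2 x)
    have "(\<Sum>(c, u, v)\<leftarrow>us. sc c (x * u * w * v)) = x * (\<Sum>(c, u, v)\<leftarrow>us. sc c (u * w * v))"
      by (induction us) (auto simp: distrib_left sc_mult_right[symmetric] mult.assoc)
    then show ?thesis using 2 by (simp add: pull_def mult_by_simps sandwich_def)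
  next
    case (3 x y xs)
    have "mult_by w (butlast L @ [z]) = 0" for z using 3 by (auto simp: mult_by_def split: list.split)
    then have "(\<Sum>(c, u, v)\<leftarrow>us. sc c (mult_by w (butlast L @ [last L * u]) * v)) = 0"
      by (induction us) auto
    then show ?thesis using 3 by (simp add: pull_def mult_by_simps)
  qed (simp add: pull_def mult_by_simps)
qed

text \<open>\<open>X q\<close> is a basis of degree \<open>q\<close> that starts with its
  \<open>s q\<close> sources. The targets in degree \<open>Suc q\<close> are placed right behind the
  sources of that degree, which gives the index \<open>s (Suc q) + i\<close>. The condition
  \<open>0 < n\<close> reflects that nothing maps into degree 0.\<close>

theorem HH_dim_monomial:
  fixes X :: "nat \<Rightarrow> nat \<Rightarrow> 'a" and c :: "nat \<Rightarrow> nat \<Rightarrow> 'k" and N s :: "nat \<Rightarrow> nat"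
  assumes X: "\<And>q i. i < N q \<Longrightarrow> X q i \<in> inv_space q"
    and span: "\<And>q w. w \<in> inv_space q \<Longrightarrow> \<exists>u. w = (\<Sum>i<N q. sc (u i) (X q i))"
    and ind: "\<And>q u. (\<Sum>i<N q. sc (u i) (X q i)) = 0 \<Longrightarrow> \<forall>i<N q. u i = 0"
    and d: "\<And>q i. i < N q \<Longrightarrow> sandwich (ts q) (X q i) = (if i < s q then sc (c q i) (X (Suc q) (s (Suc q) + i)) else 0)"
    and s: "\<And>q. s (Suc q) + s q \<le> N (Suc q)" "s 0 \<le> N 0"
  shows "HH_dim sc (*) n = card {i. i < N n \<and> (i < s n \<longrightarrow> c n i = 0) \<and>
      (0 < n \<and> s n \<le> i \<and> i < s n + s (n - 1) \<longrightarrow> c (n - 1) (i - s n) = 0)}"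
proof -
  interpret m: Vector_Spaces.linear sc "cscale sc" mult_by by (rule linear_mult_by)
  have sN: "s q \<le> N q" for q using s by (cases q) (auto intro: order_trans[OF le_add1])
  have sum_m: "(\<Sum>i\<in>I. cscale sc (u i) (mult_by (x i))) = mult_by (\<Sum>i\<in>I. sc (u i) (x i))" for I u x
    by (simp add: m.sum m.scale)
  have inv: "mult_by ` inv_space q = {(\<Sum>i<N q. cscale sc (u i) (mult_by (X q i))) |u. True}" for q
  proof -
    have "(\<Sum>i<N q. sc (u i) (X q i)) \<in> inv_space q" for u
    proof -
      have "(\<Sum>i<N q. cscale sc (u i) (mult_by (X q i))) \<in> C (G q) 0"
        using X mult_by_C by (intro F.subspace_sum[OF subspace_C] F.subspace_scale[OF subspace_C]) auto
      then show ?thesis by (simp add: sum_m mult_by_C)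
    qed
    then show ?thesis unfolding sum_m using span by blast
  qed
  have ind_m: "\<forall>i<N q. u i = 0" if "(\<Sum>i<N q. cscale sc (u i) (mult_by (X q i))) = 0" for u q
  proof -
    have "mult_by (\<Sum>i<N q. sc (u i) (X q i)) = mult_by 0" using that by (simp add: sum_m m.zero)
    then show ?thesis using ind mult_by_inj by blast
  qed
  have dX: "pull (ts q) (mult_by (X q i)) = (if i < s q then cscale sc (c q i) (mult_by (X (Suc q) (s (Suc q) + i))) else 0)"
    if "i < N q" for i q
    using that by (simp add: pull_mult_by d m.scale m.zero)
  have Z: "D.Z 0 n = {x \<in> {(\<Sum>i<N n. cscale sc (u i) (mult_by (X n i))) |u. True}. pull (ts n) x = 0}"
    unfolding inv[symmetric] left_d_kernel[symmetric] D.Z_def by auto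
  let ?r = "if n = 0 then 0 else s (n - 1)"
  have B: "D.B 0 n = {(\<Sum>j<?r. cscale sc (u j * c (n - 1) j) (mult_by (X n (s n + j)))) |u. True}"
  proof (cases n)
    case (Suc q)
    interpret p: Vector_Spaces.linear "cscale sc" "cscale sc" "pull (ts q)" by (rule linear_pull)
    have *: "pull (ts q) (\<Sum>i<N q. cscale sc (u i) (mult_by (X q i)))
      = (\<Sum>j<s q. cscale sc (u j * c q j) (mult_by (X (Suc q) (s (Suc q) + j))))" for u
    proof -
      have "pull (ts q) (\<Sum>i<N q. cscale sc (u i) (mult_by (X q i)))
        = (\<Sum>i<N q. if i < s q then cscale sc (u i * c q i) (mult_by (X (Suc q) (s (Suc q) + i))) else 0)"
        unfolding p.sum by (rule sum.cong) (auto simp: p.scale dX)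
      also have "\<dots> = (\<Sum>j<s q. cscale sc (u j * c q j) (mult_by (X (Suc q) (s (Suc q) + j))))"
        using sN[of q] by (intro sum.mono_neutral_cong_right) auto
      finally show ?thesis .
    qed
    have "D.B 0 n = pull (ts q) ` (mult_by ` inv_space q)" using Suc left_d_kernel by simp
    also have "\<dots> = {pull (ts q) (\<Sum>i<N q. cscale sc (u i) (mult_by (X q i))) |u. True}"
      unfolding inv by blast
    finally show ?thesis unfolding * using Suc by simp
  qed auto
  show ?thesis
  proof (rule HH_dim_eq)
    have "F.quot_dim (D.Z 0 n) (D.B 0 n)
       (card {i. i < N n \<and> (i < s n \<longrightarrow> c n i = 0) \<and> (s n \<le> i \<and> i < s n + ?r \<longrightarrow> c (n - 1) (i - s n) = 0)})"
      unfolding Z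
      by (rule F.quot_dim_monomial[OF ind_m ind_m linear_pull dX _ _ _ B refl])
        (use sN s(1)[of n] s(1)[of "n - 1"] in \<open>auto\<close>)
    moreover have "{i. i < N n \<and> (i < s n \<longrightarrow> c n i = 0) \<and> (s n \<le> i \<and> i < s n + ?r \<longrightarrow> c (n - 1) (i - s n) = 0)}
       = {i. i < N n \<and> (i < s n \<longrightarrow> c n i = 0) \<and> (0 < n \<and> s n \<le> i \<and> i < s n + s (n - 1) \<longrightarrow> c (n - 1) (i - s n) = 0)}"
      by auto
    ultimately show "F.quot_dim (D.Z 0 n) (D.B 0 n) (card {i. i < N n \<and> (i < s n \<longrightarrow> c n i = 0) \<and>
        (0 < n \<and> s n \<le> i \<and> i < s n + s (n - 1) \<longrightarrow> c (n - 1) (i - s n) = 0)})" by simp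
  qed
qed

end

section \<open>The algebra and its multiplicative basis\<close>

lemma vertices_1: "vertices 1 = {0, 1, 2, 3, 5, 6}"
proof -
  have "vtx 1 v \<in> {0, 1, 2, 3, 5, 6}" for v
  proof -
    have "v mod 4 \<in> {0, 1, 2, 3}" "v div 4 mod 2 \<in> {0, 1}" by auto
    then show ?thesis by (auto simp: vtx_def Let_def)
  qed
  moreover have "v = vtx 1 v" if "v \<in> {0, 1, 2, 3, 5, 6}" for v
    using that by (auto simp: vtx_def Let_def)
  ultimately show ?thesis unfolding vertices_def by blast
qed

lemma arrows_1: "arrows 1 = {Alpha 0, Alpha 1, Alpha 2, Alpha 3, Alpha 4, Alpha 5, Gamma 0}"
proof -
  have "0 \<le> i \<and> i < 6 \<Longrightarrow> i \<in> {0, 1, 2, 3, 4, 5}" for i :: int by auto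
  then have "{Alpha i |i. 0 \<le> i \<and> i < 6} = {Alpha 0, Alpha 1, Alpha 2, Alpha 3, Alpha 4, Alpha 5}" by fastforce
  moreover have "{Gamma t |t. 0 \<le> t \<and> t < 1} = {Gamma 0}" by auto
  ultimately show ?thesis unfolding arrows_def by auto
qed

lemma tgt_vertices: "tgt s a \<in> vertices s"
  by (cases a) (auto simp: vertices_def)

lemma endv_vertices: "v \<in> vertices s \<Longrightarrow> endv s v ws \<in> vertices s"
  by (induction ws arbitrary: v) (auto simp: tgt_vertices)

lemma endv_append: "endv s v (xs @ ys) = endv s (endv s v xs) ys"
  by (induction xs arbitrary: v) auto

lemma valid_append:
  "valid s (v, xs @ ys) \<longleftrightarrow> valid s (v, xs) \<and> valid s (endv s v xs, ys)"
proof -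
  have "walk s v (xs @ ys) \<longleftrightarrow> walk s v xs \<and> walk s (endv s v xs) ys" for v
    by (induction xs arbitrary: v) auto
  then show ?thesis by (auto simp: valid_def endv_vertices)
qed

lemma valid_take_drop:
  assumes "valid s (v, ws)"
  shows "valid s (v, take k ws)" "valid s (endv s v (take k ws), drop k ws)"
  using assms valid_append[of s v "take k ws" "drop k ws"] by auto

text \<open>Both sides sum over the ways to cut the path at two positions
  \<open>k \<le> m\<close>.\<close>

lemma kmult_assoc: "kmult s (kmult s x y) z = kmult s x (kmult s y z)"
proof (rule ext, clarify)
  fix v ws
  show "kmult s (kmult s x y) z (v, ws) = kmult s x (kmult s y z) (v, ws)"
  proof (cases "valid s (v, ws)")
    case True
    let ?n = "length ws"
    let ?t = "\<lambda>k m. x (endv s v (take m ws), drop m ws) *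
      y (endv s v (take k ws), drop k (take m ws)) * z (v, take k ws)"
    have e: "endv s (endv s v (take k ws)) (take j (drop k ws)) = endv s v (take (k + j) ws)" for k j
      by (metis endv_append take_add)
    have "kmult s (kmult s x y) z (v, ws) = (\<Sum>k\<in>{0..?n}. \<Sum>j\<in>{0..?n - k}. ?t k (k + j))"
      unfolding kmult_def using True valid_take_drop(2)[OF True]
      by (auto simp: sum_distrib_right e drop_take add.commute intro!: sum.cong)
    also have "\<dots> = (\<Sum>(k, j)\<in>(SIGMA k:{0..?n}. {0..?n - k}). ?t k (k + j))"
      by (rule sum.Sigma) auto
    also have "\<dots> = (\<Sum>(m, k)\<in>(SIGMA m:{0..?n}. {0..m}). ?t k m)"
      by (rule sum.reindex_bij_witness[of _ "\<lambda>(m, k). (k, m - k)" "\<lambda>(k, j). (k + j, k)"]) auto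
    also have "\<dots> = (\<Sum>m\<in>{0..?n}. \<Sum>k\<in>{0..m}. ?t k m)"
      by (rule sum.Sigma[symmetric]) auto
    also have "\<dots> = kmult s x (kmult s y z) (v, ws)"
      unfolding kmult_def using True valid_take_drop(1)[OF True]
      by (auto simp: sum_distrib_left mult.assoc min.absorb2 intro!: sum.cong)
    finally show ?thesis .
  qed (simp add: kmult_def)
qed

lemma kmult_kadd_left: "kmult s (kadd x y) z = kadd (kmult s x z) (kmult s y z)"
  by (auto simp: fun_eq_iff kadd_def kmult_def algebra_simps sum.distrib)

lemma kmult_kadd_right: "kmult s x (kadd y z) = kadd (kmult s x y) (kmult s x z)"
  by (auto simp: fun_eq_iff kadd_def kmult_def algebra_simps sum.distrib)

lemma kmult_kscale_left: "kmult s (kscale c x) y = kscale c (kmult s x y)"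
  by (auto simp: fun_eq_iff kscale_def kmult_def algebra_simps sum_distrib_left)

lemma kmult_kscale_right: "kmult s x (kscale c y) = kscale c (kmult s x y)"
  by (auto simp: fun_eq_iff kscale_def kmult_def algebra_simps sum_distrib_left)

abbreviation kone :: "path \<Rightarrow> 'k::field" where
  "kone \<equiv> \<lambda>p. if snd p = [] \<and> fst p \<in> vertices 1 then 1 else 0"

lemma kmult_kone_left:
  assumes "kq 1 x" shows "kmult 1 kone x = (x :: path \<Rightarrow> 'k::field)"
proof (rule ext, clarify)
  fix v ws
  show "kmult 1 kone x (v, ws) = x (v, ws)"
  proof (cases "valid 1 (v, ws)")
    case True
    then have "endv 1 v ws \<in> vertices 1" by (simp add: valid_def endv_vertices)
    then have "(\<Sum>k\<in>{0..length ws}. kone (endv 1 v (take k ws), drop k ws) * x (v, take k ws))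
        = (\<Sum>k\<in>{length ws}. x (v, take k ws))"
      by (intro sum.mono_neutral_cong_right) auto
    then show ?thesis using True by (simp add: kmult_def)
  next
    case False
    then have "x (v, ws) = 0" using assms unfolding kq_def by blast
    with False show ?thesis by (simp add: kmult_def)
  qed
qed

lemma kmult_kone_right:
  assumes "kq 1 x" shows "kmult 1 x kone = (x :: path \<Rightarrow> 'k::field)"
proof (rule ext, clarify)
  fix v ws
  show "kmult 1 x kone (v, ws) = x (v, ws)"
  proof (cases "valid 1 (v, ws)")
    case True
    then have "v \<in> vertices 1" by (simp add: valid_def)
    then have "(\<Sum>k\<in>{0..length ws}. x (endv 1 v (take k ws), drop k ws) * kone (v, take k ws))
        = (\<Sum>k\<in>{0}. x (endv 1 v (take k ws), drop k ws))"
      by (intro sum.mono_neutral_cong_right) auto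
    then show ?thesis using True by (simp add: kmult_def)
  next
    case False
    then have "x (v, ws) = 0" using assms unfolding kq_def by blast
    with False show ?thesis by (simp add: kmult_def)
  qed
qed

lemma rel_refl_iff: "rel s x x \<longleftrightarrow> kq s x"
  by (simp add: rel_def ksub_self idl.zero)

lemma R1_cases:
  obtains x where "a = abs_R1 x" "kq 1 x"
  by (metis Quotient3_R1 Quotient3_abs_rep Quotient3_rep_reflp rel_refl_iff)

lemma abs_R1_eq_iff:
  assumes "kq 1 x" "kq 1 y"
  shows "abs_R1 x = abs_R1 y \<longleftrightarrow> ksub x y \<in> idl 1"
  using Quotient3_rel[OF Quotient3_R1, of x y] assms by (auto simp: rel_def ksub_self idl.zero)

lemma abs_R1_mult: "kq 1 x \<Longrightarrow> kq 1 y \<Longrightarrow> r1_mult (abs_R1 x) (abs_R1 y) = abs_R1 (kmult 1 x y)"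
  by (simp add: r1_mult.abs_eq rel_refl_iff)

lemma abs_R1_add: "kq 1 x \<Longrightarrow> kq 1 y \<Longrightarrow> abs_R1 x + abs_R1 y = abs_R1 (kadd x y)"
  by (simp add: plus_R1_def r1_add.abs_eq rel_refl_iff)

lemma abs_R1_scale: "kq 1 x \<Longrightarrow> r1_scale c (abs_R1 x) = abs_R1 (kscale c x)"
  by (simp add: r1_scale.abs_eq rel_refl_iff)

lemma zero_R1_abs: "0 = abs_R1 (\<lambda>p. 0)"
  by (simp add: zero_R1_def r1_zero_def)

text \<open>\<open>(v,k,w)\<close> stands for the nonzero path of length \<open>k\<close> from \<open>v\<close> to \<open>w\<close>, which is unique modulo the
  relations.\<close>

type_synonym bel = "int \<times> int \<times> int"

text \<open>A decision tree for membership in \<open>basis\<close>, in nested conditionals for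
  evaluation by \<open>code_simp\<close>.\<close>

definition is_bel :: "int \<Rightarrow> int \<Rightarrow> int \<Rightarrow> bool" where
  "is_bel v k w = (
    if v = 0 then (if k = 0 then w = 0 else if k = 1 then (if w = 1 then True else w = 5)
      else if k = 2 then (if w = 2 then True else w = 6) else if k = 3 then w = 3 else if k = 4 then w = 0 else False)
    else if v = 3 then (if k = 0 then w = 3 else if k = 1 then w = 0 else if k = 2 then (if w = 1 then True else w = 5)
      else if k = 3 then (if w = 2 then True else w = 6) else if k = 4 then w = 3 else False)
    else if v = 1 then (if k = 0 then w = 1 else if k = 1 then w = 2 else if k = 2 then w = 3 else if k = 3 then w = 0 else if k = 4 then w = 5 else False)
    else if v = 2 then (if k = 0 then w = 2 else if k = 1 then w = 3 else if k = 2 then w = 0 else if k = 3 then w = 5 else if k = 4 then w = 6 else False)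
    else if v = 5 then (if k = 0 then w = 5 else if k = 1 then w = 6 else if k = 2 then w = 3 else if k = 3 then w = 0 else if k = 4 then w = 1 else False)
    else if v = 6 then (if k = 0 then w = 6 else if k = 1 then w = 3 else if k = 2 then w = 0 else if k = 3 then w = 1 else if k = 4 then w = 2 else False)
    else False)"

definition basis :: "bel list" where
  "basis = [(0,0,0),(0,1,1),(0,1,5),(0,2,2),(0,2,6),(0,3,3),(0,4,0),
    (1,0,1),(1,1,2),(1,2,3),(1,3,0),(1,4,5),(2,0,2),(2,1,3),(2,2,0),(2,3,5),(2,4,6),
    (3,0,3),(3,1,0),(3,2,1),(3,2,5),(3,3,2),(3,3,6),(3,4,3),
    (5,0,5),(5,1,6),(5,2,3),(5,3,0),(5,4,1),(6,0,6),(6,1,3),(6,2,0),(6,3,1),(6,4,2)]"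

lemma is_bel_iff: "is_bel v k w \<longleftrightarrow> (v, k, w) \<in> set basis"
  by (auto simp: is_bel_def basis_def)

text \<open>The right factor is traversed first. A nonzero product is determined by its start,
  length and end, and the product is zero exactly when no basis element has these data.\<close>

fun bmul :: "bel \<Rightarrow> bel \<Rightarrow> bel option" where
  "bmul (v,k,w) (v',k',w') =
    (if v = w' then (if is_bel v' (k' + k) w then Some (v', k' + k, w) else None) else None)"

text \<open>At vertex \<open>0\<close> the branch through \<open>5\<close> and \<open>6\<close> is
  entered only if it contains the target; the branch of \<open>Alpha 0\<close> is the default when
  both lead there.\<close>

fun route :: "nat \<Rightarrow> int \<Rightarrow> int \<Rightarrow> arrow list" where
  "route 0 v w = []"
| "route (Suc k) v w =
    (if v = 0 then (if w = 5 \<or> w = 6 then Alpha 3 # route k 5 w else Alpha 0 # route k 1 w)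
     else if v = 1 then Alpha 1 # route k 2 w
     else if v = 2 then Alpha 2 # route k 3 w
     else if v = 5 then Alpha 4 # route k 6 w
     else if v = 6 then Alpha 5 # route k 3 w
     else Gamma 0 # route k 0 w)"

fun path_of :: "bel \<Rightarrow> path" where "path_of (v, k, w) = (v, route (nat k) v w)"

text \<open>The three exceptional basis elements are represented by a path through each branch.\<close>

fun coord :: "(path \<Rightarrow> 'k::field) \<Rightarrow> bel \<Rightarrow> 'k" where
  "coord x b = x (path_of b) +
    (if b = (0,3,3) then x (0, [Alpha 3, Alpha 4, Alpha 5])
     else if b = (0,4,0) then x (0, [Alpha 3, Alpha 4, Alpha 5, Gamma 0])
     else if b = (3,4,3) then x (3, [Gamma 0, Alpha 3, Alpha 4, Alpha 5]) else 0)"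

text \<open>For \<open>s = 1\<close> the relations indexed by \<open>t\<close> depend only on the
  parity of \<open>t\<close>. The commutativity relation thus occurs with both signs, and there are
  two zero relations of length three.\<close>

lemma gens_1_cases:
  assumes "g \<in> gens 1"
  obtains p where "g = bp p" "valid 1 p" "length (snd p) = 5"
    | "g = ksub (bp (0, [Alpha 0, Alpha 1, Alpha 2])) (bp (0, [Alpha 3, Alpha 4, Alpha 5]))"
    | "g = ksub (bp (0, [Alpha 3, Alpha 4, Alpha 5])) (bp (0, [Alpha 0, Alpha 1, Alpha 2]))"
    | "g = bp (2, [Alpha 2, Gamma 0, Alpha 0])" | "g = bp (6, [Alpha 5, Gamma 0, Alpha 3])"
proof -
  have t: "\<exists>k. t = 2 * k \<or> t = 2 * k + 1" for t :: int by presburger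
  from assms consider p where "g = bp p" "valid 1 p" "length (snd p) = 5"
    | t where "g = ksub (bp (pth 1 [alpha 1 (3*t+2), alpha 1 (3*t+1), alpha 1 (3*t)]))
            (bp (pth 1 [alpha 1 (3*(t+1)+2), alpha 1 (3*(t+1)+1), alpha 1 (3*(t+1))]))"
    | t where "g = bp (pth 1 [alpha 1 (3*t), gamma 1 (t-1), alpha 1 (3*(t+1) - 1)])"
    unfolding gens_def by blast
  then show thesis
  proof cases
    case (2 t)
    obtain k where "t = 2 * k \<or> t = 2 * k + 1" using t by blast
    then show thesis
    proof
      assume k: "t = 2 * k"
      show thesis by (rule that(2)) (simp add: 2 k pth_def alpha_def vtx_def algebra_simps)
    next
      assume k: "t = 2 * k + 1"
      show thesis by (rule that(3)) (simp add: 2 k pth_def alpha_def vtx_def algebra_simps)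
    qed
  next
    case (3 t)
    obtain k where "t = 2 * k \<or> t = 2 * k + 1" using t by blast
    then show thesis
    proof
      assume k: "t = 2 * k"
      show thesis by (rule that(4)) (simp add: 3 k pth_def alpha_def gamma_def vtx_def algebra_simps)
    next
      assume k: "t = 2 * k + 1"
      show thesis by (rule that(5)) (simp add: 3 k pth_def alpha_def gamma_def vtx_def algebra_simps)
    qed
  qed (rule that(1))
qed

lemma gens_1:
  "valid 1 p \<Longrightarrow> length (snd p) = 5 \<Longrightarrow> bp p \<in> gens 1"
  "ksub (bp (0, [Alpha 0, Alpha 1, Alpha 2])) (bp (0, [Alpha 3, Alpha 4, Alpha 5])) \<in> gens 1"
  "bp (2, [Alpha 2, Gamma 0, Alpha 0]) \<in> gens 1" "bp (6, [Alpha 5, Gamma 0, Alpha 3]) \<in> gens 1"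
proof -
  have "ksub (bp (pth 1 [alpha 1 (3*0+2), alpha 1 (3*0+1), alpha 1 (3*0)]))
            (bp (pth 1 [alpha 1 (3*(0+1)+2), alpha 1 (3*(0+1)+1), alpha 1 (3*(0+1))])) \<in> gens 1"
    unfolding gens_def by blast
  then show "ksub (bp (0, [Alpha 0, Alpha 1, Alpha 2])) (bp (0, [Alpha 3, Alpha 4, Alpha 5])) \<in> gens 1"
    by (simp add: pth_def alpha_def vtx_def)
  have *: "bp (pth 1 [alpha 1 (3*t), gamma 1 (t-1), alpha 1 (3*(t+1) - 1)]) \<in> gens 1" for t
    unfolding gens_def by blast
  show "bp (2, [Alpha 2, Gamma 0, Alpha 0]) \<in> gens 1" "bp (6, [Alpha 5, Gamma 0, Alpha 3]) \<in> gens 1"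
    using *[of 0] *[of 1] by (simp_all add: pth_def alpha_def gamma_def vtx_def)
qed (unfold gens_def, blast)

lemma gens_coord:
  assumes "g \<in> gens 1" shows "\<forall>b\<in>set basis. coord g b = (0::'k::field)"
  using assms
proof (cases rule: gens_1_cases)
  case (1 p)
  then obtain v a b c d e where "p = (v, [a, b, c, d, e])"
    by (cases p) (auto simp: eval_nat_numeral length_Suc_conv)
  with 1 show ?thesis by (simp add: basis_def bp_def eval_nat_numeral)
qed (simp_all add: basis_def ksub_def bp_def eval_nat_numeral)

text \<open>The vanishing of all coordinates, solved for the values of \<open>x\<close>, so that it
  can be used for rewriting in the two closure proofs that follow.\<close>

lemma coord_eq_0_iff:
  "(\<forall>b\<in>set basis. coord x b = 0) \<longleftrightarrow>
     (\<forall>b\<in>set basis. b \<notin> {(0,3,3), (0,4,0), (3,4,3)} \<longrightarrow> x (path_of b) = 0) \<and>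
     x (0, [Alpha 3, Alpha 4, Alpha 5]) = - x (0, [Alpha 0, Alpha 1, Alpha 2]) \<and>
     x (0, [Alpha 3, Alpha 4, Alpha 5, Gamma 0]) = - x (0, [Alpha 0, Alpha 1, Alpha 2, Gamma 0]) \<and>
     x (3, [Gamma 0, Alpha 3, Alpha 4, Alpha 5]) = - x (3, [Gamma 0, Alpha 0, Alpha 1, Alpha 2])"
  by (rule iffI; simp add: basis_def eval_nat_numeral eq_neg_iff_add_eq_0 add.commute)

lemma kmult_short:
  "valid s (v, []) \<Longrightarrow> kmult s x y (v, []) = x (v, []) * y (v, [])"
  "valid s (v, [a]) \<Longrightarrow> kmult s x y (v, [a]) = x (v, [a]) * y (v, []) + x (tgt s a, []) * y (v, [a])"
  "valid s (v, [a, b]) \<Longrightarrow> kmult s x y (v, [a, b]) =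
     x (v, [a, b]) * y (v, []) + x (tgt s a, [b]) * y (v, [a]) + x (tgt s b, []) * y (v, [a, b])"
  "valid s (v, [a, b, c]) \<Longrightarrow> kmult s x y (v, [a, b, c]) =
     x (v, [a, b, c]) * y (v, []) + x (tgt s a, [b, c]) * y (v, [a]) + x (tgt s b, [c]) * y (v, [a, b])
       + x (tgt s c, []) * y (v, [a, b, c])"
  "valid s (v, [a, b, c, d]) \<Longrightarrow> kmult s x y (v, [a, b, c, d]) =
     x (v, [a, b, c, d]) * y (v, []) + x (tgt s a, [b, c, d]) * y (v, [a]) + x (tgt s b, [c, d]) * y (v, [a, b])
       + x (tgt s c, [d]) * y (v, [a, b, c]) + x (tgt s d, []) * y (v, [a, b, c, d])"
  by (simp_all add: kmult_def sum.atLeast0_atMost_Suc)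

lemma arrow_1_simps:
  "src 1 (Alpha 0) = 0" "src 1 (Alpha 1) = 1" "src 1 (Alpha 2) = 2" "src 1 (Alpha 3) = 0" "src 1 (Alpha 4) = 5"
  "src 1 (Alpha 5) = 6" "src 1 (Gamma 0) = 3" "tgt 1 (Alpha 0) = 1" "tgt 1 (Alpha 1) = 2" "tgt 1 (Alpha 2) = 3"
  "tgt 1 (Alpha 3) = 5" "tgt 1 (Alpha 4) = 6" "tgt 1 (Alpha 5) = 3" "tgt 1 (Gamma 0) = 0"
  by (simp_all add: vtx_def)

text \<open>A coordinate of \<open>kmult 1 a x\<close> involves \<open>x\<close> only on initial
  segments of representing paths. These are again representing paths, except that for the
  coordinates with two representatives the contributions of the two branches cancel.\<close>

lemma coord_kmult_left:
  assumes "\<forall>b\<in>set basis. coord x b = 0" shows "\<forall>b\<in>set basis. coord (kmult 1 a x) b = (0::'k::field)"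
  using assms unfolding coord_eq_0_iff
  by (simp add: basis_def eval_nat_numeral kmult_short valid_def vertices_1 arrows_1 arrow_1_simps del: src.simps tgt.simps)

lemma coord_kmult_right:
  assumes "\<forall>b\<in>set basis. coord x b = 0" shows "\<forall>b\<in>set basis. coord (kmult 1 x a) b = (0::'k::field)"
  using assms unfolding coord_eq_0_iff
  by (simp add: basis_def eval_nat_numeral kmult_short valid_def vertices_1 arrows_1 arrow_1_simps del: src.simps tgt.simps)

lemma coord_kadd: "coord (kadd x y) b = coord x b + coord y b"
  by (simp add: kadd_def)

lemma coord_kscale: "coord (kscale c x) b = c * coord x b"
  by (simp add: kscale_def distrib_left)

lemma coord_ksub: "coord (ksub x y) b = coord x b - coord y b"
  by (simp add: ksub_def)

lemma coord_zero: "coord (\<lambda>p. 0) b = 0"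
  by simp

declare coord.simps [simp del]

text \<open>Well-definedness of the coordinates on the quotient; the linear independence of the
  basis rests on it.\<close>

lemma coord_idl: "x \<in> idl 1 \<Longrightarrow> \<forall>b\<in>set basis. coord x b = 0"
proof (induction rule: idl.induct)
  case (gen g) then show ?case by (rule gens_coord)
next
  case zero show ?case by (simp add: coord_zero)
next
  case (add x y) then show ?case by (simp add: coord_kadd)
next
  case (scale x c) then show ?case by (simp add: coord_kscale)
next
  case (lmult x a) then show ?case by (intro coord_kmult_left)
next
  case (rmult x a) then show ?case by (intro coord_kmult_right)
qed

definition crd :: "bel \<Rightarrow> 'k::field R1 \<Rightarrow> 'k" where
  "crd b a = coord (rep_R1 a) b"

lemma crd_abs: "kq 1 x \<Longrightarrow> b \<in> set basis \<Longrightarrow> crd b (abs_R1 x) = coord x b"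
proof -
  assume x: "kq 1 x" and b: "b \<in> set basis"
  have "rel 1 (rep_R1 (abs_R1 x)) x"
    using x rep_abs_rsp_left[OF Quotient3_R1, of x x] by (simp add: rel_refl_iff)
  then have "coord (ksub (rep_R1 (abs_R1 x)) x) b = 0"
    using coord_idl b by (auto simp: rel_def)
  then show ?thesis by (simp add: crd_def coord_ksub)
qed

lemma crd_add: "b \<in> set basis \<Longrightarrow> crd b (x + y) = crd b x + crd b y"
  by (rule R1_cases[of x], rule R1_cases[of y]) (simp add: abs_R1_add crd_abs kq_add coord_kadd)

lemma crd_scale: "b \<in> set basis \<Longrightarrow> crd b (r1_scale c x) = c * crd b x"
  by (rule R1_cases[of x]) (simp add: abs_R1_scale crd_abs kq_scale coord_kscale)

lemma kq_kone: "kq 1 (kone :: path \<Rightarrow> 'k::field)"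
proof -
  have "{p. (kone p :: 'k) \<noteq> 0} \<subseteq> (\<lambda>v. (v, [])) ` vertices 1" by auto
  then have "finite {p. (kone p :: 'k) \<noteq> 0}" by (rule finite_subset) (simp add: vertices_1)
  then show ?thesis unfolding kq_def valid_def by (auto split: if_splits)
qed

lemma r1_one_abs: "r1_one = abs_R1 kone"
  by (simp add: r1_one_def)

instantiation R1 :: (field) ring_1
begin
definition "1 = (r1_one :: 'a R1)"
definition "a * b = r1_mult a (b :: 'a R1)"
instance
proof
  fix a b c :: "'a R1"
  obtain x y z where e [simp]: "a = abs_R1 x" "b = abs_R1 y" "c = abs_R1 z"
    and k [simp]: "kq 1 x" "kq 1 y" "kq 1 z"
    by (rule R1_cases[of a], rule R1_cases[of b], rule R1_cases[of c])
  note [simp] = times_R1_def one_R1_def r1_one_abs abs_R1_mult abs_R1_add kq_add kq_mult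
  show "a * b * c = a * (b * c)" by (simp add: kmult_assoc)
  show "(a + b) * c = a * c + b * c" by (simp add: kmult_kadd_left)
  show "a * (b + c) = a * b + a * c" by (simp add: kmult_kadd_right)
  show "1 * a = a"
    unfolding times_R1_def one_R1_def r1_one_abs e(1) abs_R1_mult[OF kq_kone k(1)] kmult_kone_left[OF k(1)] ..
  show "a * 1 = a"
    unfolding times_R1_def one_R1_def r1_one_abs e(1) abs_R1_mult[OF k(1) kq_kone] kmult_kone_right[OF k(1)] ..
  show "(0::'a R1) \<noteq> 1"
  proof
    assume "(0::'a R1) = 1"
    then have "crd (0,0,0) (0::'a R1) = crd (0,0,0) (1::'a R1)" by simp
    moreover have b: "(0,0,0) \<in> set basis" by (simp add: basis_def)
    ultimately have "coord (\<lambda>p. 0 :: 'a) (0,0,0) = coord kone (0,0,0)"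
      unfolding zero_R1_abs one_R1_def r1_one_abs crd_abs[OF kq_kone b] crd_abs[OF kq_zero b] by fast
    then show False by (simp add: coord.simps vertices_1)
  qed
qed
end

lemma vector_space_r1_scale: "vector_space (r1_scale :: 'k::field \<Rightarrow> 'k R1 \<Rightarrow> 'k R1)"
proof
  fix a b :: 'k and x y :: "'k R1"
  obtain u v where [simp]: "x = abs_R1 u" "kq 1 u" "y = abs_R1 v" "kq 1 v"
    by (rule R1_cases[of x], rule R1_cases[of y])
  note [simp] = abs_R1_scale abs_R1_add kq_add kq_scale
  have "kscale a (kadd u v) = kadd (kscale a u) (kscale a v)" "kscale (a + b) u = kadd (kscale a u) (kscale b u)"
    "kscale a (kscale b u) = kscale (a * b) u" "kscale 1 u = u"
    by (simp_all add: kadd_def kscale_def algebra_simps)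
  then show "r1_scale a (x + y) = r1_scale a x + r1_scale a y"
    "r1_scale (a + b) x = r1_scale a x + r1_scale b x"
    "r1_scale a (r1_scale b x) = r1_scale (a * b) x" "r1_scale 1 x = x"
    by simp_all
qed

lemma r1_scale_mult:
  "r1_scale c (x * y) = r1_scale c x * (y :: 'k::field R1)"
  "r1_scale c (x * y) = x * r1_scale c (y :: 'k::field R1)"
  by (rule R1_cases[of x], rule R1_cases[of y],
      simp add: times_R1_def abs_R1_mult abs_R1_scale kq_mult kq_scale kmult_kscale_left kmult_kscale_right)+

section \<open>Products of basis elements, independence and spanning\<close>

definition pR :: "path \<Rightarrow> 'k::field R1" where "pR p = abs_R1 (bp p)"

definition be :: "bel \<Rightarrow> 'k::field R1" where "be b = pR (path_of b)"

lemma kq_bp: "valid s p \<Longrightarrow> kq s (bp p)"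
  unfolding kq_def bp_def by auto

lemma kmult_bp:
  assumes "valid s (v, ws)" "valid s (v', ws')"
  shows "kmult s (bp (v, ws)) (bp (v', ws')) =
    (if endv s v' ws' = v then bp (v', ws' @ ws) else (\<lambda>p. 0 :: 'k::field))"
proof (rule ext, clarify)
  fix u us
  let ?t = "\<lambda>k. bp (v, ws) (endv s u (take k us), drop k us) * (bp (v', ws') (u, take k us) :: 'k)"
  have t: "?t k = 0" if "k \<le> length us" "\<not> (u = v' \<and> us = ws' @ ws \<and> k = length ws' \<and> endv s v' ws' = v)" for k
    using that append_take_drop_id[of k us] by (auto simp: bp_def)
  show "kmult s (bp (v, ws)) (bp (v', ws')) (u, us) =
    (if endv s v' ws' = v then bp (v', ws' @ ws) else (\<lambda>p. 0 :: 'k)) (u, us)"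
  proof (cases "u = v' \<and> us = ws' @ ws \<and> endv s v' ws' = v")
    case True
    then have "valid s (u, us)" using assms by (simp add: valid_append)
    moreover have "(\<Sum>k\<in>{0..length us}. ?t k) = (\<Sum>k\<in>{length ws'}. ?t k)"
      using True t by (intro sum.mono_neutral_right) auto
    ultimately show ?thesis using True by (simp add: kmult_def) (simp add: bp_def)
  next
    case False
    then have "(\<Sum>k\<in>{0..length us}. ?t k) = 0" using t by (intro sum.neutral) auto
    then show ?thesis using False by (auto simp: kmult_def) (auto simp: bp_def)
  qed
qed

lemma pR_mult:
  assumes "valid 1 (v, ws)" "valid 1 (v', ws')"
  shows "pR (v, ws) * pR (v', ws') = (if endv 1 v' ws' = v then pR (v', ws' @ ws) else (0 :: 'k::field R1))"
  using assms by (simp add: pR_def times_R1_def abs_R1_mult kq_bp kmult_bp zero_R1_abs)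

lemma pR_gens:
  "valid 1 p \<Longrightarrow> length (snd p) = 5 \<Longrightarrow> pR p = (0 :: 'k::field R1)"
  "pR (0, [Alpha 3, Alpha 4, Alpha 5]) = (pR (0, [Alpha 0, Alpha 1, Alpha 2]) :: 'k R1)"
  "pR (2, [Alpha 2, Gamma 0, Alpha 0]) = (0 :: 'k R1)" "pR (6, [Alpha 5, Gamma 0, Alpha 3]) = (0 :: 'k R1)"
proof -
  have z: "pR p = (0 :: 'k R1)" if "(bp p :: path \<Rightarrow> 'k) \<in> gens 1" "valid 1 p" for p
  proof -
    have "ksub (bp p) (\<lambda>p. 0) = (bp p :: path \<Rightarrow> 'k)" by (simp add: ksub_def)
    then show ?thesis unfolding pR_def zero_R1_abs abs_R1_eq_iff[OF kq_bp[OF that(2)] kq_zero]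
      using idl.gen[OF that(1)] by simp
  qed
  show "valid 1 p \<Longrightarrow> length (snd p) = 5 \<Longrightarrow> pR p = (0 :: 'k R1)" by (intro z gens_1)
  note val = valid_def vertices_1 arrows_1 arrow_1_simps
  show "pR (2, [Alpha 2, Gamma 0, Alpha 0]) = (0 :: 'k R1)" "pR (6, [Alpha 5, Gamma 0, Alpha 3]) = (0 :: 'k R1)"
    by (rule z, rule gens_1, simp add: val del: src.simps tgt.simps)+
  have "pR (0, [Alpha 0, Alpha 1, Alpha 2]) = (pR (0, [Alpha 3, Alpha 4, Alpha 5]) :: 'k R1)"
    unfolding pR_def
    by (subst abs_R1_eq_iff) (auto simp: val simp del: src.simps tgt.simps intro!: kq_bp idl.gen gens_1)
  then show "pR (0, [Alpha 3, Alpha 4, Alpha 5]) = (pR (0, [Alpha 0, Alpha 1, Alpha 2]) :: 'k R1)" ..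
qed

fun be_opt :: "bel option \<Rightarrow> 'k::field R1" where
  "be_opt None = 0"
| "be_opt (Some b) = be b"

lemma be_pR: "be b = pR (fst b, snd (path_of b))"
  by (cases b) (simp add: be_def)

lemma path_of_basis:
  "b \<in> set basis \<Longrightarrow> valid 1 (fst b, snd (path_of b))"
  "b \<in> set basis \<Longrightarrow> endv 1 (fst b) (snd (path_of b)) = snd (snd b)"
proof -
  have "\<forall>b\<in>set basis. valid 1 (fst b, snd (path_of b)) \<and> endv 1 (fst b) (snd (path_of b)) = snd (snd b)"
    by (simp add: basis_def eval_nat_numeral valid_def vertices_1 arrows_1 arrow_1_simps del: src.simps tgt.simps)
  then show "b \<in> set basis \<Longrightarrow> valid 1 (fst b, snd (path_of b))"
    "b \<in> set basis \<Longrightarrow> endv 1 (fst b) (snd (path_of b)) = snd (snd b)" by blast+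
qed

text \<open>All products are reduced to this finite case. One arrow in front of a representing path
  gives a representing path, a path killed by the relations, or the second representative of an
  exceptional element.\<close>

lemma be_arrow:
  assumes "b \<in> set basis" "a \<in> arrows 1" "tgt 1 a = fst b"
  shows "be b * pR (src 1 a, [a]) = (be_opt (bmul b (src 1 a, 1, tgt 1 a)) :: 'k::field R1)"
proof -
  note val = valid_def vertices_1 arrows_1 arrow_1_simps
  have "pR (v, [a, c, d, e, f]) = (0 :: 'k R1)" if "valid 1 (v, [a, c, d, e, f])" for v a c d e f
    using pR_gens(1)[OF that] by simp
  note five = this
  have app: "pR (v, xs @ ys) = pR (endv 1 v xs, ys) * (pR (v, xs) :: 'k R1)" if "valid 1 (v, xs @ ys)" for v xs ys
    using that pR_mult[where 'k = 'k, of "endv 1 v xs" ys v xs] by (simp add: valid_append)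
  \<comment> \<open>Consequences of the relations in length four, each obtained by multiplying a
    relation by one more arrow.\<close>
  have four: "pR (2, [Alpha 2, Gamma 0, Alpha 0, Alpha 1]) = (0 :: 'k R1)"
    "pR (6, [Alpha 5, Gamma 0, Alpha 3, Alpha 4]) = (0 :: 'k R1)"
    "pR (1, [Alpha 1, Alpha 2, Gamma 0, Alpha 0]) = (0 :: 'k R1)"
    "pR (5, [Alpha 4, Alpha 5, Gamma 0, Alpha 3]) = (0 :: 'k R1)"
    "pR (0, [Alpha 3, Alpha 4, Alpha 5, Gamma 0]) = (pR (0, [Alpha 0, Alpha 1, Alpha 2, Gamma 0]) :: 'k R1)"
    using app[of 2 "[Alpha 2, Gamma 0, Alpha 0]" "[Alpha 1]"] app[of 6 "[Alpha 5, Gamma 0, Alpha 3]" "[Alpha 4]"]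
      app[of 1 "[Alpha 1]" "[Alpha 2, Gamma 0, Alpha 0]"] app[of 5 "[Alpha 4]" "[Alpha 5, Gamma 0, Alpha 3]"]
      app[of 0 "[Alpha 3, Alpha 4, Alpha 5]" "[Gamma 0]"] app[of 0 "[Alpha 0, Alpha 1, Alpha 2]" "[Gamma 0]"]
    by (simp_all add: val pR_gens del: src.simps tgt.simps)
  have v: "valid 1 (src 1 a, [a])"
    using assms(2) by (auto simp: val simp del: src.simps tgt.simps)
  have "be b * pR (src 1 a, [a]) = (pR (src 1 a, a # snd (path_of b)) :: 'k R1)"
    using pR_mult[where 'k = 'k, OF path_of_basis(1)[OF assms(1)] v] assms(3) by (simp add: be_pR)
  also have "\<dots> = be_opt (bmul b (src 1 a, 1, tgt 1 a))"
  proof -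
    have "\<forall>a\<in>arrows 1. \<forall>b\<in>set basis. tgt 1 a = fst b \<longrightarrow>
      pR (src 1 a, a # snd (path_of b)) = (be_opt (bmul b (src 1 a, 1, tgt 1 a)) :: 'k R1)"
      by (simp add: basis_def is_bel_def val be_def five four pR_gens eval_nat_numeral del: src.simps tgt.simps)
    then show ?thesis using assms by blast
  qed
  finally show ?thesis .
qed

text \<open>Right multiplication by a path, arrow by arrow; the arrow traversed first is the
  rightmost factor and comes last.\<close>

fun act :: "bel \<Rightarrow> int \<Rightarrow> arrow list \<Rightarrow> bel option" where
  "act b v [] = Some b"
| "act b v (a # ws) = (case act b (tgt 1 a) ws of None \<Rightarrow> None | Some b' \<Rightarrow> bmul b' (v, 1, tgt 1 a))"

lemma bmul_basis: "bmul b c = Some d \<Longrightarrow> d \<in> set basis \<and> fst d = fst c"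
  by (cases b; cases c) (auto simp: is_bel_iff split: if_splits)

lemma be_mult_pR:
  assumes "valid 1 (v, ws)" "b \<in> set basis" "endv 1 v ws = fst b"
  shows "be b * pR (v, ws) = (be_opt (act b v ws) :: 'k::field R1) \<and>
     (\<forall>c. act b v ws = Some c \<longrightarrow> c \<in> set basis \<and> fst c = v)"
  using assms
proof (induction ws arbitrary: v)
  case Nil
  have "be b * pR (v, []) = (be b :: 'k R1)"
    using pR_mult[where 'k = 'k, OF path_of_basis(1) Nil.prems(1)] Nil.prems by (simp add: be_pR)
  then show ?case using Nil by simp
next
  case (Cons a ws)
  then have a: "a \<in> arrows 1" "src 1 a = v" by (auto simp: valid_def)
  have v: "valid 1 (v, [a])" "valid 1 (tgt 1 a, ws)" using Cons.prems(1) valid_append[of 1 v "[a]" ws] by simp_all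
  have "be b * pR (v, a # ws) = be b * (pR (tgt 1 a, ws) * pR (v, [a]) :: 'k R1)"
    using pR_mult[where 'k = 'k, of "tgt 1 a" ws v "[a]"] v by simp
  also have "\<dots> = be_opt (act b (tgt 1 a) ws) * pR (v, [a])"
    using Cons.IH[OF v(2)] Cons.prems by (simp add: mult.assoc[symmetric])
  finally have *: "be b * pR (v, a # ws) = be_opt (act b (tgt 1 a) ws) * (pR (v, [a]) :: 'k R1)" .
  show ?case
  proof (cases "act b (tgt 1 a) ws")
    case None then show ?thesis using * by simp
  next
    case (Some c)
    then have "c \<in> set basis" "fst c = tgt 1 a" using Cons.IH[OF v(2)] Cons.prems by auto
    then have "be c * pR (v, [a]) = (be_opt (bmul c (v, 1, tgt 1 a)) :: 'k R1)"
      using be_arrow[where 'k = 'k, of c a] a by simp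
    then show ?thesis using * Some bmul_basis[of c "(v, 1, tgt 1 a)"] by auto
  qed
qed

lemma act_route:
  assumes "b \<in> set basis" "c \<in> set basis" "fst b = snd (snd c)"
  shows "act b (fst c) (snd (path_of c)) = bmul b c"
proof -
  have "\<forall>b\<in>set basis. \<forall>c\<in>set basis.
      if fst b = snd (snd c) then act b (fst c) (snd (path_of c)) = bmul b c else True"
    by code_simp
  with assms show ?thesis by metis
qed

lemma be_mult:
  assumes "b \<in> set basis" "c \<in> set basis"
  shows "be b * be c = (be_opt (bmul b c) :: 'k::field R1)"
proof (cases "fst b = snd (snd c)")
  case True
  then have "endv 1 (fst c) (snd (path_of c)) = fst b" using path_of_basis(2)[OF assms(2)] by simp
  then show ?thesis
    using be_mult_pR[where 'k = 'k, OF path_of_basis(1)[OF assms(2)] assms(1)] act_route assms True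
    by (simp add: be_pR[of c])
next
  case False
  have "be b * be c = (0 :: 'k R1)"
    using pR_mult[where 'k = 'k, OF path_of_basis(1)[OF assms(1)] path_of_basis(1)[OF assms(2)]]
      path_of_basis(2)[OF assms(2)] False
    by (simp add: be_pR)
  moreover have "bmul b c = None" using False by (cases b; cases c) auto
  ultimately show ?thesis by simp
qed

text \<open>A representing path gives back start, length and end, so different basis elements have
  different paths. The second representatives that \<open>coord\<close> adds are not the
  representing path of any basis element.\<close>

lemma crd_be:
  assumes "b \<in> set basis" "c \<in> set basis"
  shows "crd b (be c) = (if b = c then 1 else (0::'k::field))"
proof -
  have inj: "\<forall>b\<in>set basis. \<forall>c\<in>set basis. path_of b = path_of c \<longrightarrow> b = c"
  proof (intro ballI impI)
    fix b c assume b: "b \<in> set basis" and c: "c \<in> set basis" and e: "path_of b = path_of c"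
    have len: "length (route n v w) = n" for n v w by (induction n v w rule: route.induct) auto
    have pos: "\<forall>b\<in>set basis. 0 \<le> fst (snd b)" by (simp add: basis_def)
    obtain v k w v' k' w' where bc: "b = (v, k, w)" "c = (v', k', w')" by (cases b; cases c)
    from e have r: "v = v'" "route (nat k) v w = route (nat k') v' w'" by (auto simp: bc)
    from r(2) have "length (route (nat k) v w) = length (route (nat k') v' w')" by (rule arg_cong)
    then have "fst b = fst c" "nat (fst (snd b)) = nat (fst (snd c))" by (simp_all only: bc r(1) len fst_conv snd_conv)
    moreover have "fst (snd b) = fst (snd c)"
      using calculation(2) bspec[OF pos b] bspec[OF pos c] by (simp only: eq_nat_nat_iff)
    moreover have "snd (snd b) = snd (snd c)"
      using path_of_basis(2)[OF b] path_of_basis(2)[OF c] e calculation(1) by simp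
    ultimately show "b = c" by (intro prod_eqI)
  qed
  have alt: "\<forall>c\<in>set basis. (0, [Alpha 3, Alpha 4, Alpha 5]) \<noteq> path_of c \<and>
      (0, [Alpha 3, Alpha 4, Alpha 5, Gamma 0]) \<noteq> path_of c \<and> (3, [Gamma 0, Alpha 3, Alpha 4, Alpha 5]) \<noteq> path_of c"
    by (simp add: basis_def eval_nat_numeral)
  have "crd b (be c) = coord (bp (path_of c)) b"
    unfolding be_def pR_def using path_of_basis(1)[OF assms(2)] assms(1)
    by (intro crd_abs kq_bp) (cases c, auto)
  also have "\<dots> = bp (path_of c) (path_of b)"
    using alt[rule_format, OF assms(2)] unfolding coord.simps bp_def by (simp del: path_of.simps)
  also have "\<dots> = (if b = c then 1 else 0)"
    using inj[rule_format, OF assms] unfolding bp_def by (simp del: path_of.simps)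
  finally show ?thesis .
qed

text \<open>A path is the product of the trivial path at its end with itself, and
  \<open>be_mult_pR\<close> evaluates this product.\<close>

lemma pR_basis: "valid 1 (v, ws) \<Longrightarrow> \<exists>o'. pR (v, ws) = (be_opt o' :: 'k::field R1) \<and> (\<forall>c. o' = Some c \<longrightarrow> c \<in> set basis)"
proof -
  assume v: "valid 1 (v, ws)"
  let ?w = "endv 1 v ws"
  have w: "?w \<in> vertices 1" using v by (simp add: valid_def endv_vertices)
  then have b: "(?w, 0, ?w) \<in> set basis" by (auto simp: vertices_1 basis_def)
  have "be (?w, 0, ?w) * pR (v, ws) = (pR (v, ws) :: 'k R1)"
    using pR_mult[where 'k = 'k, of ?w "[]" v ws] v w by (simp add: be_def valid_def)
  then show ?thesis using be_mult_pR[where 'k = 'k, OF v b]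
    by (intro exI[of _ "act (?w, 0, ?w) v ws"]) auto
qed

text \<open>Spanning: each path is zero or a basis element by \<open>pR_basis\<close>, and a general
  element is built up path by path along its finite support.\<close>

lemma R1_expand: "x = (\<Sum>b\<in>set basis. r1_scale (crd b x) (be b))" for x :: "'k::field R1"
proof -
  interpret vector_space "r1_scale :: 'k \<Rightarrow> 'k R1 \<Rightarrow> 'k R1" by (rule vector_space_r1_scale)
  define P where "P x \<longleftrightarrow> x = (\<Sum>b\<in>set basis. r1_scale (crd b x) (be b))" for x :: "'k R1"
  have crd0: "b \<in> set basis \<Longrightarrow> crd b (0 :: 'k R1) = 0" for b
    using crd_scale[of b 0 "0 :: 'k R1"] by simp
  have P0: "P 0" by (simp add: P_def crd0)
  have Padd: "P (x + y)" if "P x" "P y" for x y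
    using that unfolding P_def
    by (simp add: crd_add scale_left_distrib sum.distrib cong: sum.cong)
  have Psc: "P (r1_scale c x)" if "P x" for c x
  proof -
    have e: "(\<Sum>b\<in>set basis. r1_scale (crd b (r1_scale c x)) (be b)) = r1_scale c (\<Sum>b\<in>set basis. r1_scale (crd b x) (be b))"
      by (simp add: crd_scale scale_sum_right cong: sum.cong)
    show ?thesis unfolding P_def e using that[unfolded P_def] by (rule arg_cong)
  qed
  have Pbe: "P (be c)" if "c \<in> set basis" for c
  proof -
    have "(\<Sum>b\<in>set basis. r1_scale (crd b (be c :: 'k R1)) (be b)) = (\<Sum>b\<in>{c}. r1_scale (crd b (be c)) (be b))"
      using that by (intro sum.mono_neutral_right) (auto simp: crd_be)
    then show ?thesis using that by (simp add: P_def crd_be)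
  qed
  have PpR: "P (pR p)" if "valid 1 p" for p
  proof -
    obtain v ws where "p = (v, ws)" by (cases p)
    with that obtain o' where "pR p = (be_opt o' :: 'k R1)" "\<forall>c. o' = Some c \<longrightarrow> c \<in> set basis"
      using pR_basis[where 'k = 'k, of v ws] by blast
    then show ?thesis using Pbe P0 by (cases o') auto
  qed
  have "P (abs_R1 y)" if "finite S" "{p. y p \<noteq> 0} \<subseteq> S" "kq 1 y" for S y
    using that
  proof (induction S arbitrary: y rule: finite_induct)
    case empty
    then have "y = (\<lambda>p. 0)" by auto
    then show ?case using P0 by (simp add: zero_R1_abs)
  next
    case (insert p S)
    show ?case
    proof (cases "y p = 0")
      case True
      then have "{p. y p \<noteq> 0} \<subseteq> S" using insert.prems by auto
      then show ?thesis using insert by blast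
    next
      case False
      let ?y = "y(p := 0)"
      have val: "valid 1 p" using False insert.prems(2) unfolding kq_def by blast
      have "finite {q. ?y q \<noteq> 0}"
        by (rule finite_subset[of _ "{q. y q \<noteq> 0}"]) (use insert.prems(2) in \<open>auto simp: kq_def\<close>)
      moreover have "\<forall>q. ?y q \<noteq> 0 \<longrightarrow> valid 1 q"
        using insert.prems(2) unfolding kq_def fun_upd_apply by metis
      ultimately have k: "kq 1 ?y" unfolding kq_def by blast
      have "{q. ?y q \<noteq> 0} \<subseteq> S" using insert.prems(1) by auto
      then have "P (abs_R1 ?y)" using k by (rule insert.IH)
      moreover have "abs_R1 y = abs_R1 ?y + r1_scale (y p) (pR p)"
      proof -
        have "y = kadd ?y (kscale (y p) (bp p))" by (auto simp: fun_eq_iff kadd_def kscale_def bp_def)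
        then have "abs_R1 y = abs_R1 (kadd ?y (kscale (y p) (bp p)))" by (rule arg_cong)
        then show ?thesis
          unfolding pR_def abs_R1_scale[OF kq_bp[OF val]] abs_R1_add[OF k kq_scale[OF kq_bp[OF val]]] .
      qed
      ultimately show ?thesis using Padd Psc PpR[OF val] by simp
    qed
  qed
  note fin = this
  obtain y where y: "x = abs_R1 y" "kq 1 y" by (rule R1_cases)
  have "finite {p. y p \<noteq> 0}" using y(2) unfolding kq_def by (rule conjunct1)
  from fin[OF this subset_refl y(2)] have "P x" unfolding y(1) .
  then show ?thesis by (simp only: P_def)
qed

lemma one_R1_sum: "(\<Sum>v\<in>{0,1,2,3,5,6}. be (v, 0, v)) = (1 :: 'k::field R1)"
proof -
  interpret vector_space "r1_scale :: 'k \<Rightarrow> 'k R1 \<Rightarrow> 'k R1" by (rule vector_space_r1_scale)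
  let ?o = "1 :: 'k R1"
  have "crd b ?o = (if fst (snd b) = 0 then 1 else 0)" if "b \<in> set basis" for b
  proof -
    have "\<forall>b\<in>set basis. coord (kone :: path \<Rightarrow> 'k) b = (if fst (snd b) = 0 then 1 else 0)"
      by (simp add: basis_def coord.simps vertices_1 eval_nat_numeral)
    then show ?thesis using that unfolding one_R1_def r1_one_abs crd_abs[OF kq_kone that] by blast
  qed
  then have "?o = (\<Sum>b\<in>set basis. r1_scale (if fst (snd b) = 0 then 1 else 0) (be b))"
    using R1_expand[of ?o] by (simp cong: sum.cong)
  also have "\<dots> = (\<Sum>v\<in>{0,1,2,3,5,6}. be (v, 0, v))"
    by (simp add: basis_def add.assoc)
  finally show ?thesis ..
qed

section \<open>Formal tensors\<close>

abbreviation R1_vertices :: "int set" where "R1_vertices \<equiv> {0, 1, 2, 3, 5, 6}"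

lemma vertex_in_basis: "v \<in> R1_vertices \<Longrightarrow> (v, 0, v) \<in> set basis"
  by (auto simp: basis_def)

lemma basis_ends: "b \<in> set basis \<Longrightarrow> fst b \<in> R1_vertices \<and> snd (snd b) \<in> R1_vertices"
  by (auto simp: basis_def)

lemma be_vertex:
  assumes "b \<in> set basis" "v \<in> R1_vertices"
  shows "be (v, 0, v) * be b = (if snd (snd b) = v then be b else (0 :: 'k::field R1))"
    "be b * be (v, 0, v) = (if fst b = v then be b else (0 :: 'k::field R1))"
  using be_mult[where 'k = 'k, OF vertex_in_basis[OF assms(2)] assms(1)]
    be_mult[where 'k = 'k, OF assms(1) vertex_in_basis[OF assms(2)]] assms(1)
  by (cases b; auto simp: is_bel_iff)+

interpretation R: idempotent_algebra "r1_scale :: 'k::field \<Rightarrow> 'k R1 \<Rightarrow> 'k R1" R1_vertices "\<lambda>v. be (v, 0, v)"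
proof (intro idempotent_algebra.intro kalgebra.intro idempotent_algebra_axioms.intro)
  show "vector_space (r1_scale :: 'k \<Rightarrow> 'k R1 \<Rightarrow> 'k R1)" by (rule vector_space_r1_scale)
  show "finite R1_vertices" by simp
  show "(\<Sum>v\<in>R1_vertices. be (v, 0, v)) = (1 :: 'k R1)" by (rule one_R1_sum)
  show "be (i, 0, i) * be (j, 0, j) = (if i = j then be (i, 0, i) else (0 :: 'k R1))"
    if "i \<in> R1_vertices" "j \<in> R1_vertices" for i j
    using be_vertex(1)[where 'k = 'k, OF vertex_in_basis[OF that(2)] that(1)] by auto
qed (rule r1_scale_mult)+

lemma crd_sum: "b \<in> set basis \<Longrightarrow> crd b (\<Sum>i\<in>I. f i) = (\<Sum>i\<in>I. crd b (f i :: 'k::field R1))"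
proof -
  assume b: "b \<in> set basis"
  have "crd b (0 :: 'k R1) = 0" using crd_scale[OF b, of 0 "0 :: 'k R1"] by simp
  then show ?thesis by (induction I rule: infinite_finite_induct) (auto simp: crd_add[OF b])
qed

lemma lin_expand:
  assumes "R.lin (\<phi> :: 'k::field R1 \<Rightarrow> 'k R1)"
  shows "\<phi> x = (\<Sum>b\<in>set basis. r1_scale (crd b x) (\<phi> (be b)))"
proof -
  have "\<phi> (\<Sum>b\<in>S. r1_scale (crd b x) (be b)) = (\<Sum>b\<in>S. r1_scale (crd b x) (\<phi> (be b)))" if "finite S" for S
    using that
  proof induction
    case empty then show ?case using R.lin_zero[OF assms] by simp
  next
    case (insert b S) then show ?case using assms by (simp add: R.lin_def)
  qed
  from this[of "set basis"] R1_expand[of x] show ?thesis by simp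
qed

lemma lin_eqI:
  assumes "R.lin \<phi>" "R.lin \<psi>" "\<And>b. b \<in> set basis \<Longrightarrow> \<phi> (be b) = \<psi> (be b)"
  shows "\<phi> x = (\<psi> x :: 'k::field R1)"
  using lin_expand[OF assms(1), of x] lin_expand[OF assms(2), of x] assms(3) by (simp cong: sum.cong)

lemma crd_mult_vertex:
  assumes "b \<in> set basis" "v \<in> R1_vertices"
  shows "crd b (x * be (v, 0, v)) = (if fst b = v then crd b x else (0 :: 'k::field))"
proof -
  have "x * be (v, 0, v) = (\<Sum>c\<in>set basis. r1_scale (crd c x) (be c * be (v, 0, v)))"
    by (rule lin_expand) (simp add: R.lin_def distrib_right r1_scale_mult)
  then have "crd b (x * be (v, 0, v)) = (\<Sum>c\<in>set basis. crd c x * crd b (be c * be (v, 0, v)))"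
    by (simp add: crd_sum assms crd_scale)
  also have "\<dots> = (\<Sum>c\<in>{b}. crd c x * crd b (be c * be (v, 0, v)))"
    using assms crd_scale[OF assms(1), of 0 "0 :: 'k R1"]
    by (intro sum.mono_neutral_right) (auto simp: be_vertex(2) crd_be)
  also have "\<dots> = (if fst b = v then crd b x else 0)"
    using assms crd_scale[OF assms(1), of 0 "0 :: 'k R1"] by (simp add: be_vertex(2) crd_be)
  finally show ?thesis .
qed

text \<open>A multilinear map is determined by the coordinates of its values on tuples of basis
  elements, which are finitely many functionals.\<close>

lemma cochain_finite_dim:
  "\<exists>T. finite T \<and> {f. cochain (r1_scale :: 'k::field \<Rightarrow> 'k R1 \<Rightarrow> 'k R1) n f} \<subseteq> R.F.span T"
proof -
  define I where "I = {bs. set bs \<subseteq> set basis \<and> length bs = n} \<times> set basis"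
  define \<phi> where "\<phi> = (\<lambda>(bs, b) (f :: 'k R1 list \<Rightarrow> 'k R1). crd b (f (map be bs)))"
  show ?thesis
  proof (rule R.F.finite_span_of_separating_functionals[where I = I and \<phi> = \<phi>])
    show "finite I" by (simp add: I_def finite_lists_length_eq)
    show "R.F.subspace {f. cochain (r1_scale :: 'k \<Rightarrow> 'k R1 \<Rightarrow> 'k R1) n f}" by (rule R.subspace_cochain)
    show "\<phi> i (x + y) = \<phi> i x + \<phi> i y" if "i \<in> I" for i x y
      using that by (auto simp: \<phi>_def I_def crd_add)
    show "\<phi> i (cscale r1_scale c x) = c * \<phi> i x" if "i \<in> I" for i c x
      using that by (auto simp: \<phi>_def I_def cscale_def crd_scale)
    fix f :: "'k R1 list \<Rightarrow> 'k R1" assume f: "f \<in> {f. cochain r1_scale n f}" and z: "\<And>i. i \<in> I \<Longrightarrow> \<phi> i f = 0"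
    \<comment> \<open>The arguments in \<open>bs\<close> are already basis elements; expanding the
      first one of \<open>ys\<close> moves it over to \<open>bs\<close>.\<close>
    have "f (map be bs @ ys) = 0" if "set bs \<subseteq> set basis" "length bs + length ys = n" for bs ys
      using that
    proof (induction ys arbitrary: bs)
      case Nil
      have "f (map be bs) = (\<Sum>b\<in>set basis. r1_scale (crd b (f (map be bs))) (be b))" by (rule R1_expand)
      also have "\<dots> = 0" using z[of "(bs, _)"] Nil by (intro sum.neutral) (auto simp: \<phi>_def I_def)
      finally show ?case by simp
    next
      case (Cons y ys)
      have "R.lin (\<lambda>a. f (map be bs @ a # ys))"
        using f Cons.prems by (intro R.cochain_lin[of n]) auto
      from lin_expand[OF this, of y] show ?case
        using Cons.IH[of "bs @ [_]"] Cons.prems by simp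
    qed
    from this[of "[]"] have "f ys = 0" for ys
      using R.cochain_length[of n f ys] f by (cases "length ys = n") auto
    then show "f = 0" by (simp add: fun_eq_iff)
  qed
qed

section \<open>Integral tensors and their evaluation\<close>

type_synonym tensor = "(int \<times> bel \<times> bel) list"

fun rmul :: "int \<Rightarrow> bel \<Rightarrow> tensor \<Rightarrow> tensor" where
  "rmul c v [] = []"
| "rmul c v ((c',u',v') # L) = (case bmul v' v of None \<Rightarrow> rmul c v L | Some y \<Rightarrow> (c * c',u',y) # rmul c v L)"

fun lmul :: "bel \<Rightarrow> tensor \<Rightarrow> tensor" where
  "lmul u [] = []"
| "lmul u ((c',u',v') # L) = (case bmul u u' of None \<Rightarrow> lmul u L | Some y \<Rightarrow> (c',y,v') # lmul u L)"

text \<open>The right linear extension of a map given on the elements \<open>u \<otimes> 1\<close>: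
  \<open>u \<otimes> v\<close> goes to \<open>T u\<close> times \<open>v\<close>.\<close>

fun rlin :: "(bel \<Rightarrow> tensor) \<Rightarrow> tensor \<Rightarrow> tensor" where
  "rlin T [] = []"
| "rlin T ((c,u,v) # L) = rmul c v (T u) @ rlin T L"

fun beq :: "bel \<Rightarrow> bel \<Rightarrow> bool" where
  "beq (a,b,c) (a',b',c') = (if a = a' then if b = b' then c = c' else False else False)"

lemma beq_iff: "beq x y \<longleftrightarrow> x = y"
  by (cases x; cases y) auto

fun coeff_at :: "bel \<Rightarrow> bel \<Rightarrow> tensor \<Rightarrow> int" where
  "coeff_at x y [] = 0"
| "coeff_at x y ((c,u,v)#L) =
    (if beq u x then (if beq v y then c + coeff_at x y L else coeff_at x y L) else coeff_at x y L)"

text \<open>Term lists have no normal form, so coefficients are collected. Only pairs occurring in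
  \<open>L\<close> have to be examined, since all other coefficients are 0.\<close>

definition tzero :: "tensor \<Rightarrow> bool" where
  "tzero L = list_all (\<lambda>(c,u,v). coeff_at u v L = 0) L"

fun tbasis :: "tensor \<Rightarrow> bool" where
  "tbasis [] = True"
| "tbasis ((c,(v,k,w),(v',k',w')) # L) = (if is_bel v k w then (if is_bel v' k' w' then tbasis L else False) else False)"

lemma tbasis_iff: "tbasis L \<longleftrightarrow> (\<forall>(c,u,v)\<in>set L. u \<in> set basis \<and> v \<in> set basis)"
  by (induction L rule: tbasis.induct) (auto simp: is_bel_iff)

lemma tbasis_Cons: "tbasis ((c,u,v) # L) \<longleftrightarrow> u \<in> set basis \<and> v \<in> set basis \<and> tbasis L"
  by (simp add: tbasis_iff)

text \<open>\<open>\<phi>\<close> stands for the right linear map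
  \<open>x \<otimes> y \<mapsto> \<phi> x * y\<close>. Through \<open>ev\<close>, an integral
  identity that was evaluated once holds over every field.\<close>

definition ev :: "('k::field R1 \<Rightarrow> 'k R1) \<Rightarrow> tensor \<Rightarrow> 'k R1" where
  "ev \<phi> L = (\<Sum>(c,u,v)\<leftarrow>L. r1_scale (of_int c) (\<phi> (be u) * be v))"

lemma ev_simps [simp]: "ev \<phi> [] = 0" "ev \<phi> ((c,u,v) # L) = r1_scale (of_int c) (\<phi> (be u) * be v) + ev \<phi> L"
  "ev \<phi> (L @ M) = ev \<phi> L + ev \<phi> M"
  by (simp_all add: ev_def)

lemma ev_concat: "ev \<phi> (concat Ls) = (\<Sum>L\<leftarrow>Ls. ev \<phi> L)"
  by (induction Ls) auto

lemma ev_coeff: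
  assumes "finite K" "(\<lambda>(c,u,v). (u,v)) ` set L \<subseteq> K"
  shows "ev \<phi> L = (\<Sum>(u,v)\<in>K. r1_scale (of_int (coeff_at u v L)) (\<phi> (be u) * be v :: 'k::field R1))"
  using assms(2)
proof (induction L)
  case (Cons t L)
  obtain c u v where t: "t = (c, u, v)" by (cases t)
  have "(\<Sum>(x,y)\<in>K. r1_scale (of_int (coeff_at x y (t # L))) (\<phi> (be x) * be y :: 'k R1))
    = (\<Sum>(x,y)\<in>K. (if (x,y) = (u,v) then r1_scale (of_int c) (\<phi> (be x) * be y) else 0)
         + r1_scale (of_int (coeff_at x y L)) (\<phi> (be x) * be y))"
    by (rule sum.cong) (auto simp: t beq_iff R.A.scale_left_distrib)
  also have "\<dots> = (\<Sum>p\<in>K. if p = (u,v) then r1_scale (of_int c) (\<phi> (be u) * be v) else 0) + ev \<phi> L"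
    using Cons by (simp add: split_def sum.distrib) (rule sum.cong, auto)
  also have "\<dots> = r1_scale (of_int c) (\<phi> (be u) * be v) + ev \<phi> L"
    using assms(1) Cons.prems t by simp
  finally show ?case using t by simp
qed simp

lemma ev_tzero: "tzero L \<Longrightarrow> ev \<phi> L = 0"
proof -
  assume z: "tzero L"
  have "ev \<phi> L = (\<Sum>(u,v)\<in>(\<lambda>(c,u,v). (u,v)) ` set L. r1_scale (of_int (coeff_at u v L)) (\<phi> (be u) * be v))"
    by (rule ev_coeff) auto
  also have "\<dots> = 0" using z by (intro sum.neutral) (auto simp: tzero_def list_all_iff)
  finally show ?thesis .
qed

lemma ev_rmul:
  assumes "tbasis L" "v \<in> set basis"
  shows "ev \<phi> (rmul c v L) = r1_scale (of_int c) (ev \<phi> L * (be v :: 'k::field R1))"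
  using assms(1)
proof (induction L)
  case (Cons t L)
  obtain c' u' v' where t: "t = (c', u', v')" by (cases t)
  have "v' \<in> set basis" "tbasis L" using Cons.prems t by (auto simp: tbasis_iff)
  then show ?case using Cons.IH t be_mult[where 'k = 'k, OF \<open>v' \<in> set basis\<close> assms(2)]
    by (cases "bmul v' v")
      (auto simp: distrib_right mult.assoc R.A.scale_right_distrib r1_scale_mult(1)[symmetric])
qed simp

text \<open>Evaluating at \<open>\<phi>\<close> after the right linear map \<open>T\<close> is the
  same as evaluating at the composite \<open>\<psi>\<close>; this turns identities of tables into
  identities of cochains.\<close>

lemma ev_rlin:
  assumes "\<And>b. b \<in> set basis \<Longrightarrow> \<psi> (be b) = ev \<phi> (T b)" "\<And>b. b \<in> set basis \<Longrightarrow> tbasis (T b)" "tbasis L"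
  shows "ev \<phi> (rlin T L) = (ev \<psi> L :: 'k::field R1)"
  using assms(3)
proof (induction L)
  case (Cons t L)
  obtain c u v where t: "t = (c, u, v)" by (cases t)
  with Cons.prems have "u \<in> set basis" "v \<in> set basis" "tbasis L" by (simp_all add: tbasis_Cons)
  then show ?case using Cons.IH t ev_rmul[where 'k = 'k, OF assms(2)] assms(1) by simp
qed simp

text \<open>\<open>pull\<close> with all entries except the last one held fixed.\<close>

definition pl :: "('k \<times> 'k R1 \<times> 'k R1) list \<Rightarrow> ('k::field R1 \<Rightarrow> 'k R1) \<Rightarrow> 'k R1 \<Rightarrow> 'k R1" where
  "pl ts \<phi> x = (\<Sum>(c, u, v)\<leftarrow>ts. r1_scale c (\<phi> (x * u) * v))"

lemma pull_pl: "R.pull ts f (L @ [x]) = pl ts (\<lambda>y. f (L @ [y])) x"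
  by (simp add: R.pull_snoc pl_def)

definition conv :: "tensor \<Rightarrow> ('k::field \<times> 'k R1 \<times> 'k R1) list" where
  "conv L = map (\<lambda>(c, u, v). (of_int c, be u, be v)) L"

lemma pl_conv_1: "pl (conv L) \<phi> 1 = ev \<phi> L"
  by (induction L) (auto simp: pl_def conv_def)

lemma pl_conv_be:
  assumes "R.lin \<phi>" "b \<in> set basis" "tbasis L"
  shows "pl (conv L) \<phi> (be b) = (ev \<phi> (lmul b L) :: 'k::field R1)"
  using assms(3)
proof (induction L)
  case (Cons t L)
  obtain c u v where t: "t = (c, u, v)" by (cases t)
  have "u \<in> set basis" "tbasis L" using Cons.prems t by (auto simp: tbasis_iff)
  then show ?case using Cons.IH t be_mult[where 'k = 'k, OF assms(2) \<open>u \<in> set basis\<close>] R.lin_zero[OF assms(1)]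
    by (cases "bmul b u") (auto simp: pl_def conv_def)
qed (simp add: pl_def conv_def)

lemma tbasis_lmul: "tbasis L \<Longrightarrow> tbasis (lmul b L)"
proof (induction L)
  case (Cons t L)
  obtain c u v where t: "t = (c, u, v)" by (cases t)
  with Cons show ?case using bmul_basis[of b u] by (cases "bmul b u") (simp_all add: tbasis_Cons)
qed simp

lemma lmul_append: "lmul b (L @ M) = lmul b L @ lmul b M"
  by (induction b L rule: lmul.induct) (auto split: option.split)

text \<open>The transpose of the right linear map given by \<open>T\<close>. A homotopy table need
  not be left linear and is prescribed on basis elements only, so coordinates extend it to all
  \<open>x\<close>.\<close>

definition contract :: "(bel \<Rightarrow> tensor) \<Rightarrow> ('k::field R1 \<Rightarrow> 'k R1) \<Rightarrow> 'k R1 \<Rightarrow> 'k R1" where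
  "contract T \<phi> x = (\<Sum>b\<in>set basis. r1_scale (crd b x) (ev \<phi> (T b)))"

lemma contract_be: "b \<in> set basis \<Longrightarrow> contract T \<phi> (be b) = (ev \<phi> (T b) :: 'k::field R1)"
proof -
  assume b: "b \<in> set basis"
  have "contract T \<phi> (be b) = (\<Sum>c\<in>{b}. r1_scale (crd c (be b)) (ev \<phi> (T c)))"
    unfolding contract_def using b by (intro sum.mono_neutral_right) (auto simp: crd_be)
  then show ?thesis using b by (simp add: crd_be)
qed

lemma lin_contract: "R.lin (contract T \<phi>)"
  by (auto simp: R.lin_def contract_def crd_add crd_scale R.A.scale_left_distrib sum.distrib R.A.scale_sum_right cong: sum.cong)

section \<open>The minimal bimodule resolution\<close>

definition swap_vertex :: "int \<Rightarrow> int" where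
  "swap_vertex v = (if v = 1 then 5 else if v = 5 then 1 else if v = 2 then 6 else if v = 6 then 2 else v)"

fun swap_right :: "tensor \<Rightarrow> tensor" where
  "swap_right [] = []"
| "swap_right ((c,u,(v,k,w)) # L) = (c,u,(swap_vertex v, k, swap_vertex w)) # swap_right L"

text \<open>In a pair \<open>(i,j)\<close> paths end at \<open>i\<close> and start at
  \<open>j\<close>. For \<open>r = 1\<close> the pairs are the arrows, for \<open>r = 2\<close> the
  minimal relations: \<open>(3,0)\<close> is the commutativity relation, \<open>(1,2)\<close> and
  \<open>(5,6)\<close> are the zero paths of length three, and the other three come from paths of
  length five.\<close>

definition gen_pairs0 :: "int \<Rightarrow> (int \<times> int) list" where
  "gen_pairs0 r = (
    if r = 0 then [(0,0),(1,1),(2,2),(3,3),(5,5),(6,6)]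
    else if r = 1 then [(1,0),(5,0),(2,1),(3,2),(0,3),(6,5),(3,6)]
    else if r = 2 then [(3,0),(1,2),(5,6),(6,1),(0,3),(2,5)]
    else if r = 3 then [(2,0),(6,0),(3,1),(0,2),(1,3),(5,3),(3,5),(0,6)]
    else if r = 4 then [(3,0),(1,2),(5,6),(0,0),(5,1),(6,2),(3,3),(1,5),(2,6)]
    else if r = 5 then [(1,0),(5,0),(3,2),(3,6),(0,1),(2,3),(6,3),(0,5)]
    else if r = 6 then [(0,0),(5,1),(6,2),(3,3),(1,5),(2,6),(2,1),(0,3),(6,5)]
    else if r = 7 then [(2,0),(6,0),(3,1),(0,2),(1,3),(5,3),(3,5),(0,6)]
    else if r = 8 then [(3,0),(5,2),(1,6),(2,1),(0,3),(6,5)]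
    else if r = 9 then [(3,0),(0,1),(1,2),(2,3),(6,3),(0,5),(5,6)]
    else if r = 10 then [(0,0),(1,1),(2,2),(3,3),(5,5),(6,6)]
    else [])"

text \<open>\<open>bdry_r i\<close> lists the terms \<open>c u \<otimes> v\<close> of the differential \<open>P\<^sub>r \<rightarrow> P\<^sub>r\<^sub>-\<^sub>1\<close> with \<open>u\<close> ending at \<open>i\<close>; a generator
  \<open>(i,j)\<close> is sent to the sum of those with \<open>v\<close> starting at \<open>j\<close>. The table for \<open>r = 0\<close> is the
  differential \<open>P\<^sub>1\<^sub>1 \<rightarrow> P\<^sub>1\<^sub>0\<close>.\<close>

definition bdry_0 :: "int \<Rightarrow> tensor" where
  "bdry_0 i = (
    if i = 0 then
      [(1,(0,0,0),(0,4,0)),(1,(0,4,0),(0,0,0)),(1,(1,3,0),(0,1,1)),(1,(2,2,0),(0,2,2)),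
       (-1,(3,1,0),(0,3,3)),(-1,(5,3,0),(0,1,5)),(1,(6,2,0),(0,2,6))]
    else if i = 1 then
      [(1,(0,1,1),(5,3,0)),(1,(1,0,1),(5,4,1)),(-1,(3,2,1),(5,2,3)),(-1,(5,4,1),(5,0,5)),
       (1,(6,3,1),(5,1,6))]
    else if i = 2 then
      [(1,(0,2,2),(6,2,0)),(1,(1,1,2),(6,3,1)),(1,(2,0,2),(6,4,2)),(-1,(3,3,2),(6,1,3)),
       (1,(6,4,2),(6,0,6))]
    else if i = 3 then
      [(1,(0,3,3),(3,1,0)),(1,(1,2,3),(3,2,1)),(1,(2,1,3),(3,3,2)),(-1,(3,0,3),(3,4,3)),
       (-1,(3,4,3),(3,0,3)),(-1,(5,2,3),(3,2,5)),(1,(6,1,3),(3,3,6))]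
    else if i = 5 then
      [(1,(0,1,5),(1,3,0)),(1,(1,4,5),(1,0,1)),(1,(2,3,5),(1,1,2)),(-1,(3,2,5),(1,2,3)),
       (-1,(5,0,5),(1,4,5))]
    else if i = 6 then
      [(1,(0,2,6),(2,2,0)),(1,(2,4,6),(2,0,2)),(-1,(3,3,6),(2,1,3)),(-1,(5,1,6),(2,3,5)),
       (1,(6,0,6),(2,4,6))]
    else [])"

definition bdry_1 :: "int \<Rightarrow> tensor" where
  "bdry_1 i = (
    if i = 0 then
      [(-1,(0,0,0),(3,1,0)),(1,(3,1,0),(3,0,3))]
    else if i = 1 then
      [(-1,(0,1,1),(0,0,0)),(1,(1,0,1),(0,1,1))]
    else if i = 2 then
      [(-1,(1,1,2),(1,0,1)),(1,(2,0,2),(1,1,2))]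
    else if i = 3 then
      [(-1,(2,1,3),(2,0,2)),(1,(3,0,3),(2,1,3)),(-1,(3,0,3),(6,1,3)),(1,(6,1,3),(6,0,6))]
    else if i = 5 then
      [(-1,(0,1,5),(0,0,0)),(1,(5,0,5),(0,1,5))]
    else if i = 6 then
      [(-1,(5,1,6),(5,0,5)),(1,(6,0,6),(5,1,6))]
    else [])"

definition bdry_2 :: "int \<Rightarrow> tensor" where
  "bdry_2 i = (
    if i = 0 then
      [(1,(5,3,0),(3,1,0)),(-1,(0,0,0),(3,4,3)),(-1,(0,4,0),(3,0,3)),(1,(6,2,0),(3,2,5)),
       (-1,(3,1,0),(3,3,6))]
    else if i = 1 then
      [(-1,(1,0,1),(2,2,0)),(-1,(3,2,1),(2,0,2)),(1,(0,1,1),(2,1,3))]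
    else if i = 2 then
      [(-1,(1,1,2),(5,3,0)),(-1,(2,0,2),(5,4,1)),(1,(0,2,2),(5,2,3)),(-1,(6,4,2),(5,0,5)),
       (1,(3,3,2),(5,1,6))]
    else if i = 3 then
      [(-1,(1,2,3),(0,0,0)),(1,(5,2,3),(0,0,0)),(-1,(2,1,3),(0,1,1)),(-1,(3,0,3),(0,2,2)),
       (1,(6,1,3),(0,1,5)),(-1,(3,0,3),(0,2,6))]
    else if i = 5 then
      [(-1,(5,0,5),(6,2,0)),(1,(0,1,5),(6,1,3)),(1,(3,2,5),(6,0,6))]
    else if i = 6 then
      [(-1,(5,1,6),(1,3,0)),(-1,(2,4,6),(1,0,1)),(-1,(3,3,6),(1,1,2)),(1,(0,2,6),(1,2,3)),
       (-1,(6,0,6),(1,4,5))]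
    else [])"

definition bdry_3 :: "int \<Rightarrow> tensor" where
  "bdry_3 i = (
    if i = 0 then
      [(1,(3,1,0),(2,2,0)),(-1,(1,3,0),(2,0,2)),(-1,(0,0,0),(2,1,3)),(1,(5,3,0),(6,0,6)),
       (1,(0,0,0),(6,1,3))]
    else if i = 1 then
      [(-1,(3,2,1),(3,1,0)),(1,(1,0,1),(3,3,2)),(1,(0,1,1),(3,0,3))]
    else if i = 2 then
      [(1,(3,3,2),(0,0,0)),(-1,(1,1,2),(0,2,2)),(1,(2,0,2),(0,1,5))]
    else if i = 3 then
      [(-1,(3,0,3),(1,3,0)),(1,(1,2,3),(1,1,2)),(-1,(6,1,3),(1,0,1)),(-1,(3,0,3),(5,3,0)),
       (-1,(5,2,3),(5,1,6)),(1,(2,1,3),(5,0,5))]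
    else if i = 5 then
      [(1,(5,0,5),(3,3,6)),(1,(0,1,5),(3,0,3))]
    else if i = 6 then
      [(-1,(3,3,6),(0,0,0)),(-1,(5,1,6),(0,2,6)),(1,(6,0,6),(0,1,1))]
    else [])"

definition bdry_4 :: "int \<Rightarrow> tensor" where
  "bdry_4 i = (
    if i = 0 then
      [(1,(6,2,0),(0,0,0)),(1,(3,1,0),(0,1,1)),(1,(0,0,0),(0,2,2)),(1,(0,0,0),(0,2,6))]
    else if i = 1 then
      [(1,(0,1,1),(2,0,2)),(1,(1,0,1),(2,1,3)),(-1,(1,0,1),(5,2,3)),(1,(3,2,1),(5,0,5)),
       (1,(0,1,1),(5,1,6))]
    else if i = 2 then
      [(1,(2,0,2),(6,2,0)),(1,(1,1,2),(6,1,3)),(-1,(0,2,2),(6,0,6))]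
    else if i = 3 then
      [(-1,(2,1,3),(0,0,0)),(-1,(6,1,3),(0,0,0)),(-1,(3,0,3),(0,1,1)),(1,(3,0,3),(0,1,5)),
       (1,(6,1,3),(3,1,0)),(1,(3,0,3),(3,2,1)),(-1,(1,2,3),(3,0,3)),(1,(5,2,3),(3,0,3))]
    else if i = 5 then
      [(-1,(5,0,5),(6,1,3)),(1,(0,1,5),(6,0,6)),(1,(3,2,5),(1,0,1)),(1,(0,1,5),(1,1,2)),
       (1,(5,0,5),(1,2,3))]
    else if i = 6 then
      [(1,(6,0,6),(2,2,0)),(1,(0,2,6),(2,0,2)),(1,(5,1,6),(2,1,3))]
    else [])"

definition bdry_5 :: "int \<Rightarrow> tensor" where
  "bdry_5 i = (
    if i = 0 then
      [(-1,(0,0,0),(1,3,0)),(-1,(5,3,0),(1,0,1)),(1,(6,2,0),(1,1,2)),(1,(5,3,0),(5,1,6)),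
       (-1,(0,0,0),(5,3,0)),(1,(3,1,0),(5,2,3)),(-1,(1,3,0),(5,0,5))]
    else if i = 1 then
      [(1,(3,2,1),(0,0,0)),(-1,(1,0,1),(0,2,2)),(1,(0,1,1),(0,0,0)),(-1,(1,0,1),(0,1,5))]
    else if i = 2 then
      [(-1,(3,3,2),(3,1,0)),(-1,(3,3,2),(3,0,3)),(1,(1,1,2),(3,2,5)),(1,(2,0,2),(3,3,6))]
    else if i = 3 then
      [(1,(1,2,3),(2,0,2)),(-1,(6,1,3),(2,0,2)),(1,(3,0,3),(2,1,3)),(1,(3,0,3),(6,2,0)),
       (1,(5,2,3),(6,0,6)),(1,(3,0,3),(6,1,3)),(1,(2,1,3),(6,0,6))]
    else if i = 5 then
      [(1,(5,0,5),(0,2,6)),(-1,(0,1,5),(0,0,0)),(1,(5,0,5),(0,1,1))]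
    else if i = 6 then
      [(1,(5,1,6),(3,2,1)),(-1,(6,0,6),(3,3,2)),(-1,(3,3,6),(3,0,3))]
    else [])"

definition bdry_6 :: "int \<Rightarrow> tensor" where
  "bdry_6 i = (
    if i = 0 then
      [(-1,(1,3,0),(0,0,0)),(-1,(5,3,0),(0,0,0)),(-1,(3,1,0),(0,2,2)),(-1,(0,0,0),(0,1,1)),
       (1,(0,0,0),(0,1,5)),(1,(0,0,0),(3,2,1)),(1,(6,2,0),(3,0,3))]
    else if i = 1 then
      [(-1,(1,0,1),(5,3,0)),(1,(3,2,1),(5,1,6)),(-1,(0,1,1),(5,0,5))]
    else if i = 2 then
      [(1,(3,3,2),(6,0,6)),(1,(2,0,2),(6,1,3)),(1,(1,1,2),(1,3,0)),(1,(3,3,2),(1,1,2)),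
       (1,(0,2,2),(1,0,1)),(1,(2,0,2),(1,2,3))]
    else if i = 3 then
      [(1,(1,2,3),(3,1,0)),(1,(5,2,3),(3,1,0)),(1,(3,0,3),(3,3,2)),(-1,(3,0,3),(3,3,6)),
       (1,(2,1,3),(3,0,3)),(-1,(6,1,3),(3,0,3))]
    else if i = 5 then
      [(-1,(5,0,5),(1,3,0)),(1,(0,1,5),(1,0,1))]
    else if i = 6 then
      [(1,(3,3,6),(2,0,2)),(1,(6,0,6),(2,1,3)),(-1,(5,1,6),(5,3,0)),(1,(6,0,6),(5,2,3)),
       (1,(0,2,6),(5,0,5))]
    else [])"

definition bdry_7 :: "int \<Rightarrow> tensor" where
  "bdry_7 i = (
    if i = 0 then
      [(-1,(6,2,0),(2,0,2)),(1,(0,0,0),(2,1,3)),(1,(0,0,0),(6,2,0)),(1,(3,1,0),(6,1,3)),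
       (-1,(2,2,0),(6,0,6)),(1,(0,0,0),(6,1,3))]
    else if i = 1 then
      [(1,(0,1,1),(3,1,0)),(1,(3,2,1),(3,0,3)),(1,(1,0,1),(3,2,5)),(1,(0,1,1),(3,0,3))]
    else if i = 2 then
      [(1,(0,2,2),(0,0,0)),(1,(1,1,2),(0,1,5)),(-1,(2,0,2),(0,2,6)),(1,(2,0,2),(0,1,1))]
    else if i = 3 then
      [(-1,(5,2,3),(1,0,1)),(-1,(6,1,3),(1,1,2)),(-1,(3,0,3),(1,2,3)),(1,(2,1,3),(1,0,1)),
       (1,(3,0,3),(5,2,3)),(1,(1,2,3),(5,0,5)),(-1,(2,1,3),(5,1,6)),(1,(6,1,3),(5,0,5))]
    else if i = 5 then
      [(-1,(5,0,5),(3,2,1)),(1,(0,1,5),(3,0,3))]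
    else if i = 6 then
      [(-1,(0,2,6),(0,0,0)),(-1,(5,1,6),(0,1,1)),(-1,(6,0,6),(0,2,2)),(1,(6,0,6),(0,1,5))]
    else [])"

definition bdry_8 :: "int \<Rightarrow> tensor" where
  "bdry_8 i = (
    if i = 0 then
      [(1,(6,2,0),(3,1,0)),(-1,(0,0,0),(3,3,2)),(1,(1,3,0),(3,0,3)),(-1,(5,3,0),(3,0,3)),
       (-1,(3,1,0),(3,2,5)),(1,(0,0,0),(3,3,6))]
    else if i = 1 then
      [(-1,(1,0,1),(6,1,3)),(1,(0,1,1),(6,0,6))]
    else if i = 2 then
      [(-1,(2,0,2),(1,3,0)),(1,(3,3,2),(1,0,1)),(-1,(0,2,2),(1,1,2)),(1,(1,1,2),(1,2,3))]
    else if i = 3 then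
      [(1,(2,1,3),(0,0,0)),(1,(6,1,3),(0,0,0)),(-1,(3,0,3),(0,1,1)),(-1,(3,0,3),(0,1,5))]
    else if i = 5 then
      [(-1,(0,1,5),(2,0,2)),(1,(5,0,5),(2,1,3))]
    else if i = 6 then
      [(1,(6,0,6),(5,3,0)),(-1,(5,1,6),(5,2,3)),(-1,(3,3,6),(5,0,5)),(1,(0,2,6),(5,1,6))]
    else [])"

definition bdry_9 :: "int \<Rightarrow> tensor" where
  "bdry_9 i = (
    if i = 0 then
      [(1,(3,1,0),(1,3,0)),(-1,(5,3,0),(1,1,2)),(1,(2,2,0),(1,0,1)),(-1,(0,0,0),(1,2,3)),
       (-1,(1,3,0),(5,1,6)),(-1,(0,0,0),(5,2,3)),(1,(6,2,0),(5,0,5))]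
    else if i = 1 then
      [(-1,(3,2,1),(2,2,0)),(1,(5,4,1),(2,0,2)),(-1,(1,0,1),(2,4,6)),(1,(0,1,1),(2,1,3))]
    else if i = 2 then
      [(-1,(3,3,2),(3,1,0)),(-1,(1,1,2),(3,3,6)),(-1,(2,0,2),(3,2,1)),(1,(0,2,2),(3,0,3))]
    else if i = 3 then
      [(1,(3,0,3),(0,4,0)),(1,(3,4,3),(0,0,0)),(-1,(5,2,3),(0,2,2)),(1,(1,2,3),(0,2,6)),
       (1,(2,1,3),(0,1,1)),(-1,(6,1,3),(0,1,5))]
    else if i = 5 then
      [(-1,(5,0,5),(6,4,2)),(1,(1,4,5),(6,0,6)),(1,(0,1,5),(6,1,3))]
    else if i = 6 then
      [(-1,(5,1,6),(3,3,2)),(1,(0,2,6),(3,0,3)),(-1,(6,0,6),(3,2,5))]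
    else [])"

definition bdry_10 :: "int \<Rightarrow> tensor" where
  "bdry_10 i = (
    if i = 0 then
      [(1,(3,1,0),(0,0,0)),(-1,(0,0,0),(0,1,1)),(1,(0,0,0),(0,1,5))]
    else if i = 1 then
      [(1,(0,1,1),(1,0,1)),(1,(1,0,1),(1,1,2))]
    else if i = 2 then
      [(-1,(1,1,2),(2,0,2)),(1,(2,0,2),(2,1,3))]
    else if i = 3 then
      [(1,(3,0,3),(3,1,0)),(1,(2,1,3),(3,0,3)),(-1,(6,1,3),(3,0,3))]
    else if i = 5 then
      [(1,(0,1,5),(5,0,5)),(1,(5,0,5),(5,1,6))]
    else if i = 6 then
      [(-1,(6,0,6),(6,1,3)),(1,(5,1,6),(6,0,6))]
    else [])"

definition bdry0 :: "int \<Rightarrow> int \<Rightarrow> tensor" where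
  "bdry0 r i = (
    if r = 0 then bdry_0 i
    else if r = 1 then bdry_1 i
    else if r = 2 then bdry_2 i
    else if r = 3 then bdry_3 i
    else if r = 4 then bdry_4 i
    else if r = 5 then bdry_5 i
    else if r = 6 then bdry_6 i
    else if r = 7 then bdry_7 i
    else if r = 8 then bdry_8 i
    else if r = 9 then bdry_9 i
    else if r = 10 then bdry_10 i
    else [])"

text \<open>The right linear contracting homotopy \<open>P\<^sub>r \<rightarrow> P\<^sub>r\<^sub>+\<^sub>1\<close> on the elements \<open>(v,k,w) \<otimes> e\<^sub>j\<close>.\<close>

definition contr_0 :: "int \<Rightarrow> int \<Rightarrow> int \<Rightarrow> tensor" where
  "contr_0 v k w = (
    if v = 0 then (if k = 1 then (if w = 1 then [(-1,(1,0,1),(0,0,0))]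
        else if w = 5 then [(-1,(5,0,5),(0,0,0))] else [])
      else if k = 2 then (if w = 2 then [(-1,(1,1,2),(0,0,0)),(-1,(2,0,2),(0,1,1))]
        else if w = 6 then [(-1,(5,1,6),(0,0,0)),(-1,(6,0,6),(0,1,5))] else [])
      else if k = 3 then (if w = 3 then [(-1,(1,2,3),(0,0,0)),(-1,(2,1,3),(0,1,1)),(-1,(3,0,3),(0,2,2))] else [])
      else if k = 4 then (if w = 0 then
        [(-1,(5,3,0),(0,0,0)),(1,(0,0,0),(0,3,3)),(-1,(6,2,0),(0,1,5)),(1,(3,1,0),(0,2,6))] else []) else [])
    else if v = 1 then (if k = 1 then (if w = 2 then [(-1,(2,0,2),(1,0,1))] else [])
      else if k = 2 then (if w = 3 then [(-1,(2,1,3),(1,0,1)),(-1,(3,0,3),(1,1,2))] else [])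
      else if k = 3 then (if w = 0 then [(-1,(2,2,0),(1,0,1)),(-1,(3,1,0),(1,1,2)),(1,(0,0,0),(1,2,3))] else [])
      else if k = 4 then (if w = 5 then
        [(-1,(5,0,5),(1,3,0)),(-1,(2,3,5),(1,0,1)),(-1,(3,2,5),(1,1,2)),(1,(0,1,5),(1,2,3))] else []) else [])
    else if v = 2 then (if k = 1 then (if w = 3 then [(-1,(3,0,3),(2,0,2))] else [])
      else if k = 2 then (if w = 0 then [(-1,(3,1,0),(2,0,2)),(1,(0,0,0),(2,1,3))] else [])
      else if k = 3 then (if w = 5 then [(-1,(5,0,5),(2,2,0)),(-1,(3,2,5),(2,0,2)),(1,(0,1,5),(2,1,3))] else [])
      else if k = 4 then (if w = 6 then
        [(-1,(5,1,6),(2,2,0)),(-1,(3,3,6),(2,0,2)),(1,(0,2,6),(2,1,3)),(-1,(6,0,6),(2,3,5))] else []) else [])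
    else if v = 3 then (if k = 1 then (if w = 0 then [(1,(0,0,0),(3,0,3))] else [])
      else if k = 2 then (if w = 1 then [(-1,(1,0,1),(3,1,0)),(1,(0,1,1),(3,0,3))]
        else if w = 5 then [(-1,(5,0,5),(3,1,0)),(1,(0,1,5),(3,0,3))] else [])
      else if k = 3 then (if w = 2 then [(-1,(1,1,2),(3,1,0)),(-1,(2,0,2),(3,2,1)),(1,(0,2,2),(3,0,3))]
        else if w = 6 then [(-1,(5,1,6),(3,1,0)),(1,(0,2,6),(3,0,3)),(-1,(6,0,6),(3,2,5))] else [])
      else if k = 4 then (if w = 3 then
        [(-1,(1,2,3),(3,1,0)),(-1,(2,1,3),(3,2,1)),(-1,(3,0,3),(3,3,2)),(1,(0,3,3),(3,0,3))] else []) else [])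
    else if v = 5 then (if k = 1 then (if w = 6 then [(-1,(6,0,6),(5,0,5))] else [])
      else if k = 2 then (if w = 3 then [(-1,(6,1,3),(5,0,5)),(1,(3,0,3),(5,1,6))] else [])
      else if k = 3 then (if w = 0 then [(1,(0,0,0),(5,2,3)),(-1,(6,2,0),(5,0,5)),(1,(3,1,0),(5,1,6))] else [])
      else if k = 4 then (if w = 1 then
        [(-1,(1,0,1),(5,3,0)),(1,(0,1,1),(5,2,3)),(-1,(6,3,1),(5,0,5)),(1,(3,2,1),(5,1,6))] else []) else [])
    else if v = 6 then (if k = 1 then (if w = 3 then [(1,(3,0,3),(6,0,6))] else [])
      else if k = 2 then (if w = 0 then [(1,(0,0,0),(6,1,3)),(1,(3,1,0),(6,0,6))] else [])
      else if k = 3 then (if w = 1 then [(-1,(1,0,1),(6,2,0)),(1,(0,1,1),(6,1,3)),(1,(3,2,1),(6,0,6))] else [])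
      else if k = 4 then (if w = 2 then
        [(-1,(1,1,2),(6,2,0)),(-1,(2,0,2),(6,3,1)),(1,(0,2,2),(6,1,3)),(1,(3,3,2),(6,0,6))] else []) else [])
    else [])"

definition contr_1 :: "int \<Rightarrow> int \<Rightarrow> int \<Rightarrow> tensor" where
  "contr_1 v k w = (
    if v = 0 then (if k = 4 then (if w = 0 then [(-1,(0,0,0),(3,0,3))] else []) else [])
    else if v = 1 then (if k = 3 then (if w = 0 then [(-1,(3,1,0),(0,0,0))] else [])
      else if k = 4 then (if w = 5 then [(-1,(3,2,5),(0,0,0)),(-1,(5,0,5),(0,2,6))] else []) else [])
    else if v = 2 then (if k = 4 then (if w = 6 then [(-1,(6,0,6),(1,0,1))] else []) else [])
    else if v = 3 then (if k = 2 then (if w = 1 then [(-1,(1,0,1),(2,0,2))]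
        else if w = 5 then [(1,(5,0,5),(6,0,6))] else [])
      else if k = 3 then (if w = 2 then [(-1,(1,1,2),(2,0,2))]
        else if w = 6 then [(1,(5,1,6),(6,0,6))] else [])
      else if k = 4 then (if w = 3 then [(-1,(1,2,3),(2,0,2)),(1,(3,0,3),(6,2,0)),(1,(5,2,3),(6,0,6))] else []) else [])
    else if v = 5 then (if k = 2 then (if w = 3 then [(1,(3,0,3),(0,0,0))] else [])
      else if k = 4 then (if w = 1 then [(1,(3,2,1),(0,0,0)),(-1,(1,0,1),(0,2,2))] else []) else [])
    else if v = 6 then (if k = 4 then (if w = 2 then [(-1,(2,0,2),(5,0,5))] else []) else [])
    else [])"

definition contr_2 :: "int \<Rightarrow> int \<Rightarrow> int \<Rightarrow> tensor" where
  "contr_2 v k w = (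
    if v = 0 then (if k = 1 then (if w = 1 then [(1,(1,0,1),(3,0,3))]
        else if w = 5 then [(1,(5,0,5),(3,0,3))] else [])
      else if k = 2 then (if w = 2 then [(1,(2,0,2),(3,1,0)),(1,(1,1,2),(3,0,3))]
        else if w = 6 then [(1,(5,1,6),(3,0,3))] else [])
      else if k = 3 then (if w = 3 then [(1,(5,2,3),(3,0,3))] else [])
      else if k = 4 then (if w = 0 then [(1,(0,0,0),(3,3,2)),(1,(1,3,0),(3,0,3))] else []) else [])
    else if v = 1 then (if k = 3 then (if w = 0 then [(-1,(0,0,0),(2,0,2))] else [])
      else if k = 4 then (if w = 5 then [(-1,(0,1,5),(2,0,2)),(-1,(5,0,5),(2,1,3))] else []) else [])
    else if v = 2 then (if k = 1 then (if w = 3 then [(1,(3,0,3),(5,0,5))] else [])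
      else if k = 2 then (if w = 0 then [(1,(3,1,0),(5,0,5)),(1,(0,0,0),(5,1,6))] else [])
      else if k = 3 then (if w = 5 then [(1,(3,2,5),(5,0,5))] else [])
      else if k = 4 then (if w = 6 then [(-1,(6,0,6),(5,3,0)),(1,(3,3,6),(5,0,5))] else []) else [])
    else if v = 3 then (if k = 3 then (if w = 2 then [(1,(2,0,2),(0,0,0))]
        else if w = 6 then [(-1,(6,0,6),(0,0,0))] else [])
      else if k = 4 then (if w = 3 then [(-1,(6,1,3),(0,0,0)),(-1,(3,0,3),(0,1,1))] else []) else [])
    else if v = 5 then (if k = 3 then (if w = 0 then [(1,(0,0,0),(6,0,6))] else [])
      else if k = 4 then (if w = 1 then [(-1,(1,0,1),(6,1,3)),(1,(0,1,1),(6,0,6))] else []) else [])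
    else if v = 6 then (if k = 1 then (if w = 3 then [(-1,(3,0,3),(1,0,1))] else [])
      else if k = 2 then (if w = 0 then [(-1,(3,1,0),(1,0,1)),(-1,(0,0,0),(1,1,2))] else [])
      else if k = 3 then (if w = 1 then [(-1,(3,2,1),(1,0,1))] else [])
      else if k = 4 then (if w = 2 then [(-1,(2,0,2),(1,3,0)),(-1,(3,3,2),(1,0,1))] else []) else [])
    else [])"

definition contr_3 :: "int \<Rightarrow> int \<Rightarrow> int \<Rightarrow> tensor" where
  "contr_3 v k w = (
    if v = 0 then (if k = 1 then (if w = 1 then [(1,(1,0,1),(2,0,2))]
        else if w = 5 then [(1,(5,0,5),(6,0,6))] else [])
      else if k = 2 then (if w = 2 then [(1,(1,1,2),(2,0,2)),(-1,(2,0,2),(6,0,6))]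
        else if w = 6 then [(1,(6,0,6),(2,0,2)),(1,(5,1,6),(6,0,6))] else [])
      else if k = 3 then (if w = 3 then [(1,(6,1,3),(2,0,2)),(1,(5,2,3),(6,0,6))] else [])
      else if k = 4 then (if w = 0 then
        [(1,(1,3,0),(2,0,2)),(1,(5,3,0),(6,0,6)),(-1,(0,0,0),(6,2,0)),(1,(3,1,0),(6,1,3))] else []) else [])
    else if v = 1 then (if k = 2 then (if w = 3 then [(-1,(3,0,3),(3,0,3))] else [])
      else if k = 4 then (if w = 5 then [(1,(5,0,5),(3,2,1)),(-1,(3,2,5),(3,0,3))] else []) else [])
    else if v = 2 then (if k = 1 then (if w = 3 then [(-1,(3,0,3),(0,0,0))] else [])
      else if k = 2 then (if w = 0 then [(-1,(3,1,0),(0,0,0)),(-1,(0,0,0),(0,0,0))] else [])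
      else if k = 3 then (if w = 5 then [(-1,(3,2,5),(0,0,0)),(-1,(5,0,5),(0,1,1))] else [])
      else if k = 4 then (if w = 6 then [(-1,(3,3,6),(0,0,0)),(-1,(5,1,6),(0,1,1)),(1,(6,0,6),(0,2,2))] else []) else [])
    else if v = 3 then (if k = 2 then (if w = 1 then [(1,(1,0,1),(5,0,5))]
        else if w = 5 then [(1,(5,0,5),(1,0,1))] else [])
      else if k = 3 then (if w = 2 then [(1,(1,1,2),(5,0,5)),(1,(2,0,2),(5,1,6))]
        else if w = 6 then [(1,(5,1,6),(1,0,1)),(-1,(6,0,6),(1,1,2))] else [])
      else if k = 4 then (if w = 3 then
        [(1,(5,2,3),(1,0,1)),(-1,(6,1,3),(1,1,2)),(-1,(5,2,3),(5,1,6)),(-1,(3,0,3),(5,2,3)),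
         (1,(1,2,3),(5,0,5))] else []) else [])
    else if v = 5 then (if k = 3 then (if w = 0 then [(-1,(0,0,0),(3,1,0)),(1,(3,1,0),(3,0,3))] else [])
      else if k = 4 then (if w = 1 then [(1,(3,2,1),(3,1,0)),(1,(3,2,1),(3,0,3)),(-1,(1,0,1),(3,2,5))] else []) else [])
    else if v = 6 then (if k = 2 then (if w = 0 then [(1,(0,0,0),(0,0,0))] else [])
      else if k = 3 then (if w = 1 then [(-1,(3,2,1),(0,0,0)),(1,(1,0,1),(0,1,5))] else [])
      else if k = 4 then (if w = 2 then [(-1,(3,3,2),(0,0,0)),(1,(1,1,2),(0,1,5)),(1,(2,0,2),(0,2,6))] else []) else [])
    else [])"

definition contr_4 :: "int \<Rightarrow> int \<Rightarrow> int \<Rightarrow> tensor" where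
  "contr_4 v k w = (
    if v = 0 then (if k = 1 then (if w = 1 then [(1,(1,0,1),(0,0,0))]
        else if w = 5 then [(-1,(5,0,5),(0,0,0))] else [])
      else if k = 2 then (if w = 2 then [(1,(1,1,2),(0,0,0))]
        else if w = 6 then [(-1,(5,1,6),(0,0,0))] else [])
      else if k = 3 then (if w = 3 then [(-1,(5,2,3),(0,0,0))] else [])
      else if k = 4 then (if w = 0 then [(1,(1,3,0),(0,0,0)),(-1,(0,0,0),(0,1,5))] else []) else [])
    else if v = 1 then (if k = 2 then (if w = 3 then [(1,(3,0,3),(2,0,2))] else [])
      else if k = 3 then (if w = 0 then [(-1,(0,0,0),(5,0,5))] else [])
      else if k = 4 then (if w = 5 then [(1,(3,2,5),(2,0,2)),(1,(5,0,5),(5,3,0)),(-1,(0,1,5),(5,0,5))] else []) else [])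
    else if v = 2 then (if k = 1 then (if w = 3 then [(1,(3,0,3),(6,0,6))] else [])
      else if k = 2 then (if w = 0 then [(1,(3,1,0),(6,0,6))] else [])
      else if k = 3 then (if w = 5 then [(1,(3,2,5),(6,0,6))] else [])
      else if k = 4 then (if w = 6 then [(1,(3,3,6),(6,0,6)),(1,(6,0,6),(6,1,3))] else []) else [])
    else if v = 3 then (if k = 3 then (if w = 2 then [(-1,(2,0,2),(3,0,3))]
        else if w = 6 then [(-1,(6,0,6),(3,0,3))] else [])
      else if k = 4 then (if w = 3 then
        [(1,(1,2,3),(0,0,0)),(1,(5,2,3),(0,0,0)),(1,(3,0,3),(0,2,2)),(-1,(6,1,3),(3,0,3))] else []) else [])
    else if v = 5 then (if k = 3 then (if w = 0 then [(-1,(3,1,0),(1,1,2)),(-1,(0,0,0),(1,0,1))] else [])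
      else if k = 4 then (if w = 1 then
        [(1,(3,2,1),(6,0,6)),(-1,(1,0,1),(1,3,0)),(-1,(3,2,1),(1,1,2)),(-1,(0,1,1),(1,0,1))] else []) else [])
    else if v = 6 then (if k = 2 then (if w = 0 then [(-1,(3,1,0),(2,0,2))] else [])
      else if k = 3 then (if w = 1 then [(-1,(3,2,1),(2,0,2))] else [])
      else if k = 4 then (if w = 2 then [(-1,(3,3,2),(2,0,2)),(-1,(2,0,2),(2,1,3))] else []) else [])
    else [])"

definition contr_5 :: "int \<Rightarrow> int \<Rightarrow> int \<Rightarrow> tensor" where
  "contr_5 v k w = (
    if v = 0 then (if k = 1 then (if w = 1 then [(-1,(1,0,1),(5,0,5))]
        else if w = 5 then [(1,(5,0,5),(1,0,1))] else [])
      else if k = 2 then (if w = 2 then [(1,(2,0,2),(1,0,1)),(-1,(1,1,2),(5,0,5)),(1,(2,0,2),(5,1,6))]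
        else if w = 6 then [(1,(5,1,6),(1,0,1)),(1,(6,0,6),(5,0,5))] else [])
      else if k = 3 then (if w = 3 then [(1,(5,2,3),(1,0,1)),(1,(6,1,3),(5,0,5))] else [])
      else if k = 4 then (if w = 0 then [(-1,(0,0,0),(1,3,0)),(1,(5,3,0),(1,0,1)),(-1,(1,3,0),(5,0,5))] else []) else [])
    else if v = 1 then (if k = 4 then (if w = 5 then [(-1,(0,1,5),(0,0,0)),(-1,(5,0,5),(0,1,1))] else []) else [])
    else if v = 2 then (if k = 1 then (if w = 3 then [(1,(3,0,3),(3,0,3))] else [])
      else if k = 2 then (if w = 0 then [(1,(0,0,0),(3,1,0)),(1,(3,1,0),(3,0,3)),(1,(0,0,0),(3,0,3))] else [])
      else if k = 3 then (if w = 5 then [(1,(0,1,5),(3,1,0)),(1,(5,0,5),(3,2,1)),(1,(3,2,5),(3,0,3))] else [])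
      else if k = 4 then (if w = 6 then [(-1,(6,0,6),(3,3,2)),(1,(3,3,6),(3,0,3))] else []) else [])
    else if v = 3 then (if k = 3 then (if w = 2 then [(1,(2,0,2),(6,0,6))]
        else if w = 6 then [(1,(6,0,6),(2,0,2))] else [])
      else if k = 4 then (if w = 3 then [(1,(6,1,3),(2,0,2)),(-1,(3,0,3),(6,1,3)),(1,(2,1,3),(6,0,6))] else []) else [])
    else if v = 5 then (if k = 3 then (if w = 0 then [(-1,(0,0,0),(0,0,0))] else [])
      else if k = 4 then (if w = 1 then [(-1,(0,1,1),(0,0,0)),(-1,(1,0,1),(0,1,5))] else []) else [])
    else if v = 6 then (if k = 2 then (if w = 0 then [(1,(0,0,0),(3,0,3))] else [])
      else if k = 3 then (if w = 1 then [(1,(0,1,1),(3,0,3))] else [])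
      else if k = 4 then (if w = 2 then [(-1,(2,0,2),(3,2,1)),(1,(0,2,2),(3,0,3))] else []) else [])
    else [])"

definition contr_6 :: "int \<Rightarrow> int \<Rightarrow> int \<Rightarrow> tensor" where
  "contr_6 v k w = (
    if v = 0 then (if k = 1 then (if w = 5 then [(1,(5,0,5),(3,0,3))] else [])
      else if k = 2 then (if w = 2 then [(1,(2,0,2),(0,0,0))]
        else if w = 6 then [(-1,(6,0,6),(0,0,0)),(1,(5,1,6),(3,0,3))] else [])
      else if k = 3 then (if w = 3 then [(-1,(6,1,3),(0,0,0)),(1,(5,2,3),(3,0,3))] else [])
      else if k = 4 then (if w = 0 then
        [(-1,(6,2,0),(0,0,0)),(1,(0,0,0),(0,2,2)),(1,(3,1,0),(0,1,5)),(-1,(0,0,0),(0,2,6)),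
         (1,(5,3,0),(3,0,3))] else []) else [])
    else if v = 1 then (if k = 2 then (if w = 3 then [(1,(3,0,3),(5,0,5))] else [])
      else if k = 4 then (if w = 5 then [(1,(5,0,5),(5,2,3)),(1,(3,2,5),(5,0,5)),(-1,(0,1,5),(5,1,6))] else []) else [])
    else if v = 2 then (if k = 1 then (if w = 3 then [(1,(3,0,3),(1,0,1))] else [])
      else if k = 2 then (if w = 0 then [(-1,(0,0,0),(6,0,6)),(1,(3,1,0),(1,0,1)),(-1,(0,0,0),(1,1,2))] else [])
      else if k = 3 then (if w = 5 then [(1,(5,0,5),(6,1,3)),(-1,(0,1,5),(6,0,6)),(1,(3,2,5),(1,0,1))] else [])
      else if k = 4 then (if w = 6 then
        [(-1,(6,0,6),(6,2,0)),(1,(5,1,6),(6,1,3)),(-1,(0,2,6),(6,0,6)),(1,(3,3,6),(1,0,1))] else []) else [])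
    else if v = 3 then (if k = 2 then (if w = 1 then [(1,(1,0,1),(3,0,3))] else [])
      else if k = 3 then (if w = 2 then [(-1,(2,0,2),(3,1,0)),(1,(1,1,2),(3,0,3))] else [])
      else if k = 4 then (if w = 3 then
        [(-1,(2,1,3),(3,1,0)),(1,(3,0,3),(3,2,1)),(1,(1,2,3),(3,0,3)),(-1,(5,2,3),(3,0,3))] else []) else [])
    else if v = 5 then (if k = 4 then (if w = 1 then [(-1,(3,2,1),(1,0,1)),(1,(0,1,1),(1,1,2)),(-1,(1,0,1),(1,2,3))] else []) else [])
    else if v = 6 then (if k = 2 then (if w = 0 then [(-1,(0,0,0),(2,0,2)),(1,(3,1,0),(5,0,5)),(-1,(0,0,0),(5,1,6))] else [])
      else if k = 3 then (if w = 1 then [(-1,(0,1,1),(2,0,2)),(-1,(1,0,1),(5,2,3)),(1,(3,2,1),(5,0,5))] else [])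
      else if k = 4 then (if w = 2 then
        [(-1,(0,2,2),(2,0,2)),(1,(2,0,2),(5,3,0)),(-1,(1,1,2),(5,2,3)),(1,(3,3,2),(5,0,5))] else []) else [])
    else [])"

definition contr_7 :: "int \<Rightarrow> int \<Rightarrow> int \<Rightarrow> tensor" where
  "contr_7 v k w = (
    if v = 0 then (if k = 1 then (if w = 1 then [(1,(1,0,1),(6,0,6))]
        else if w = 5 then [(-1,(5,0,5),(2,0,2))] else [])
      else if k = 2 then (if w = 2 then [(1,(1,1,2),(6,0,6))]
        else if w = 6 then [(-1,(5,1,6),(2,0,2))] else [])
      else if k = 3 then (if w = 3 then [(-1,(5,2,3),(2,0,2)),(1,(3,0,3),(6,2,0)),(1,(1,2,3),(6,0,6))] else [])
      else if k = 4 then (if w = 0 then [(-1,(5,3,0),(2,0,2)),(1,(1,3,0),(6,0,6)),(1,(0,0,0),(6,1,3))] else []) else [])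
    else if v = 1 then (if k = 2 then (if w = 3 then [(1,(3,0,3),(3,1,0))] else [])
      else if k = 3 then (if w = 0 then [(1,(0,0,0),(3,0,3))] else [])
      else if k = 4 then (if w = 5 then [(-1,(5,0,5),(3,3,2)),(1,(0,1,5),(3,0,3))] else []) else [])
    else if v = 2 then (if k = 1 then (if w = 3 then [(1,(3,0,3),(0,0,0))] else [])
      else if k = 2 then (if w = 0 then [(1,(3,1,0),(0,0,0))] else [])
      else if k = 3 then (if w = 5 then [(1,(3,2,5),(0,0,0))] else [])
      else if k = 4 then (if w = 6 then [(1,(3,3,6),(0,0,0)),(-1,(6,0,6),(0,1,5))] else []) else [])
    else if v = 3 then (if k = 3 then (if w = 2 then [(1,(2,0,2),(1,0,1))]
        else if w = 6 then [(-1,(6,0,6),(5,0,5))] else [])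
      else if k = 4 then (if w = 3 then
        [(-1,(5,2,3),(1,1,2)),(1,(2,1,3),(1,0,1)),(1,(3,0,3),(5,3,0)),(1,(1,2,3),(5,1,6)),
         (-1,(6,1,3),(5,0,5))] else []) else [])
    else if v = 5 then (if k = 4 then (if w = 1 then [(1,(3,2,1),(3,1,0)),(1,(1,0,1),(3,3,6)),(-1,(0,1,1),(3,0,3))] else []) else [])
    else if v = 6 then (if k = 3 then (if w = 1 then [(1,(3,2,1),(0,0,0))] else [])
      else if k = 4 then (if w = 2 then [(1,(3,3,2),(0,0,0)),(1,(2,0,2),(0,1,1))] else []) else [])
    else [])"

definition contr_8 :: "int \<Rightarrow> int \<Rightarrow> int \<Rightarrow> tensor" where
  "contr_8 v k w = (
    if v = 0 then (if k = 2 then (if w = 2 then [(1,(2,0,2),(3,0,3))]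
        else if w = 6 then [(1,(6,0,6),(3,0,3))] else [])
      else if k = 3 then (if w = 3 then [(1,(6,1,3),(3,0,3))] else [])
      else if k = 4 then (if w = 0 then [(1,(0,0,0),(3,2,1)),(1,(2,2,0),(3,0,3))] else []) else [])
    else if v = 1 then (if k = 4 then (if w = 5 then [(1,(5,0,5),(6,0,6))] else []) else [])
    else if v = 2 then (if k = 2 then (if w = 0 then [(1,(0,0,0),(1,0,1))] else [])
      else if k = 3 then (if w = 5 then [(1,(0,1,5),(1,0,1))] else [])
      else if k = 4 then (if w = 6 then [(1,(0,2,6),(1,0,1)),(1,(6,0,6),(1,2,3))] else []) else [])
    else if v = 3 then (if k = 4 then (if w = 3 then [(1,(3,0,3),(0,0,0))] else []) else [])
    else if v = 5 then (if k = 4 then (if w = 1 then [(1,(1,0,1),(2,0,2))] else []) else [])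
    else if v = 6 then (if k = 2 then (if w = 0 then [(1,(0,0,0),(5,0,5))] else [])
      else if k = 3 then (if w = 1 then [(1,(0,1,1),(5,0,5))] else [])
      else if k = 4 then (if w = 2 then [(1,(2,0,2),(5,2,3)),(1,(0,2,2),(5,0,5))] else []) else [])
    else [])"

definition contr_9 :: "int \<Rightarrow> int \<Rightarrow> int \<Rightarrow> tensor" where
  "contr_9 v k w = (
    if v = 0 then (if k = 1 then (if w = 1 then [(1,(1,0,1),(1,0,1))]
        else if w = 5 then [(1,(5,0,5),(5,0,5))] else [])
      else if k = 2 then (if w = 2 then [(1,(1,1,2),(1,0,1)),(1,(2,0,2),(1,1,2))]
        else if w = 6 then [(1,(5,1,6),(5,0,5)),(-1,(6,0,6),(5,1,6))] else [])
      else if k = 3 then (if w = 3 then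
        [(1,(1,2,3),(1,0,1)),(1,(2,1,3),(1,1,2)),(-1,(3,0,3),(1,2,3)),(1,(5,2,3),(5,0,5)),
         (-1,(6,1,3),(5,1,6))] else [])
      else if k = 4 then (if w = 0 then
        [(1,(1,3,0),(1,0,1)),(1,(2,2,0),(1,1,2)),(-1,(0,0,0),(5,3,0)),(1,(3,1,0),(5,2,3)),
         (1,(5,3,0),(5,0,5)),(-1,(6,2,0),(5,1,6))] else []) else [])
    else if v = 1 then (if k = 1 then (if w = 2 then [(-1,(2,0,2),(2,0,2))] else [])
      else if k = 2 then (if w = 3 then [(-1,(2,1,3),(2,0,2)),(1,(3,0,3),(2,1,3))] else [])
      else if k = 3 then (if w = 0 then [(-1,(2,2,0),(2,0,2))] else [])
      else if k = 4 then (if w = 5 then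
        [(-1,(0,1,5),(2,2,0)),(-1,(2,3,5),(2,0,2)),(1,(3,2,5),(2,1,3)),(1,(5,0,5),(2,3,5))] else []) else [])
    else if v = 2 then (if k = 1 then (if w = 3 then [(1,(3,0,3),(3,0,3))] else [])
      else if k = 3 then (if w = 5 then [(-1,(0,1,5),(3,1,0)),(1,(3,2,5),(3,0,3)),(1,(5,0,5),(3,2,5))] else [])
      else if k = 4 then (if w = 6 then
        [(-1,(0,2,6),(3,1,0)),(1,(3,3,6),(3,0,3)),(1,(5,1,6),(3,2,5)),(-1,(6,0,6),(3,3,6))] else []) else [])
    else if v = 3 then (if k = 1 then (if w = 0 then [(1,(0,0,0),(0,0,0))] else [])
      else if k = 2 then (if w = 1 then [(1,(0,1,1),(0,0,0)),(1,(1,0,1),(0,1,1))]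
        else if w = 5 then [(1,(0,1,5),(0,0,0)),(-1,(5,0,5),(0,1,5))] else [])
      else if k = 3 then (if w = 2 then [(1,(0,2,2),(0,0,0)),(1,(1,1,2),(0,1,1)),(1,(2,0,2),(0,2,2))]
        else if w = 6 then [(1,(0,2,6),(0,0,0)),(-1,(5,1,6),(0,1,5)),(1,(6,0,6),(0,2,6))] else [])
      else if k = 4 then (if w = 3 then
        [(1,(0,3,3),(0,0,0)),(1,(1,2,3),(0,1,1)),(1,(2,1,3),(0,2,2)),(-1,(3,0,3),(0,3,3)),
         (-1,(5,2,3),(0,1,5)),(1,(6,1,3),(0,2,6))] else []) else [])
    else if v = 5 then (if k = 1 then (if w = 6 then [(1,(6,0,6),(6,0,6))] else [])
      else if k = 2 then (if w = 3 then [(1,(6,1,3),(6,0,6))] else [])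
      else if k = 3 then (if w = 0 then [(1,(0,0,0),(6,2,0)),(-1,(3,1,0),(6,1,3)),(1,(6,2,0),(6,0,6))] else [])
      else if k = 4 then (if w = 1 then
        [(1,(0,1,1),(6,2,0)),(1,(1,0,1),(6,3,1)),(-1,(3,2,1),(6,1,3)),(1,(6,3,1),(6,0,6))] else []) else [])
    else if v = 6 then (if k = 2 then (if w = 0 then [(1,(0,0,0),(3,1,0)),(-1,(3,1,0),(3,0,3))] else [])
      else if k = 3 then (if w = 1 then [(1,(0,1,1),(3,1,0)),(1,(1,0,1),(3,2,1)),(-1,(3,2,1),(3,0,3))] else [])
      else if k = 4 then (if w = 2 then
        [(1,(0,2,2),(3,1,0)),(1,(1,1,2),(3,2,1)),(1,(2,0,2),(3,3,2)),(-1,(3,3,2),(3,0,3))] else []) else [])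
    else [])"

definition contr_10 :: "int \<Rightarrow> int \<Rightarrow> int \<Rightarrow> tensor" where
  "contr_10 v k w = (
    if v = 0 then (if k = 4 then (if w = 0 then [(1,(0,0,0),(0,0,0))] else []) else [])
    else if v = 1 then (if k = 4 then (if w = 5 then [(1,(5,0,5),(1,0,1))] else []) else [])
    else if v = 2 then (if k = 4 then (if w = 6 then [(1,(6,0,6),(2,0,2))] else []) else [])
    else if v = 3 then (if k = 4 then (if w = 3 then [(-1,(3,0,3),(3,0,3))] else []) else [])
    else if v = 5 then (if k = 4 then (if w = 1 then [(-1,(1,0,1),(5,0,5))] else []) else [])
    else if v = 6 then (if k = 4 then (if w = 2 then [(1,(2,0,2),(6,0,6))] else []) else [])
    else [])"

definition contr0 :: "int \<Rightarrow> int \<Rightarrow> int \<Rightarrow> int \<Rightarrow> tensor" where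
  "contr0 r v k w = (
    if r = 0 then contr_0 v k w
    else if r = 1 then contr_1 v k w
    else if r = 2 then contr_2 v k w
    else if r = 3 then contr_3 v k w
    else if r = 4 then contr_4 v k w
    else if r = 5 then contr_5 v k w
    else if r = 6 then contr_6 v k w
    else if r = 7 then contr_7 v k w
    else if r = 8 then contr_8 v k w
    else if r = 9 then contr_9 v k w
    else if r = 10 then contr_10 v k w
    else [])"

section \<open>Periodic extension of the tables and their verification\<close>

definition gen_pairs :: "int \<Rightarrow> (int \<times> int) list" where
  "gen_pairs q = (if q < 11 then gen_pairs0 q else map (\<lambda>(i,j). (i, swap_vertex j)) (gen_pairs0 (q - 11)))"

text \<open>The differential out of \<open>P_q\<close> with \<open>q\<close> read modulo 22, so
  \<open>bdry 0\<close> is the map \<open>P_22 \<rightarrow> P_21\<close> and not the augmentation.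
  It is twisted and \<open>bdry 11\<close> is not, because the table for 0 maps into the untwisted
  \<open>P_10\<close>.\<close>

definition bdry :: "int \<Rightarrow> int \<Rightarrow> tensor" where
  "bdry q i = (if q = 0 then swap_right (bdry0 0 i) else if q < 11 then bdry0 q i
     else if q = 11 then bdry0 0 i else swap_right (bdry0 (q - 11) i))"

fun contr :: "int \<Rightarrow> bel \<Rightarrow> tensor" where
  "contr q (v,k,w) = (if q < 11 then contr0 q v k w else swap_right (contr0 (q - 11) v k w))"

fun bmap :: "int \<Rightarrow> bel \<Rightarrow> tensor" where
  "bmap q (v,k,w) = lmul (v,k,w) (bdry q v)"

text \<open>All generators in one list, the format of \<open>pull\<close>; the end of
  \<open>u\<close> and the start of \<open>v\<close> tell to which generator a term belongs.\<close>

definition flat :: "int \<Rightarrow> tensor" where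
  "flat q = concat (map (bdry q) [0,1,2,3,5,6])"

fun right_vertices :: "int \<Rightarrow> (int \<times> int) list \<Rightarrow> int list" where
  "right_vertices i [] = []"
| "right_vertices i ((a,j) # L) = (if a = i then j # right_vertices i L else right_vertices i L)"

lemma set_right_vertices: "set (right_vertices i L) = {j. (i,j) \<in> set L}"
  by (induction i L rule: right_vertices.induct) auto

fun wf_bdry :: "int \<Rightarrow> int list \<Rightarrow> tensor \<Rightarrow> bool" where
  "wf_bdry i js [] = True"
| "wf_bdry i js ((c,(a,k,b),(v,l,w)) # L) =
    (if b = i then if v \<in> set js then wf_bdry i js L else False else False)"

lemma wf_bdry_iff: "wf_bdry i js L \<longleftrightarrow> (\<forall>(c,u,v)\<in>set L. snd (snd u) = i \<and> fst v \<in> set js)"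
  by (induction i js L rule: wf_bdry.induct) auto

fun wf_contr :: "int list \<Rightarrow> tensor \<Rightarrow> bool" where
  "wf_contr js [] = True"
| "wf_contr js ((c,u,(v,l,w)) # L) = (if v \<in> set js then wf_contr js L else False)"

lemma wf_contr_iff: "wf_contr js L \<longleftrightarrow> (\<forall>(c,u,v)\<in>set L. fst v \<in> set js)"
  by (induction js L rule: wf_contr.induct) auto

definition chk_wf :: "int \<Rightarrow> bool" where
  "chk_wf q \<longleftrightarrow>
    list_all (\<lambda>i. tbasis (bdry q i) \<and> wf_bdry i (right_vertices i (gen_pairs q)) (bdry q i)
       \<and> distinct (right_vertices i (gen_pairs q))) [0,1,2,3,5,6] \<and>
    list_all (\<lambda>b. tbasis (contr q b) \<and> wf_contr (right_vertices (fst b) (gen_pairs q)) (contr q b)) basis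
    \<and> list_all (\<lambda>(i,j). j \<in> set [0,1,2,3,5,6]) (gen_pairs q)"

definition chk_dd :: "int \<Rightarrow> int \<Rightarrow> bool" where
  "chk_dd q r \<longleftrightarrow> list_all (\<lambda>i. tzero (rlin (bmap q) (bdry r i))) [0,1,2,3,5,6]"

text \<open>The identity \<open>d h + h d = 1\<close> in degree \<open>q\<close>, with neighbours
  \<open>p\<close> below and \<open>r\<close> above, on the elements \<open>b \<otimes> e_j\<close>
  for all admissible \<open>j\<close> at once.\<close>

definition chk_hom :: "int \<Rightarrow> int \<Rightarrow> int \<Rightarrow> bool" where
  "chk_hom p q r \<longleftrightarrow> list_all (\<lambda>b. tzero (map (\<lambda>j. (-1,b,(j,0,j))) (right_vertices (fst b) (gen_pairs q))
      @ rlin (bmap r) (contr q b) @ rlin (contr p) (bmap q b))) basis"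

text \<open>The homotopy identity in degree 0. In place of \<open>h d\<close> stands the
  multiplication map followed by its right linear section
  \<open>y \<mapsto> e_w \<otimes> y\<close>, with \<open>w\<close> the end of
  \<open>y\<close>.\<close>

definition chk_aug :: bool where
  "chk_aug \<longleftrightarrow> list_all (\<lambda>(v,k,w). tzero ((-1,(v,k,w),(v,0,v)) # (1,(w,0,w),(v,k,w)) # rlin (bmap 1) (contr 0 (v,k,w)))) basis"

text \<open>The dummy left factor turns the products into terms of a tensor, so that
  \<open>tzero\<close> can decide whether their sum vanishes.\<close>

fun mul_out :: "tensor \<Rightarrow> tensor" where
  "mul_out [] = []"
| "mul_out ((c,u,v) # L) = (case bmul u v of None \<Rightarrow> mul_out L | Some y \<Rightarrow> (c,(0,0,0),y) # mul_out L)"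

text \<open>Consecutive degrees modulo 22. The triple \<open>(21,0,1)\<close> concerns degree 22 and
  its translates; degree 0 itself is the subject of \<open>chk_aug\<close>.\<close>

definition triples :: "(int \<times> int \<times> int) list" where
  "triples = [(0,1,2),(1,2,3),(2,3,4),(3,4,5),(4,5,6),(5,6,7),(6,7,8),(7,8,9),(8,9,10),(9,10,11),(10,11,12),
    (11,12,13),(12,13,14),(13,14,15),(14,15,16),(15,16,17),(16,17,18),(17,18,19),(18,19,20),(19,20,21),(20,21,0),(21,0,1)]"

lemma chk_wf: "list_all (\<lambda>(p,q,r). chk_wf p) triples"
  by code_simp

lemma chk_dd: "list_all (\<lambda>(p,q,r). chk_dd p q) triples"
  by code_simp

lemma chk_hom_1: "list_all (\<lambda>(p,q,r). chk_hom p q r) (take 6 triples)"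
  by code_simp

lemma chk_hom_2: "list_all (\<lambda>(p,q,r). chk_hom p q r) (take 6 (drop 6 triples))"
  by code_simp

lemma chk_hom_3: "list_all (\<lambda>(p,q,r). chk_hom p q r) (take 5 (drop 12 triples))"
  by code_simp

lemma chk_hom_4: "list_all (\<lambda>(p,q,r). chk_hom p q r) (drop 17 triples)"
  by code_simp

lemma chk_aug: chk_aug
  by code_simp

lemma chk_mul_out: "tzero (mul_out (flat 1))"
  by code_simp

definition idx :: "nat \<Rightarrow> int" where "idx q = int (q mod 22)"

lemma idx_triple: "(idx q, idx (Suc q), idx (Suc (Suc q))) \<in> set triples"
proof -
  have "idx (Suc n) = (if idx n = 21 then 0 else idx n + 1)" for n
    by (auto simp: idx_def mod_Suc)
  moreover have "[0..21::int] = [0,1,2,3,4,5,6,7,8,9,10,11,12,13,14,15,16,17,18,19,20,21]"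
    by code_simp
  then have "{0..21::int} = {0,1,2,3,4,5,6,7,8,9,10,11,12,13,14,15,16,17,18,19,20,21}"
    by (metis list.simps(15) set_upto list.set(1))
  moreover have "idx q \<in> {0..21}" by (simp add: idx_def)
  ultimately show ?thesis unfolding triples_def by (simp only: insert_iff empty_iff) (elim disjE; simp)
qed

lemma chk_hom_triple: "chk_hom (idx q) (idx (Suc q)) (idx (Suc (Suc q)))"
proof -
  have e: "take 6 triples @ take 6 (drop 6 triples) @ take 5 (drop 12 triples) @ drop 17 triples = triples"
    by (simp add: triples_def)
  have "list_all (\<lambda>(p,q,r). chk_hom p q r)
      (take 6 triples @ take 6 (drop 6 triples) @ take 5 (drop 12 triples) @ drop 17 triples)"
    unfolding list_all_append by (intro conjI chk_hom_1 chk_hom_2 chk_hom_3 chk_hom_4)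
  then have "list_all (\<lambda>(p,q,r). chk_hom p q r) triples" unfolding e .
  then show ?thesis using idx_triple[of q] by (auto simp: list_all_iff)
qed

lemma bdry_wf:
  assumes "i \<in> R1_vertices"
  shows "tbasis (bdry (idx q) i)"
    and "(c, u, v) \<in> set (bdry (idx q) i) \<Longrightarrow> snd (snd u) = i \<and> (i, fst v) \<in> set (gen_pairs (idx q))"
    and "distinct (right_vertices i (gen_pairs (idx q)))"
proof -
  have "chk_wf (idx q)" using chk_wf idx_triple[of q] by (auto simp: list_all_iff)
  then have "list_all (\<lambda>i. tbasis (bdry (idx q) i) \<and> wf_bdry i (right_vertices i (gen_pairs (idx q))) (bdry (idx q) i)
       \<and> distinct (right_vertices i (gen_pairs (idx q)))) [0,1,2,3,5,6]"
    unfolding chk_wf_def by blast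
  then have *: "tbasis (bdry (idx q) i) \<and> wf_bdry i (right_vertices i (gen_pairs (idx q))) (bdry (idx q) i)
       \<and> distinct (right_vertices i (gen_pairs (idx q)))" using assms unfolding list_all_iff by auto
  then show "tbasis (bdry (idx q) i)" "distinct (right_vertices i (gen_pairs (idx q)))" by blast+
  assume m: "(c, u, v) \<in> set (bdry (idx q) i)"
  from * have "\<forall>(c,u,v)\<in>set (bdry (idx q) i). snd (snd u) = i \<and> fst v \<in> {j. (i, j) \<in> set (gen_pairs (idx q))}"
    unfolding wf_bdry_iff set_right_vertices by (elim conjE)
  from bspec[OF this m] show "snd (snd u) = i \<and> (i, fst v) \<in> set (gen_pairs (idx q))" by simp
qed

lemma contr_wf:
  assumes "b \<in> set basis"
  shows "tbasis (contr (idx q) b)"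
    and "(c, u, v) \<in> set (contr (idx q) b) \<Longrightarrow> (fst b, fst v) \<in> set (gen_pairs (idx q))"
proof -
  have "chk_wf (idx q)" using chk_wf idx_triple[of q] by (auto simp: list_all_iff)
  then have "list_all (\<lambda>b. tbasis (contr (idx q) b) \<and> wf_contr (right_vertices (fst b) (gen_pairs (idx q))) (contr (idx q) b)) basis"
    unfolding chk_wf_def by blast
  then have *: "tbasis (contr (idx q) b) \<and> wf_contr (right_vertices (fst b) (gen_pairs (idx q))) (contr (idx q) b)"
    using assms unfolding list_all_iff by blast
  then show "tbasis (contr (idx q) b)" by blast
  assume m: "(c, u, v) \<in> set (contr (idx q) b)"
  from * have "\<forall>(c,u,v)\<in>set (contr (idx q) b). fst v \<in> {j. (fst b, j) \<in> set (gen_pairs (idx q))}"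
    unfolding wf_contr_iff set_right_vertices by (elim conjE)
  from bspec[OF this m] show "(fst b, fst v) \<in> set (gen_pairs (idx q))" by simp
qed

lemma gen_pairs_vertices: "(i, j) \<in> set (gen_pairs (idx q)) \<Longrightarrow> j \<in> R1_vertices"
proof -
  have "chk_wf (idx q)" using chk_wf idx_triple[of q] by (auto simp: list_all_iff)
  then have "list_all (\<lambda>(i,j). j \<in> set [0,1,2,3,5,6]) (gen_pairs (idx q))"
    unfolding chk_wf_def by blast
  then show "(i, j) \<in> set (gen_pairs (idx q)) \<Longrightarrow> j \<in> R1_vertices" unfolding list_all_iff by auto
qed

lemma flat_wf:
  "tbasis (flat (idx q))"
  "(c, u, v) \<in> set (flat (idx q)) \<Longrightarrow> snd (snd u) \<in> R1_vertices \<and> (snd (snd u), fst v) \<in> set (gen_pairs (idx q))"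
proof -
  have flat: "set (flat (idx q)) = (\<Union>i\<in>R1_vertices. set (bdry (idx q) i))" by (auto simp: flat_def)
  have "tbasis (L @ M) \<longleftrightarrow> tbasis L \<and> tbasis M" for L M
    unfolding tbasis_iff set_append ball_Un by (rule refl)
  then show "tbasis (flat (idx q))" by (simp add: flat_def bdry_wf(1) del: tbasis.simps(2))
  assume "(c, u, v) \<in> set (flat (idx q))"
  then obtain i where i: "i \<in> R1_vertices" "(c, u, v) \<in> set (bdry (idx q) i)" unfolding flat by (rule UN_E)
  from bdry_wf(2)[OF this] i(1) show "snd (snd u) \<in> R1_vertices \<and> (snd (snd u), fst v) \<in> set (gen_pairs (idx q))"
    by metis
qed

lemma lmul_eq_Nil: "(\<And>c u v. (c, u, v) \<in> set L \<Longrightarrow> snd (snd u) \<noteq> fst b) \<Longrightarrow> lmul b L = []"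
proof (induction L)
  case (Cons t L)
  obtain c u v where t: "t = (c, u, v)" by (cases t)
  have "bmul b u = None" using Cons.prems[of c u v] t by (cases b; cases u) auto
  moreover have "lmul b L = []"
  proof (rule Cons.IH)
    fix c u v assume "(c, u, v) \<in> set L"
    then show "snd (snd u) \<noteq> fst b" using Cons.prems[of c u v] by simp
  qed
  ultimately show ?case using t by simp
qed simp

lemma lmul_concat: "lmul b (concat Ls) = concat (map (lmul b) Ls)"
  by (induction Ls) (simp_all add: lmul_append)

text \<open>Left multiplication by \<open>b\<close> kills all terms whose left factor does not end
  where \<open>b\<close> starts, which leaves the generators at \<open>fst b\<close>.\<close>

lemma bmap_flat:
  assumes "b \<in> set basis" shows "lmul b (flat (idx q)) = bmap (idx q) b"
proof -
  define X where "X = lmul b (bdry (idx q) (fst b))"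
  have "lmul b (bdry (idx q) i) = (if fst b = i then X else [])" if "i \<in> R1_vertices" for i
  proof (cases "fst b = i")
    case False
    have "lmul b (bdry (idx q) i) = []"
    proof (rule lmul_eq_Nil)
      fix c u v assume "(c, u, v) \<in> set (bdry (idx q) i)"
      from bdry_wf(2)[OF that this] False show "snd (snd u) \<noteq> fst b" by simp
    qed
    then show ?thesis using False by simp
  qed (simp add: X_def)
  then have "map (\<lambda>i. lmul b (bdry (idx q) i)) [0,1,2,3,5,6] = map (\<lambda>i. if fst b = i then X else []) [0,1,2,3,5,6]"
    by (intro map_cong refl) simp
  then have "lmul b (flat (idx q)) = concat (map (\<lambda>i. if fst b = i then X else []) [0,1,2,3,5,6])"
    unfolding flat_def lmul_concat map_map comp_def by (rule arg_cong)
  also have "\<dots> = X"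
  proof -
    have "fst b \<in> R1_vertices" using basis_ends[OF assms] ..
    then show ?thesis unfolding insert_iff by (elim disjE) simp_all
  qed
  also have "X = bmap (idx q) b" unfolding X_def by (cases b) simp
  finally show ?thesis .
qed

lemma pl_flat_be:
  assumes "R.lin \<phi>" "b \<in> set basis"
  shows "pl (conv (flat (idx q))) \<phi> (be b) = (ev \<phi> (bmap (idx q) b) :: 'k::field R1)"
  using pl_conv_be[OF assms flat_wf(1)[of q]] bmap_flat[OF assms(2)] by metis

lemma tbasis_bmap: "b \<in> set basis \<Longrightarrow> tbasis (bmap (idx q) b)"
  using tbasis_lmul[OF flat_wf(1)[of q], of b] bmap_flat[of b q] by metis

lemma ev_rlin_bmap:
  assumes "R.lin \<phi>" "tbasis L"
  shows "ev \<phi> (rlin (bmap (idx q)) L) = (ev (pl (conv (flat (idx q))) \<phi>) L :: 'k::field R1)"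
  by (rule ev_rlin) (auto simp: pl_flat_be[OF assms(1)] tbasis_bmap assms(2))

lemma pl_left_mult: "pl ts \<phi> (x * y) = pl ts (\<lambda>z. \<phi> (x * z)) y"
  by (simp add: pl_def mult.assoc)

text \<open>The differentials are left linear, so replacing \<open>\<phi>\<close> by
  \<open>\<lambda>z. \<phi> (x * z)\<close> reduces the claim to the argument \<open>1\<close>,
  where the tables apply directly.\<close>

lemma pl_pl:
  assumes \<phi>: "R.lin \<phi>"
  shows "pl (conv (flat (idx (Suc q)))) (pl (conv (flat (idx q))) \<phi>) x = (0 :: 'k::field R1)"
proof -
  let ?\<phi> = "\<lambda>z. \<phi> (x * z)"
  let ?\<psi> = "pl (conv (flat (idx q))) ?\<phi>"
  have l: "R.lin ?\<phi>" using \<phi> by (rule R.lin_comp_mult_left)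
  have z: "ev ?\<psi> (bdry (idx (Suc q)) i) = 0" if "i \<in> R1_vertices" for i
  proof -
    have "chk_dd (idx q) (idx (Suc q))" using chk_dd idx_triple[of q] by (auto simp: list_all_iff)
    then have "\<forall>i\<in>set [0,1,2,3,5,6]. tzero (rlin (bmap (idx q)) (bdry (idx (Suc q)) i))"
      unfolding chk_dd_def list_all_iff .
    moreover have "i \<in> set [0,1,2,3,5,6]" using that by simp
    ultimately have "tzero (rlin (bmap (idx q)) (bdry (idx (Suc q)) i))" by (rule bspec)
    from ev_tzero[OF this, of ?\<phi>] show ?thesis unfolding ev_rlin_bmap[OF l bdry_wf(1)[OF that]] .
  qed
  have "pl (conv (flat (idx (Suc q)))) (pl (conv (flat (idx q))) \<phi>) (x * 1) = pl (conv (flat (idx (Suc q)))) ?\<psi> 1"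
    unfolding pl_left_mult ..
  also have "\<dots> = ev ?\<psi> (flat (idx (Suc q)))" by (rule pl_conv_1)
  also have "\<dots> = 0" using z by (simp add: flat_def)
  finally show ?thesis by simp
qed

section \<open>The resolution as an instance of the comparison theorem\<close>

definition R1_gens :: "nat \<Rightarrow> (int \<times> int) set" where "R1_gens q = set (gen_pairs (idx q))"

text \<open>Number \<open>q\<close> is the differential from degree \<open>q + 1\<close> to degree
  \<open>q\<close>, whereas \<open>bdry\<close> is numbered by its source.\<close>

definition R1_bdry :: "nat \<Rightarrow> ('k::field \<times> 'k R1 \<times> 'k R1) list" where "R1_bdry q = conv (flat (idx (Suc q)))"

lemma C_lin:
  assumes "f \<in> R.C S p" "length L = p" shows "R.lin (\<lambda>y. f (L @ [y]))"
  using R.cochain_lin[OF R.C_cochain[OF assms(1)], of L "[]"] assms(2) by simp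

text \<open>The terms in question are minus the identity on \<open>b\<close>: an \<open>e_j\<close>
  that is missing annihilates the value of \<open>f\<close> by the support condition, and all
  \<open>e_j\<close> together add up to 1.\<close>

lemma sum_right_vertices:
  assumes f: "f \<in> R.C (R1_gens q) p" and b: "b \<in> set basis"
  shows "ev (\<lambda>y. f (L @ [y])) (map (\<lambda>j. (-1,b,(j,0,j))) (right_vertices (fst b) (gen_pairs (idx q)))) = - (f (L @ [be b]) :: 'k::field R1)"
proof -
  let ?J = "right_vertices (fst b) (gen_pairs (idx q))"
  have fb: "fst b \<in> R1_vertices" using basis_ends[OF b] by blast
  have J: "set ?J \<subseteq> R1_vertices" using gen_pairs_vertices by (auto simp: set_right_vertices)
  have "ev (\<lambda>y. f (L @ [y])) (map (\<lambda>j. (-1,b,(j,0,j))) J) = (\<Sum>j\<leftarrow>J. - (f (L @ [be b]) * be (j,0,j)))" for J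
    by (induction J) simp_all
  from this[of ?J] have "ev (\<lambda>y. f (L @ [y])) (map (\<lambda>j. (-1,b,(j,0,j))) ?J) = (\<Sum>j\<leftarrow>?J. - (f (L @ [be b]) * be (j,0,j)))" .
  also have "\<dots> = (\<Sum>j\<in>set ?J. - (f (L @ [be b]) * be (j,0,j)))"
    using bdry_wf(3)[OF fb, of q] by (rule sum_list_distinct_conv_sum_set)
  also have "\<dots> = (\<Sum>j\<in>R1_vertices. - (f (L @ [be b]) * be (j,0,j)))"
  proof (intro sum.mono_neutral_left ballI J)
    fix j assume j: "j \<in> R1_vertices - set ?J"
    then have "(fst b, j) \<notin> R1_gens q" by (auto simp: R1_gens_def set_right_vertices)
    then have "f (L @ [be b * be (fst b,0,fst b)]) * be (j,0,j) = 0"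
      using f fb j unfolding R.C_def R.supported_def by blast
    then show "- (f (L @ [be b]) * be (j,0,j)) = 0" using be_vertex(2)[where 'k = 'k, OF b fb] by simp
  qed simp
  also have "\<dots> = - (f (L @ [be b]) * (\<Sum>j\<in>R1_vertices. be (j,0,j)))"
    by (simp only: sum_negf sum_distrib_left)
  finally show ?thesis by (simp only: one_R1_sum) simp
qed

lemma cochain_eqI:
  fixes f g :: "'k::field R1 list \<Rightarrow> 'k R1"
  assumes "cochain r1_scale (Suc p) f" "cochain r1_scale (Suc p) g"
    and "\<And>L b. length L = p \<Longrightarrow> b \<in> set basis \<Longrightarrow> f (L @ [be b]) = g (L @ [be b])"
  shows "f = g"
proof
  fix K
  show "f K = g K"
  proof (cases "length K = Suc p")
    case True
    then obtain L x where K: "K = L @ [x]" "length L = p" by (cases K rule: rev_cases) auto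
    have "R.lin (\<lambda>a. f (L @ [a]))" "R.lin (\<lambda>a. g (L @ [a]))"
      using R.cochain_lin[OF assms(1), of L "[]"] R.cochain_lin[OF assms(2), of L "[]"] K by simp_all
    then show ?thesis unfolding K(1) using assms(3)[OF K(2)] by (rule lin_eqI)
  next
    case False
    then show ?thesis using R.cochain_length[OF assms(1)] R.cochain_length[OF assms(2)] by simp
  qed
qed

lemma ev_zero: "ev (\<lambda>y. 0) L = (0 :: 'k::field R1)"
  by (induction L) (auto simp: ev_def)

text \<open>The homotopy identity evaluated at a row cocycle. The summand \<open>d h\<close>
  vanishes since \<open>f\<close> is a cocycle, and \<open>h d\<close> exhibits \<open>f\<close> as
  the coboundary of its contraction.\<close>

lemma row_identity:
  fixes f :: "'k::field R1 list \<Rightarrow> 'k R1"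
  assumes f: "f \<in> R.C (R1_gens (Suc q)) p" and z: "R.pull (R1_bdry (Suc q)) f = 0" and L: "length L = p" and b: "b \<in> set basis"
  shows "f (L @ [be b]) = pl (R1_bdry q) (contract (contr (idx q)) (\<lambda>y. f (L @ [y]))) (be b)"
proof -
  let ?\<phi> = "\<lambda>y. f (L @ [y])"
  let ?J = "right_vertices (fst b) (gen_pairs (idx (Suc q)))"
  have l: "R.lin ?\<phi>" by (rule C_lin[OF f L])
  have "tzero (map (\<lambda>j. (-1,b,(j,0,j))) ?J @ rlin (bmap (idx (Suc (Suc q)))) (contr (idx (Suc q)) b)
      @ rlin (contr (idx q)) (bmap (idx (Suc q)) b))"
    using chk_hom_triple[of q] b unfolding chk_hom_def list_all_iff by (rule bspec)
  from ev_tzero[OF this, of ?\<phi>]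
  have "0 = - f (L @ [be b]) + (ev ?\<phi> (rlin (bmap (idx (Suc (Suc q)))) (contr (idx (Suc q)) b))
      + ev ?\<phi> (rlin (contr (idx q)) (bmap (idx (Suc q)) b)))"
    unfolding ev_simps(3) sum_right_vertices[OF f b] ..
  moreover have "ev ?\<phi> (rlin (bmap (idx (Suc (Suc q)))) (contr (idx (Suc q)) b)) = 0"
  proof -
    have "pl (conv (flat (idx (Suc (Suc q))))) ?\<phi> x = 0" for x
      using pull_pl[of "R1_bdry (Suc q)" f L x] z by (simp add: R1_bdry_def)
    then have "pl (conv (flat (idx (Suc (Suc q))))) ?\<phi> = (\<lambda>x. 0)" by (rule ext)
    then show ?thesis unfolding ev_rlin_bmap[OF l contr_wf(1)[OF b]] by (simp only: ev_zero)
  qed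
  moreover have "ev ?\<phi> (rlin (contr (idx q)) (bmap (idx (Suc q)) b)) = ev (contract (contr (idx q)) ?\<phi>) (bmap (idx (Suc q)) b)"
    by (rule ev_rlin) (simp_all add: contract_be contr_wf(1) tbasis_bmap b)
  moreover have "ev (contract (contr (idx q)) ?\<phi>) (bmap (idx (Suc q)) b) = pl (R1_bdry q) (contract (contr (idx q)) ?\<phi>) (be b)"
    unfolding R1_bdry_def by (rule pl_flat_be[OF lin_contract b, symmetric])
  ultimately show ?thesis by simp
qed

text \<open>Only basis elements starting at \<open>i\<close> occur in \<open>x * be (i,0,i)\<close>,
  and the right factors in their table entries start at vertices \<open>j\<close> with
  \<open>(i,j)\<close> a generator.\<close>

lemma contract_C:
  fixes f :: "'k::field R1 list \<Rightarrow> 'k R1" and q :: nat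
  assumes f: "f \<in> R.C S p"
  defines "g \<equiv> \<lambda>K. if K = [] then 0 else contract (contr (idx q)) (\<lambda>y. f (butlast K @ [y])) (last K)"
  shows "g \<in> R.C (R1_gens q) p"
  unfolding R.C_def mem_Collect_eq R.cochain_iff R.supported_def
proof (intro conjI allI impI ballI)
  note c = R.C_cochain[OF f]
  fix K :: "'k R1 list" assume K: "length K \<noteq> Suc p"
  show "g K = 0"
  proof (cases K rule: rev_cases)
    case (snoc L x)
    then have "(\<lambda>y. f (L @ [y])) = (\<lambda>y. 0)" using R.cochain_length[OF c] K by auto
    then show ?thesis using snoc by (simp add: g_def contract_def ev_zero)
  qed (simp add: g_def)
next
  note c = R.C_cochain[OF f]
  fix xs ys :: "'k R1 list" assume l: "Suc (length xs + length ys) = Suc p"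
  show "R.lin (\<lambda>a. g (xs @ a # ys))"
  proof (cases ys rule: rev_cases)
    case Nil
    then show ?thesis using lin_contract by (simp add: g_def)
  next
    case (snoc zs y)
    have "R.lin (\<lambda>a. f (xs @ a # zs @ [z]))" for z using R.cochain_lin[OF c, of xs "zs @ [z]"] l snoc by simp
    then have "R.lin (\<lambda>a. ev (\<lambda>y. f (xs @ a # zs @ [y])) T)" for T
      unfolding ev_def split_def by (intro R.lin_sum_list R.lin_scale R.lin_mult_right)
    then show ?thesis unfolding g_def contract_def snoc
      by (auto simp: butlast_append intro!: R.lin_sum R.lin_scale)
  qed
next
  fix i j and xs :: "'k R1 list" and x assume ij: "i \<in> R1_vertices" "j \<in> R1_vertices" "(i, j) \<notin> R1_gens q"
  let ?\<phi> = "\<lambda>y. f (xs @ [y])"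
  have "ev ?\<phi> (contr (idx q) b) * be (j,0,j) = 0" if b: "b \<in> set basis" "fst b = i" for b
  proof -
    have "ev ?\<phi> T * be (j,0,j) = 0" if "set T \<subseteq> set (contr (idx q) b)" for T
      using that
    proof (induction T)
      case (Cons t T)
      obtain c u v where t: "t = (c, u, v)" by (cases t)
      with Cons.prems have m: "(c, u, v) \<in> set (contr (idx q) b)" by simp
      have v: "v \<in> set basis" using contr_wf(1)[OF b(1), of q] m by (auto simp: tbasis_iff)
      have "fst v \<noteq> j" using contr_wf(2)[OF b(1) m] b(2) ij(3) by (auto simp: R1_gens_def)
      then have "be v * be (j,0,j) = (0 :: 'k R1)" using be_vertex(2)[where 'k = 'k, OF v ij(2)] by simp
      then show ?case using Cons t by (simp add: distrib_right mult.assoc r1_scale_mult(1)[symmetric])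
    qed simp
    then show ?thesis by blast
  qed
  then have "r1_scale (crd b (x * be (i,0,i))) (ev ?\<phi> (contr (idx q) b)) * be (j,0,j) = 0" if "b \<in> set basis" for b
    using that crd_mult_vertex[where 'k = 'k, OF that ij(1), of x] by (simp add: r1_scale_mult(1)[symmetric])
  then show "g (xs @ [x * be (i,0,i)]) * be (j,0,j) = 0"
    by (simp add: g_def contract_def sum_distrib_right)
qed

interpretation res: bimodule_resolution "r1_scale :: 'k::field \<Rightarrow> 'k R1 \<Rightarrow> 'k R1" R1_vertices "\<lambda>v. be (v, 0, v)" R1_gens R1_bdry
proof (intro bimodule_resolution.intro bimodule_resolution_axioms.intro)
  show "idempotent_algebra (r1_scale :: 'k \<Rightarrow> 'k R1 \<Rightarrow> 'k R1) R1_vertices (\<lambda>v. be (v, 0, v))"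
    by (rule R.idempotent_algebra_axioms)
next
  fix c :: 'k and u v :: "'k R1" and q i j
  assume m: "(c, u, v) \<in> set (R1_bdry q)" and i: "i \<in> R1_vertices" and j: "j \<in> R1_vertices" and ij: "(i, j) \<notin> R1_gens (Suc q)"
  obtain c' u' v' where t: "(c', u', v') \<in> set (flat (idx (Suc q)))" "u = be u'" "v = be v'"
    using m by (auto simp: R1_bdry_def conv_def)
  have b: "u' \<in> set basis" "v' \<in> set basis" using flat_wf(1)[of "Suc q"] t(1) unfolding tbasis_iff by auto
  have "snd (snd u') \<noteq> i \<or> fst v' \<noteq> j" using flat_wf(2)[OF t(1)] ij by (auto simp: R1_gens_def)
  then show "be (i,0,i) * u = 0 \<or> v * be (j,0,j) = 0"
    unfolding t(2,3) be_vertex(1)[where 'k = 'k, OF b(1) i] be_vertex(2)[where 'k = 'k, OF b(2) j] by auto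
next
  fix f :: "'k R1 list \<Rightarrow> 'k R1" and q p assume f: "f \<in> R.C (R1_gens q) p"
  show "R.pull (R1_bdry (Suc q)) (R.pull (R1_bdry q) f) = 0"
  proof (rule cochain_eqI[of p])
    show "cochain r1_scale (Suc p) (R.pull (R1_bdry (Suc q)) (R.pull (R1_bdry q) f))"
      by (intro R.cochain_pull R.C_cochain[OF f])
    show "cochain r1_scale (Suc p) (0 :: 'k R1 list \<Rightarrow> 'k R1)" by (rule R.cochain_0)
    fix L :: "'k R1 list" and b assume "length L = p"
    then show "R.pull (R1_bdry (Suc q)) (R.pull (R1_bdry q) f) (L @ [be b]) = 0 (L @ [be b])"
      unfolding pull_pl R1_bdry_def using pl_pl[OF C_lin[OF f]] by simp
  qed
next
  fix f :: "'k R1 list \<Rightarrow> 'k R1" and q p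
  assume f: "f \<in> R.C (R1_gens (Suc q)) p" and z: "R.pull (R1_bdry (Suc q)) f = 0"
  define g where "g = (\<lambda>K. if K = [] then 0 else contract (contr (idx q)) (\<lambda>y. f (butlast K @ [y])) (last K))"
  have g: "g \<in> R.C (R1_gens q) p" unfolding g_def by (rule contract_C[OF f])
  have "R.pull (R1_bdry q) g = f"
  proof (rule cochain_eqI[of p])
    show "cochain r1_scale (Suc p) (R.pull (R1_bdry q) g)" by (intro R.cochain_pull R.C_cochain[OF g])
    show "cochain r1_scale (Suc p) f" by (rule R.C_cochain[OF f])
    fix L :: "'k R1 list" and b assume "length L = p" "b \<in> set basis"
    from row_identity[OF f z this] show "R.pull (R1_bdry q) g (L @ [be b]) = f (L @ [be b])"
      unfolding pull_pl by (simp add: g_def)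
  qed
  with g show "\<exists>g\<in>R.C (R1_gens q) p. R.pull (R1_bdry q) g = f" by blast
next
  fix i assume "i \<in> R1_vertices"
  then show "(i, i) \<in> R1_gens 0" by (auto simp: R1_gens_def idx_def gen_pairs_def gen_pairs0_def)
next
  fix f :: "'k R1 list \<Rightarrow> 'k R1" and p assume f: "cochain r1_scale p f"
  \<comment> \<open>With the constant function 1 the evaluation ignores the dummy left
    factors.\<close>
  have "ev (\<lambda>y. 1) (mul_out L) = (\<Sum>(c,u,v)\<leftarrow>L. r1_scale (of_int c) (be u * be v) :: 'k R1)" if "tbasis L" for L
    using that
  proof (induction L)
    case (Cons t L)
    obtain c u v where t: "t = (c, u, v)" by (cases t)
    with Cons.prems have "u \<in> set basis" "v \<in> set basis" "tbasis L" by (simp_all add: tbasis_Cons)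
    with Cons.IH t be_mult[where 'k = 'k, of u v] show ?case by (cases "bmul u v") simp_all
  qed simp
  moreover have "idx 1 = 1" by (simp add: idx_def)
  ultimately have mu: "(\<Sum>(c,u,v)\<leftarrow>flat 1. r1_scale (of_int c) (be u * be v) :: 'k R1) = 0"
    using flat_wf(1)[of 1] ev_tzero[OF chk_mul_out, of "\<lambda>y. 1 :: 'k R1"] by simp
  have "(\<Sum>(c,u,v)\<leftarrow>conv L. r1_scale c (y * (x * u) * v)) = y * x * (\<Sum>(c,u,v)\<leftarrow>L. r1_scale (of_int c) (be u * be v))"
    for x y :: "'k R1" and L
    by (induction L) (auto simp: conv_def distrib_left r1_scale_mult(2)[symmetric] mult.assoc)
  from this[of _ _ "flat 1"] mu have 0: "(\<Sum>(c,u,v)\<leftarrow>conv (flat 1). r1_scale c (y * (x * u) * v)) = 0" for x y :: "'k R1"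
    by simp
  show "R.pull (R1_bdry 0) (tensor_last f) = 0"
  proof
    fix K
    show "R.pull (R1_bdry 0) (tensor_last f) K = 0 K"
    proof (cases K rule: rev_cases)
      case (snoc L x)
      have "idx (Suc 0) = 1" by (simp add: idx_def)
      then show ?thesis using 0[of "f L" x] by (simp add: snoc pull_pl pl_def R1_bdry_def R.tensor_last_snoc)
    qed (simp add: R.pull_def)
  qed
next
  fix f :: "'k R1 list \<Rightarrow> 'k R1" and p assume f: "f \<in> R.C (R1_gens 0) p" and z: "R.pull (R1_bdry 0) f = 0"
  note c = R.C_cochain[OF f]
  \<comment> \<open>By \<open>chk_aug\<close> a row cocycle in degree 0 satisfies
    \<open>f (L @ [x]) = f (L @ [1]) * x\<close>, which dictates the choice of
    \<open>g\<close>.\<close>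
  define g where "g L = f (L @ [1])" for L
  have g: "cochain r1_scale p g"
    unfolding R.cochain_iff g_def
    using R.cochain_length[OF c] R.cochain_lin[OF c, of _ "_ @ [1]"] by simp
  have "tensor_last g = f"
  proof (rule cochain_eqI[of p])
    show "cochain r1_scale (Suc p) (tensor_last g)" by (rule R.cochain_tensor_last[OF g])
    show "cochain r1_scale (Suc p) f" by (rule c)
    fix L :: "'k R1 list" and b assume L: "length L = p" and b: "b \<in> set basis"
    obtain v k w where bv: "b = (v, k, w)" by (cases b)
    let ?\<phi> = "\<lambda>y. f (L @ [y])"
    have l: "R.lin ?\<phi>" by (rule C_lin[OF f L])
    have vw: "v \<in> R1_vertices" "w \<in> R1_vertices" using basis_ends[OF b] bv by simp_all
    have sup: "f (L @ [x * be (i,0,i)]) * be (j,0,j) = 0" if "i \<in> R1_vertices" "j \<in> R1_vertices" "i \<noteq> j" for i j x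
    proof -
      have "(i, j) \<notin> R1_gens 0" using that by (auto simp: R1_gens_def idx_def gen_pairs_def gen_pairs0_def)
      then show ?thesis using f that unfolding R.C_def R.supported_def by blast
    qed
    \<comment> \<open>All generators in degree 0 are diagonal, so \<open>f\<close> maps a last entry
      in \<open>Ae_i\<close> to a value in \<open>Ae_i\<close>.\<close>
    have only: "f (L @ [x * be (i,0,i)]) * be (i,0,i) = f (L @ [x * be (i,0,i)])" if "i \<in> R1_vertices" for i x
    proof -
      have "f (L @ [x * be (i,0,i)]) = (\<Sum>j\<in>R1_vertices. f (L @ [x * be (i,0,i)]) * be (j,0,j))"
        by (simp only: sum_distrib_left[symmetric] one_R1_sum mult_1_right)
      also have "\<dots> = (\<Sum>j\<in>{i}. f (L @ [x * be (i,0,i)]) * be (j,0,j))"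
        using that sup by (intro sum.mono_neutral_right) auto
      finally show ?thesis by simp
    qed
    have bb: "be b * be (v,0,v) = (be b :: 'k R1)" "be (w,0,w) * be b = (be b :: 'k R1)"
      using be_vertex[where 'k = 'k, OF b] vw bv by simp_all
    have "tzero ((-1,b,(v,0,v)) # (1,(w,0,w),b) # rlin (bmap 1) (contr 0 b))"
      using chk_aug b unfolding chk_aug_def list_all_iff bv by auto
    from ev_tzero[OF this, of ?\<phi>]
    have "f (L @ [be b]) * be (v,0,v) = f (L @ [be (w,0,w)]) * be b + ev ?\<phi> (rlin (bmap 1) (contr 0 b))"
      by simp
    moreover have "ev ?\<phi> (rlin (bmap 1) (contr 0 b)) = 0"
    proof -
      have i: "idx 1 = 1" "idx 0 = 0" by (simp_all add: idx_def)
      have "pl (conv (flat 1)) ?\<phi> x = 0" for x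
        using pull_pl[of "R1_bdry 0" f L x] z by (simp add: R1_bdry_def idx_def)
      then have "pl (conv (flat 1)) ?\<phi> = (\<lambda>x. 0)" by (rule ext)
      then show ?thesis using ev_rlin_bmap[OF l contr_wf(1)[OF b], of 1 0] i by (simp add: ev_zero)
    qed
    moreover have "f (L @ [be b]) * be (v,0,v) = f (L @ [be b])" using only[OF vw(1), of "be b"] bb by simp
    moreover have "f (L @ [be (w,0,w)]) * be b = f (L @ [1]) * be b"
    proof -
      have "f (L @ [1]) * be (w,0,w) = (\<Sum>i\<in>R1_vertices. f (L @ [1 * be (i,0,i)])) * be (w,0,w)"
        using R.lin_sum_idem[OF l, of 1] by simp
      also have "\<dots> = (\<Sum>i\<in>R1_vertices. f (L @ [1 * be (i,0,i)]) * be (w,0,w))" by (rule sum_distrib_right)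
      also have "\<dots> = (\<Sum>i\<in>{w}. f (L @ [1 * be (i,0,i)]) * be (w,0,w))"
      proof (rule sum.mono_neutral_right)
        show "{w} \<subseteq> R1_vertices" using vw(2) by blast
        show "\<forall>i\<in>R1_vertices - {w}. f (L @ [1 * be (i,0,i)]) * be (w,0,w) = 0"
          by (intro ballI sup vw(2)) blast+
      qed simp
      also have "\<dots> = f (L @ [be (w,0,w)])" using only[OF vw(2), of 1] by simp
      finally have "f (L @ [1]) * (be (w,0,w) * be b) = f (L @ [be (w,0,w)]) * be b" by (simp add: mult.assoc[symmetric])
      then show ?thesis unfolding bb(2) by (rule sym)
    qed
    ultimately show "tensor_last g (L @ [be b]) = f (L @ [be b])"
      by (simp add: R.tensor_last_snoc g_def)
  qed
  with g show "\<exists>g. cochain r1_scale p g \<and> tensor_last g = f" by blast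
next
  fix p
  show "\<exists>T. finite T \<and> {f. cochain (r1_scale :: 'k \<Rightarrow> 'k R1 \<Rightarrow> 'k R1) p f} \<subseteq> R.F.span T"
    by (rule cochain_finite_dim)
qed

section \<open>Hochschild cohomology\<close>

type_synonym vec = "(int \<times> bel) list"

text \<open>\<open>coh_q\<close> is an integral basis of the sum of the \<open>e\<^sub>iAe\<^sub>j\<close> in degree \<open>q\<close>, and \<open>dual_q\<close> its dual basis. The
  differential annihilates all but the first \<open>num_src q\<close> basis elements and maps the \<open>l\<close>-th of these
  to \<open>divisor q l\<close> times the basis element number \<open>num_src (q + 1) + l\<close> of degree \<open>q + 1\<close>.\<close>

definition coh_0 :: "vec list" where
  "coh_0 =
    [[(1,(1,0,1))],[(1,(1,0,1)),(1,(2,0,2))],[(1,(1,0,1)),(1,(2,0,2)),(1,(3,0,3))],[(1,(0,0,0))],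
     [(1,(5,0,5))],[(2,(0,4,0)),(1,(3,4,3))],[(1,(0,4,0))],
     [(1,(0,0,0)),(1,(1,0,1)),(1,(2,0,2)),(1,(3,0,3)),(1,(5,0,5)),(1,(6,0,6))]]"

definition dual_0 :: "vec list" where
  "dual_0 =
    [[(1,(1,0,1)),(-1,(2,0,2))],[(1,(2,0,2)),(-1,(3,0,3))],[(1,(3,0,3)),(-1,(6,0,6))],
     [(1,(0,0,0)),(-1,(6,0,6))],[(1,(5,0,5)),(-1,(6,0,6))],[(1,(3,4,3))],
     [(1,(0,4,0)),(-2,(3,4,3))],[(1,(6,0,6))]]"

definition coh_1 :: "vec list" where
  "coh_1 =
    [[(1,(0,1,1))],[(1,(0,1,1)),(-1,(1,1,2))],[(1,(0,1,1)),(-1,(2,1,3))],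
     [(1,(0,1,1)),(1,(3,1,0)),(-1,(6,1,3))],[(-1,(0,1,1)),(-1,(0,1,5)),(-1,(3,1,0))],
     [(1,(0,1,5)),(-1,(5,1,6))],[(1,(0,1,1)),(1,(0,1,5))]]"

definition dual_1 :: "vec list" where
  "dual_1 =
    [[(1,(0,1,1)),(-1,(0,1,5)),(1,(1,1,2)),(1,(2,1,3)),(-1,(5,1,6)),(1,(6,1,3))],[(-1,(1,1,2))],
     [(-1,(2,1,3))],[(-1,(6,1,3))],[(-1,(3,1,0)),(-1,(6,1,3))],[(-1,(5,1,6))],
     [(1,(0,1,5)),(-1,(3,1,0)),(1,(5,1,6)),(-1,(6,1,3))]]"

definition coh_2 :: "vec list" where
  "coh_2 =
    [[(1,(3,1,0))],[(-1,(0,3,3))]]"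

definition dual_2 :: "vec list" where
  "dual_2 =
    [[(1,(3,1,0))],[(-1,(0,3,3))]]"

definition coh_3 :: "vec list" where
  "coh_3 =
    [[(1,(0,2,2))],[(1,(5,2,3))],[(1,(2,2,0))],[(-1,(2,2,0)),(1,(3,2,5))],
     [(-1,(0,2,2)),(1,(3,2,1)),(1,(5,2,3))],
     [(-2,(0,2,2)),(1,(1,2,3)),(-1,(2,2,0)),(2,(3,2,1)),(1,(3,2,5)),(2,(5,2,3))],
     [(-3,(0,2,2)),(1,(0,2,6)),(1,(1,2,3)),(-2,(2,2,0)),(3,(3,2,1)),(1,(3,2,5)),(3,(5,2,3))],
     [(-1,(2,2,0)),(1,(3,2,1)),(1,(3,2,5)),(1,(6,2,0))]]"

definition dual_3 :: "vec list" where
  "dual_3 =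
    [[(1,(0,2,2)),(1,(3,2,1)),(-1,(6,2,0))],[(-1,(3,2,1)),(1,(5,2,3)),(1,(6,2,0))],
     [(1,(0,2,6)),(1,(2,2,0)),(1,(3,2,5))],[(-1,(1,2,3)),(1,(3,2,5)),(-1,(6,2,0))],
     [(-1,(0,2,6)),(-2,(1,2,3)),(1,(3,2,1)),(-1,(6,2,0))],[(-1,(0,2,6)),(1,(1,2,3))],
     [(1,(0,2,6))],[(1,(6,2,0))]]"

definition coh_4 :: "vec list" where
  "coh_4 =
    [[(1,(0,0,0))],[(1,(3,0,3))],[(-1,(0,3,3)),(1,(6,4,2))],[(1,(0,3,3)),(1,(5,4,1))],
     [(1,(0,4,0)),(1,(1,4,5)),(1,(2,4,6))],[(-1,(0,4,0)),(1,(3,4,3))],[(2,(0,3,3)),(-1,(3,4,3))],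
     [(3,(0,3,3)),(1,(1,4,5))],[(1,(0,3,3))]]"

definition dual_4 :: "vec list" where
  "dual_4 =
    [[(1,(0,0,0))],[(1,(3,0,3))],[(1,(6,4,2))],[(1,(5,4,1))],[(1,(2,4,6))],
     [(-1,(0,4,0)),(1,(2,4,6))],[(-1,(0,4,0)),(1,(2,4,6)),(-1,(3,4,3))],
     [(1,(1,4,5)),(-1,(2,4,6))],
     [(1,(0,3,3)),(2,(0,4,0)),(-3,(1,4,5)),(1,(2,4,6)),(2,(3,4,3)),(-1,(5,4,1)),(1,(6,4,2))]]"

definition coh_5 :: "vec list" where
  "coh_5 =
    [[(1,(2,1,3))],[(1,(1,3,0))],[(1,(3,3,2))],[(1,(6,1,3)),(-1,(3,3,2))],
     [(1,(0,1,5)),(1,(1,3,0))],[(1,(0,1,1)),(1,(0,1,5)),(1,(6,1,3)),(1,(1,3,0)),(-1,(3,3,2))],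
     [(1,(0,1,1)),(-1,(0,1,5)),(-1,(1,3,0)),(-1,(5,3,0))],
     [(1,(2,1,3)),(1,(6,1,3)),(-1,(3,3,2)),(-1,(3,3,6)),(1,(5,3,0))]]"

definition dual_5 :: "vec list" where
  "dual_5 =
    [[(1,(2,1,3)),(1,(3,3,6))],[(-1,(0,1,5)),(1,(1,3,0))],[(1,(6,1,3)),(1,(3,3,2))],
     [(-1,(0,1,1)),(1,(6,1,3)),(-1,(5,3,0))],[(-1,(0,1,1)),(1,(0,1,5)),(-2,(3,3,6)),(-2,(5,3,0))],
     [(1,(0,1,1)),(1,(3,3,6)),(1,(5,3,0))],[(-1,(3,3,6)),(-1,(5,3,0))],[(-1,(3,3,6))]]"

definition coh_6 :: "vec list" where
  "coh_6 =
    [[(1,(0,0,0))],[(1,(1,1,2))],[(1,(3,0,3)),(1,(1,1,2))],[(1,(3,1,0))],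
     [(-1,(0,4,0)),(1,(2,4,6)),(1,(3,4,3))],[(-1,(0,4,0)),(1,(1,4,5))],[(1,(3,4,3)),(1,(6,4,2))],
     [(-2,(3,4,3)),(1,(5,4,1))],[(-2,(0,4,0)),(1,(3,4,3))],[(-1,(0,4,0))],
     [(1,(0,0,0)),(-1,(3,0,3)),(-1,(1,1,2)),(1,(5,1,6))]]"

definition dual_6 :: "vec list" where
  "dual_6 =
    [[(1,(0,0,0)),(-1,(5,1,6))],[(-1,(3,0,3)),(1,(1,1,2))],[(1,(3,0,3)),(1,(5,1,6))],
     [(1,(3,1,0))],[(1,(2,4,6))],[(1,(1,4,5))],[(1,(6,4,2))],[(1,(5,4,1))],
     [(-1,(2,4,6)),(1,(3,4,3)),(2,(5,4,1)),(-1,(6,4,2))],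
     [(-1,(0,4,0)),(-1,(1,4,5)),(1,(2,4,6)),(-2,(3,4,3)),(-4,(5,4,1)),(2,(6,4,2))],[(1,(5,1,6))]]"

definition coh_7 :: "vec list" where
  "coh_7 =
    [[(1,(0,2,2))],[(1,(2,2,0))],[(1,(3,2,1))],[(1,(0,2,2)),(-1,(0,2,6)),(1,(3,2,1)),(1,(6,2,0))],
     [(1,(0,2,2)),(1,(1,2,3))],[(1,(0,2,2)),(1,(3,2,1)),(1,(5,2,3)),(1,(6,2,0))],
     [(1,(2,2,0)),(1,(3,2,1)),(1,(3,2,5)),(1,(6,2,0))],[(1,(3,2,1)),(1,(6,2,0))]]"

definition dual_7 :: "vec list" where
  "dual_7 =
    [[(1,(0,2,2)),(1,(0,2,6)),(-1,(1,2,3)),(-1,(5,2,3))],[(1,(2,2,0)),(-1,(3,2,5))],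
     [(1,(3,2,1)),(-1,(6,2,0))],[(-1,(0,2,6))],[(1,(1,2,3))],[(1,(5,2,3))],[(1,(3,2,5))],
     [(1,(0,2,6)),(-1,(3,2,5)),(-1,(5,2,3)),(1,(6,2,0))]]"

definition coh_8 :: "vec list" where
  "coh_8 =
    [[(1,(1,1,2))],[(1,(3,1,0))],[(1,(0,3,3))],[(-1,(2,3,5))],[(-1,(6,3,1))],
     [(1,(1,1,2)),(1,(3,1,0)),(1,(5,1,6))]]"

definition dual_8 :: "vec list" where
  "dual_8 =
    [[(1,(1,1,2)),(-1,(5,1,6))],[(1,(3,1,0)),(-1,(5,1,6))],[(1,(0,3,3))],[(-1,(2,3,5))],
     [(-1,(6,3,1))],[(1,(5,1,6))]]"

definition coh_9 :: "vec list" where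
  "coh_9 =
    [[(1,(0,3,3))],[(1,(1,3,0))],[(1,(0,3,3)),(1,(1,3,0)),(-1,(3,3,2))],
     [(-1,(1,3,0)),(1,(3,3,2)),(1,(3,3,6)),(-1,(5,3,0))],[(1,(1,3,0)),(1,(5,3,0))]]"

definition dual_9 :: "vec list" where
  "dual_9 =
    [[(1,(0,3,3)),(1,(3,3,2)),(-1,(3,3,6))],[(1,(1,3,0)),(1,(3,3,2)),(-1,(3,3,6)),(-1,(5,3,0))],
     [(-1,(3,3,2)),(1,(3,3,6))],[(1,(3,3,6))],[(1,(3,3,6)),(1,(5,3,0))]]"

definition coh_10 :: "vec list" where
  "coh_10 =
    [[(1,(1,0,1))],[(1,(0,0,0)),(-1,(1,0,1))],[(1,(1,0,1)),(1,(3,0,3))],[(1,(1,0,1)),(1,(5,0,5))],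
     [(-1,(0,0,0)),(1,(1,0,1)),(1,(2,0,2)),(1,(3,0,3)),(-1,(5,0,5))],
     [(-1,(0,0,0)),(1,(2,0,2)),(1,(3,0,3)),(-1,(5,0,5)),(1,(6,0,6))],[(1,(0,4,0)),(1,(3,4,3))],
     [(-1,(0,4,0))]]"

definition dual_10 :: "vec list" where
  "dual_10 =
    [[(1,(0,0,0)),(1,(1,0,1)),(-1,(3,0,3)),(-1,(5,0,5)),(1,(6,0,6))],[(1,(0,0,0)),(1,(2,0,2))],
     [(-1,(2,0,2)),(1,(3,0,3))],[(1,(2,0,2)),(1,(5,0,5))],[(1,(2,0,2)),(-1,(6,0,6))],
     [(1,(6,0,6))],[(1,(3,4,3))],[(-1,(0,4,0)),(1,(3,4,3))]]"

definition coh_11 :: "vec list" where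
  "coh_11 =
    [[(1,(0,0,0))],[(1,(3,0,3))],[(1,(0,4,0)),(1,(5,4,1)),(1,(6,4,2)),(1,(3,4,3)),(1,(1,4,5))],
     [(1,(0,4,0)),(1,(2,4,6))],[(-1,(3,4,3)),(-1,(2,4,6))],[(1,(6,4,2)),(-1,(2,4,6))],
     [(1,(1,4,5))],[(1,(2,4,6))]]"

definition dual_11 :: "vec list" where
  "dual_11 =
    [[(1,(0,0,0))],[(1,(3,0,3))],[(1,(5,4,1))],[(1,(0,4,0)),(-1,(5,4,1))],
     [(1,(5,4,1)),(-1,(3,4,3))],[(-1,(5,4,1)),(1,(6,4,2))],[(-1,(5,4,1)),(1,(1,4,5))],
     [(-1,(0,4,0)),(1,(5,4,1)),(1,(6,4,2)),(-1,(3,4,3)),(1,(2,4,6))]]"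

definition coh_12 :: "vec list" where
  "coh_12 =
    [[(1,(0,1,1))],[(1,(0,1,5))],[(-1,(0,1,1)),(-1,(0,1,5)),(-1,(3,1,0))],
     [(1,(6,1,3)),(1,(3,1,0)),(-1,(2,1,3))],[(-1,(0,1,1)),(-1,(3,1,0)),(1,(2,1,3))]]"

definition dual_12 :: "vec list" where
  "dual_12 =
    [[(1,(0,1,1)),(1,(6,1,3)),(-1,(3,1,0))],[(1,(0,1,5)),(-1,(3,1,0)),(-1,(2,1,3))],
     [(-1,(3,1,0)),(-1,(2,1,3))],[(1,(6,1,3))],[(1,(6,1,3)),(1,(2,1,3))]]"

definition coh_13 :: "vec list" where
  "coh_13 =
    [[(1,(5,1,6))],[(1,(1,1,2))],[(1,(3,1,0))],[(-1,(0,3,3)),(-1,(6,3,1))],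
     [(1,(0,3,3)),(-1,(2,3,5))],[(1,(0,3,3))]]"

definition dual_13 :: "vec list" where
  "dual_13 =
    [[(1,(5,1,6))],[(1,(1,1,2))],[(1,(3,1,0))],[(-1,(6,3,1))],[(-1,(2,3,5))],
     [(1,(0,3,3)),(-1,(6,3,1)),(1,(2,3,5))]]"

definition coh_14 :: "vec list" where
  "coh_14 =
    [[(1,(0,2,2))],[(1,(6,2,0))],[(-1,(0,2,2)),(1,(0,2,6))],[(1,(3,2,5))],
     [(1,(0,2,6)),(-1,(5,2,3))],[(1,(0,2,2)),(1,(1,2,3))],
     [(-1,(6,2,0)),(1,(3,2,1)),(1,(3,2,5)),(1,(2,2,0))],
     [(1,(0,2,2)),(-1,(0,2,6)),(1,(3,2,5)),(1,(2,2,0))]]"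

definition dual_14 :: "vec list" where
  "dual_14 =
    [[(1,(0,2,2)),(1,(0,2,6)),(1,(5,2,3)),(-1,(1,2,3))],[(1,(6,2,0)),(1,(3,2,1))],
     [(1,(0,2,6)),(1,(5,2,3)),(-1,(3,2,1)),(1,(2,2,0))],[(1,(3,2,5)),(-1,(2,2,0))],[(-1,(5,2,3))],
     [(1,(1,2,3))],[(1,(3,2,1))],[(-1,(3,2,1)),(1,(2,2,0))]]"

definition coh_15 :: "vec list" where
  "coh_15 =
    [[(1,(5,0,5))],[(1,(6,0,6))],[(1,(2,0,2))],[(1,(1,0,1)),(-1,(2,0,2))],
     [(1,(6,0,6)),(1,(3,0,3)),(1,(2,0,2))],
     [(1,(0,0,0)),(1,(5,0,5)),(2,(6,0,6)),(2,(3,0,3)),(1,(1,0,1)),(1,(2,0,2))],[(-1,(0,3,3))],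
     [(1,(6,3,1)),(1,(0,4,0))],[(1,(0,4,0)),(1,(3,4,3))],[(-1,(2,3,5)),(1,(3,4,3))],[(1,(3,4,3))]]"

definition dual_15 :: "vec list" where
  "dual_15 =
    [[(-1,(0,0,0)),(1,(5,0,5))],[(1,(6,0,6)),(-1,(3,0,3))],[(-1,(3,0,3)),(1,(1,0,1)),(1,(2,0,2))],
     [(-1,(0,0,0)),(1,(1,0,1))],[(-2,(0,0,0)),(1,(3,0,3))],[(1,(0,0,0))],[(-1,(0,3,3))],
     [(1,(6,3,1))],[(-1,(6,3,1)),(1,(0,4,0))],[(-1,(2,3,5))],
     [(1,(6,3,1)),(1,(2,3,5)),(-1,(0,4,0)),(1,(3,4,3))]]"

definition coh_16 :: "vec list" where
  "coh_16 =
    [[(1,(0,1,1))],[(1,(2,1,3))],[(1,(0,1,5)),(-1,(5,3,0)),(1,(3,3,6))],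
     [(-1,(6,1,3)),(1,(5,3,0)),(-1,(3,3,6))],[(1,(2,1,3)),(1,(3,3,2))],
     [(-1,(0,1,1)),(-1,(2,1,3)),(-1,(1,3,0))],[(2,(2,1,3)),(1,(5,3,0)),(-2,(3,3,6)),(1,(1,3,0))],
     [(1,(2,1,3)),(-1,(3,3,6))]]"

definition dual_16 :: "vec list" where
  "dual_16 =
    [[(1,(0,1,1)),(1,(0,1,5)),(1,(6,1,3)),(1,(5,3,0)),(-1,(1,3,0))],
     [(1,(2,1,3)),(1,(5,3,0)),(-1,(3,3,2)),(1,(3,3,6)),(-1,(1,3,0))],[(1,(0,1,5))],[(-1,(6,1,3))],
     [(1,(3,3,2))],[(1,(0,1,5)),(1,(6,1,3)),(1,(5,3,0)),(-1,(1,3,0))],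
     [(1,(0,1,5)),(1,(6,1,3)),(1,(5,3,0))],[(-1,(0,1,5)),(-1,(6,1,3)),(-2,(5,3,0)),(-1,(3,3,6))]]"

definition coh_17 :: "vec list" where
  "coh_17 =
    [[(1,(5,0,5))],[(1,(6,0,6))],[(1,(0,0,0))],[(1,(1,0,1))],[(1,(3,0,3)),(-1,(1,0,1))],
     [(1,(2,0,2))],
     [(-2,(0,0,0)),(1,(5,0,5)),(1,(6,0,6)),(-2,(3,0,3)),(3,(1,0,1)),(1,(2,0,2)),(1,(3,1,0))],
     [(-1,(0,4,0)),(1,(3,4,3))],[(-1,(3,4,3))]]"

definition dual_17 :: "vec list" where
  "dual_17 =
    [[(1,(5,0,5)),(-1,(3,1,0))],[(1,(6,0,6)),(-1,(3,1,0))],[(1,(0,0,0)),(2,(3,1,0))],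
     [(1,(3,0,3)),(1,(1,0,1)),(-1,(3,1,0))],[(1,(3,0,3)),(2,(3,1,0))],[(1,(2,0,2)),(-1,(3,1,0))],
     [(1,(3,1,0))],[(-1,(0,4,0))],[(-1,(0,4,0)),(-1,(3,4,3))]]"

definition coh_18 :: "vec list" where
  "coh_18 =
    [[(1,(0,2,2))],[(-1,(0,2,6)),(-1,(5,2,3)),(-1,(3,2,5))],
     [(-1,(0,2,6)),(-1,(5,2,3)),(-1,(6,2,0))],[(1,(0,2,2)),(-1,(0,2,6)),(1,(3,2,1)),(1,(2,2,0))],
     [(1,(0,2,2)),(1,(3,2,1)),(1,(1,2,3))],[(-1,(0,2,2)),(-1,(5,2,3)),(1,(2,2,0))],
     [(-1,(0,2,2)),(-1,(1,2,3)),(-1,(2,2,0))],[(-1,(2,2,0))]]"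

definition dual_18 :: "vec list" where
  "dual_18 =
    [[(1,(0,2,2)),(1,(0,2,6)),(-1,(5,2,3)),(-1,(1,2,3))],[(-1,(3,2,5))],[(-1,(6,2,0))],
     [(-1,(0,2,6)),(1,(6,2,0)),(1,(3,2,5))],[(1,(0,2,6)),(-1,(6,2,0)),(1,(3,2,1)),(-1,(3,2,5))],
     [(-1,(5,2,3)),(1,(6,2,0)),(1,(3,2,5))],
     [(1,(0,2,6)),(-1,(6,2,0)),(1,(3,2,1)),(-1,(3,2,5)),(-1,(1,2,3))],
     [(-2,(0,2,6)),(-1,(5,2,3)),(3,(6,2,0)),(-1,(3,2,1)),(3,(3,2,5)),(1,(1,2,3)),(-1,(2,2,0))]]"

definition coh_19 :: "vec list" where
  "coh_19 =
    [[(1,(3,1,0))],[(1,(0,3,3))]]"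

definition dual_19 :: "vec list" where
  "dual_19 =
    [[(1,(3,1,0))],[(1,(0,3,3))]]"

definition coh_20 :: "vec list" where
  "coh_20 =
    [[(1,(6,3,1))],[(1,(5,3,0))],[(1,(3,3,6))],[(1,(0,3,3))],[(1,(1,3,0))],
     [(-1,(5,3,0)),(1,(6,3,1)),(1,(3,3,2)),(1,(3,3,6)),(-1,(1,3,0)),(1,(2,3,5))],
     [(1,(0,3,3)),(1,(5,3,0)),(-1,(6,3,1)),(-1,(3,3,2))]]"

definition dual_20 :: "vec list" where
  "dual_20 =
    [[(1,(6,3,1)),(-1,(3,3,2))],[(1,(5,3,0)),(1,(3,3,2))],[(1,(3,3,6)),(-1,(2,3,5))],
     [(1,(0,3,3)),(1,(3,3,2)),(-1,(2,3,5))],[(1,(1,3,0)),(1,(2,3,5))],[(1,(2,3,5))],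
     [(-1,(3,3,2)),(1,(2,3,5))]]"

definition coh_21 :: "vec list" where
  "coh_21 =
    [[(1,(0,0,0))],[(2,(0,0,0)),(1,(3,0,3))],[(1,(5,4,1)),(-1,(6,4,2))],
     [(-1,(0,4,0)),(1,(5,4,1))],[(-1,(3,4,3)),(-1,(2,4,6))],[(1,(0,4,0)),(1,(3,4,3))],
     [(1,(0,4,0)),(1,(1,4,5))],[(1,(0,4,0))]]"

definition dual_21 :: "vec list" where
  "dual_21 =
    [[(1,(0,0,0)),(-2,(3,0,3))],[(1,(3,0,3))],[(-1,(6,4,2))],[(1,(5,4,1)),(1,(6,4,2))],
     [(-1,(2,4,6))],[(1,(3,4,3)),(-1,(2,4,6))],[(1,(1,4,5))],
     [(1,(0,4,0)),(1,(5,4,1)),(1,(6,4,2)),(-1,(3,4,3)),(-1,(1,4,5)),(1,(2,4,6))]]"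

definition coh :: "int \<Rightarrow> vec list" where
  "coh r = (
    if r = 0 then coh_0
    else if r = 1 then coh_1
    else if r = 2 then coh_2
    else if r = 3 then coh_3
    else if r = 4 then coh_4
    else if r = 5 then coh_5
    else if r = 6 then coh_6
    else if r = 7 then coh_7
    else if r = 8 then coh_8
    else if r = 9 then coh_9
    else if r = 10 then coh_10
    else if r = 11 then coh_11
    else if r = 12 then coh_12
    else if r = 13 then coh_13
    else if r = 14 then coh_14
    else if r = 15 then coh_15
    else if r = 16 then coh_16
    else if r = 17 then coh_17
    else if r = 18 then coh_18
    else if r = 19 then coh_19
    else if r = 20 then coh_20
    else if r = 21 then coh_21
    else [])"

definition dual :: "int \<Rightarrow> vec list" where
  "dual r = (
    if r = 0 then dual_0
    else if r = 1 then dual_1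
    else if r = 2 then dual_2
    else if r = 3 then dual_3
    else if r = 4 then dual_4
    else if r = 5 then dual_5
    else if r = 6 then dual_6
    else if r = 7 then dual_7
    else if r = 8 then dual_8
    else if r = 9 then dual_9
    else if r = 10 then dual_10
    else if r = 11 then dual_11
    else if r = 12 then dual_12
    else if r = 13 then dual_13
    else if r = 14 then dual_14
    else if r = 15 then dual_15
    else if r = 16 then dual_16
    else if r = 17 then dual_17
    else if r = 18 then dual_18
    else if r = 19 then dual_19
    else if r = 20 then dual_20
    else if r = 21 then dual_21
    else [])"

definition num_src :: "int \<Rightarrow> nat" where
  "num_src r = (
    if r = 0 then 5
    else if r = 1 then 1
    else if r = 2 then 1
    else if r = 3 then 7
    else if r = 4 then 2
    else if r = 5 then 6
    else if r = 6 then 4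
    else if r = 7 then 3
    else if r = 8 then 2
    else if r = 9 then 2
    else if r = 10 then 6
    else if r = 11 then 2
    else if r = 12 then 2
    else if r = 13 then 3
    else if r = 14 then 4
    else if r = 15 then 6
    else if r = 16 then 2
    else if r = 17 then 7
    else if r = 18 then 1
    else if r = 19 then 1
    else if r = 20 then 5
    else if r = 21 then 2
    else 0)"

text \<open>The invariant factors of the integral differentials. At most one in each degree differs
  from 1, and the bases are ordered so that it belongs to the last source.\<close>

definition top_divisor :: "int \<Rightarrow> int" where
  "top_divisor r = (if r = 3 then 4 else if r = 17 then 4 else if r = 5 then 3 else if r = 15 then 3
     else if r = 21 then 3 else 1)"

definition divisor :: "int \<Rightarrow> nat \<Rightarrow> int" where
  "divisor r l = (if Suc l = num_src r then top_divisor r else 1)"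

text \<open>Vectors are written as tensors with the dummy left factor \<open>(0,0,0)\<close>, to be evaluated by
  \<open>ev (\<lambda>_. 1)\<close>.\<close>

fun vmap :: "int \<Rightarrow> vec \<Rightarrow> tensor" where
  "vmap c [] = []"
| "vmap c ((c',w) # x) = (c * c', (0,0,0), w) # vmap c x"

definition vscale :: "int \<Rightarrow> vec \<Rightarrow> tensor" where
  "vscale c x = (if c = 0 then [] else vmap c x)"

fun vcoeff :: "bel \<Rightarrow> vec \<Rightarrow> int" where
  "vcoeff b [] = 0"
| "vcoeff b ((c,w) # x) = (if beq w b then c + vcoeff b x else vcoeff b x)"

fun pairing :: "vec \<Rightarrow> vec \<Rightarrow> int" where
  "pairing [] x = 0"
| "pairing ((c,b) # d) x = c * vcoeff b x + pairing d x"

fun sandwich_term :: "int \<Rightarrow> bel \<Rightarrow> bel \<Rightarrow> vec \<Rightarrow> tensor" where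
  "sandwich_term c u v [] = []"
| "sandwich_term c u v ((c',w) # x) = (case bmul w v of None \<Rightarrow> sandwich_term c u v x
     | Some y \<Rightarrow> (case bmul u y of None \<Rightarrow> sandwich_term c u v x
        | Some z \<Rightarrow> (c * c', (0,0,0), z) # sandwich_term c u v x))"

fun sandwich_list :: "tensor \<Rightarrow> vec \<Rightarrow> tensor" where
  "sandwich_list [] x = []"
| "sandwich_list ((c,u,v) # L) x = sandwich_term c u v x @ sandwich_list L x"

section \<open>Verification of the integral bases\<close>

definition chk_supp :: "int \<Rightarrow> bool" where
  "chk_supp q \<longleftrightarrow> list_all (list_all (\<lambda>(c,(v,k,w)). is_bel v k w \<and> (w,v) \<in> set (gen_pairs q))) (coh q)
    \<and> list_all (list_all (\<lambda>(c,(v,k,w)). is_bel v k w)) (dual q)"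

text \<open>The integral coefficients of \<open>b\<close> are read off from the dual basis. Together
  with \<open>chk_dual\<close> this yields a basis over every field.\<close>

definition chk_span :: "int \<Rightarrow> bool" where
  "chk_span q \<longleftrightarrow> list_all (\<lambda>b. if (snd (snd b), fst b) \<in> set (gen_pairs q)
     then tzero ((-1,(0,0,0),b) # concat (map (\<lambda>l. vscale (vcoeff b (dual q ! l)) (coh q ! l)) [0..<length (coh q)]))
     else True) basis"

definition chk_dual :: "int \<Rightarrow> bool" where
  "chk_dual q \<longleftrightarrow> list_all (\<lambda>k. list_all (\<lambda>l. pairing (dual q ! k) (coh q ! l) = (if k = l then 1 else 0))
     [0..<length (coh q)]) [0..<length (coh q)] \<and> length (dual q) = length (coh q)"

definition chk_diag :: "int \<Rightarrow> int \<Rightarrow> bool" where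
  "chk_diag q r \<longleftrightarrow> list_all (\<lambda>l. tzero (sandwich_list (flat r) (coh q ! l) @
     (if l < num_src q then vscale (- divisor q l) (coh r ! (num_src r + l)) else []))) [0..<length (coh q)]
    \<and> num_src r + num_src q \<le> length (coh r)"

lemma chk_supp: "list_all (\<lambda>(p,q,r). chk_supp p) triples" by code_simp
lemma chk_span: "list_all (\<lambda>(p,q,r). chk_span p) triples" by code_simp
lemma chk_dual: "list_all (\<lambda>(p,q,r). chk_dual p) triples" by code_simp
lemma chk_diag: "list_all (\<lambda>(p,q,r). chk_diag p q) triples" by code_simp

definition vval :: "vec \<Rightarrow> 'k::field R1" where
  "vval x = (\<Sum>(c,w)\<leftarrow>x. r1_scale (of_int c) (be w))"

lemma vval_simps [simp]: "vval [] = 0" "vval ((c,w) # x) = r1_scale (of_int c) (be w) + vval x"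
  by (simp_all add: vval_def)

lemma ev_vscale: "ev (\<lambda>y. 1) (vscale c x) = r1_scale (of_int c) (vval x :: 'k::field R1)"
proof -
  have "ev (\<lambda>y. 1) (vmap c x) = r1_scale (of_int c) (vval x :: 'k R1)"
    by (induction c x rule: vmap.induct) (simp_all add: R.A.scale_right_distrib)
  then show ?thesis by (simp add: vscale_def)
qed

definition vbasis :: "vec \<Rightarrow> bool" where
  "vbasis x \<longleftrightarrow> (\<forall>(c,w)\<in>set x. w \<in> set basis)"

lemma vbasis_simps [simp]: "vbasis []" "vbasis ((c,w) # x) \<longleftrightarrow> w \<in> set basis \<and> vbasis x"
  by (simp_all add: vbasis_def)

lemma ev_sandwich_term:
  assumes "u \<in> set basis" "v \<in> set basis" "vbasis x"
  shows "ev (\<lambda>y. 1) (sandwich_term c u v x) = r1_scale (of_int c) (be u * vval x * be v :: 'k::field R1)"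
  using assms(3)
proof (induction x)
  case (Cons t x)
  obtain c' w where t: "t = (c', w)" by (cases t)
  with Cons.prems have w: "w \<in> set basis" "vbasis x" by simp_all
  have uwv: "be u * be w * be v = (be u * be_opt (bmul w v) :: 'k R1)"
    using be_mult[where 'k = 'k, OF w(1) assms(2)] by (simp add: mult.assoc)
  have rest: "be u * vval (t # x) * be v = r1_scale (of_int c') (be u * be w * be v) + (be u * vval x * be v :: 'k R1)"
    by (simp add: t distrib_left distrib_right r1_scale_mult(1)[symmetric] r1_scale_mult(2)[symmetric])
  show ?case
  proof (cases "bmul w v")
    case None
    then show ?thesis using Cons.IH[OF w(2)] uwv rest t by simp
  next
    case (Some y)
    then have "be u * be w * be v = (be_opt (bmul u y) :: 'k R1)"
      using uwv be_mult[where 'k = 'k, OF assms(1), of y] bmul_basis[OF Some] by simp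
    then show ?thesis using Cons.IH[OF w(2)] rest t Some
      by (cases "bmul u y") (simp_all add: R.A.scale_right_distrib)
  qed
qed simp

lemma ev_sandwich_list:
  assumes "tbasis L" "vbasis x"
  shows "ev (\<lambda>y. 1) (sandwich_list L x) = (res.sandwich (conv L) (vval x) :: 'k::field R1)"
  using assms(1)
proof (induction L)
  case (Cons t L)
  obtain c u v where t: "t = (c, u, v)" by (cases t)
  with Cons.prems have "u \<in> set basis" "v \<in> set basis" "tbasis L" by (simp_all add: tbasis_Cons)
  with Cons.IH t ev_sandwich_term[where 'k = 'k, OF _ _ assms(2), of u v c] show ?case
    by (simp add: res.sandwich_def conv_def)
qed (simp add: res.sandwich_def conv_def)

lemma crd_zero: "b \<in> set basis \<Longrightarrow> crd b (0 :: 'k::field R1) = 0"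
  using crd_scale[of b 0 "0 :: 'k R1"] by simp

lemma crd_vval: "b \<in> set basis \<Longrightarrow> vbasis x \<Longrightarrow> crd b (vval x) = (of_int (vcoeff b x) :: 'k::field)"
  by (induction b x rule: vcoeff.induct) (auto simp: crd_zero crd_add crd_scale crd_be beq_iff)

lemma crd_vertex_mult:
  assumes "b \<in> set basis" "v \<in> R1_vertices"
  shows "crd b (be (v, 0, v) * x) = (if snd (snd b) = v then crd b x else (0 :: 'k::field))"
proof -
  have "be (v, 0, v) * x = (\<Sum>c\<in>set basis. r1_scale (crd c x) (be (v, 0, v) * be c))"
    by (rule lin_expand) (simp add: R.lin_def distrib_left r1_scale_mult(2))
  then have "crd b (be (v, 0, v) * x) = (\<Sum>c\<in>set basis. crd c x * crd b (be (v, 0, v) * be c))"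
    by (simp add: crd_sum assms crd_scale)
  also have "\<dots> = (\<Sum>c\<in>{b}. crd c x * crd b (be (v, 0, v) * be c))"
    using assms crd_zero[where 'k = 'k, OF assms(1)]
    by (intro sum.mono_neutral_right) (auto simp: be_vertex(1) crd_be)
  also have "\<dots> = (if snd (snd b) = v then crd b x else 0)"
    using assms crd_zero[where 'k = 'k, OF assms(1)] by (simp add: be_vertex(1) crd_be)
  finally show ?thesis .
qed

definition dual_val :: "vec \<Rightarrow> 'k::field R1 \<Rightarrow> 'k" where
  "dual_val d x = (\<Sum>(c,b)\<leftarrow>d. of_int c * crd b x)"

lemma dual_val_linear:
  assumes "vbasis d"
  shows "dual_val d (\<Sum>i\<in>I. r1_scale (u i) (x i)) = (\<Sum>i\<in>I. u i * dual_val d (x i :: 'k::field R1))"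
  using assms
proof (induction d)
  case (Cons t d)
  obtain c b where t: "t = (c, b)" by (cases t)
  with Cons show ?case
    by (simp add: dual_val_def crd_sum crd_scale sum_distrib_left sum.distrib algebra_simps)
qed (simp add: dual_val_def)

lemma dual_val_vval: "vbasis d \<Longrightarrow> vbasis x \<Longrightarrow> dual_val d (vval x) = (of_int (pairing d x) :: 'k::field)"
  by (induction d x rule: pairing.induct) (simp_all add: dual_val_def crd_vval)

lemma coh_wf:
  assumes "l < length (coh (idx q))"
  shows "vbasis (coh (idx q) ! l)" "vbasis (dual (idx q) ! l)" "length (dual (idx q)) = length (coh (idx q))"
    and "(c, w) \<in> set (coh (idx q) ! l) \<Longrightarrow> (snd (snd w), fst w) \<in> R1_gens q"
proof -
  have s: "chk_supp (idx q)" and d: "chk_dual (idx q)"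
    using chk_supp chk_dual idx_triple[of q] by (auto simp: list_all_iff)
  show len: "length (dual (idx q)) = length (coh (idx q))" using d unfolding chk_dual_def by blast
  have *: "\<forall>x\<in>set (coh (idx q)). \<forall>(c,(v,k,w))\<in>set x. is_bel v k w \<and> (w,v) \<in> set (gen_pairs (idx q))"
    "\<forall>x\<in>set (dual (idx q)). \<forall>(c,(v,k,w))\<in>set x. is_bel v k w"
    using s unfolding chk_supp_def list_all_iff by blast+
  note c = bspec[OF *(1) nth_mem[OF assms]]
  show "vbasis (coh (idx q) ! l)" using c unfolding vbasis_def is_bel_iff by fast
  show "vbasis (dual (idx q) ! l)" using bspec[OF *(2) nth_mem] assms len unfolding vbasis_def is_bel_iff by fastforce
  assume "(c, w) \<in> set (coh (idx q) ! l)"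
  from bspec[OF c this] show "(snd (snd w), fst w) \<in> R1_gens q" by (cases w) (simp add: R1_gens_def)
qed

definition coh_elt :: "nat \<Rightarrow> nat \<Rightarrow> 'k::field R1" where "coh_elt q l = vval (coh (idx q) ! l)"

lemma coh_elt_inv_space:
  assumes l: "l < length (coh (idx q))"
  shows "(coh_elt q l :: 'k::field R1) \<in> res.inv_space q"
  unfolding res.inv_space_def mem_Collect_eq
proof (intro ballI impI)
  fix i j assume i: "i \<in> R1_vertices" and j: "j \<in> R1_vertices" and ij: "(i, j) \<notin> R1_gens q"
  have "be (i,0,i) * vval x * be (j,0,j) = (0 :: 'k R1)" if "set x \<subseteq> set (coh (idx q) ! l)" for x
    using that
  proof (induction x)
    case (Cons t x)
    obtain c w where t: "t = (c, w)" by (cases t)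
    with Cons.prems have m: "(c, w) \<in> set (coh (idx q) ! l)" by simp
    have w: "w \<in> set basis" using coh_wf(1)[OF l] m by (auto simp: vbasis_def)
    have "snd (snd w) \<noteq> i \<or> fst w \<noteq> j" using coh_wf(4)[OF l m] ij by auto
    then have "be (i,0,i) * be w * be (j,0,j) = (0 :: 'k R1)"
      using be_vertex(1)[where 'k = 'k, OF w i] be_vertex(2)[where 'k = 'k, OF w j] by (auto simp: mult.assoc)
    then show ?case using Cons t
      by (simp add: distrib_left distrib_right r1_scale_mult(1)[symmetric] r1_scale_mult(2)[symmetric])
  qed simp
  then show "be (i,0,i) * coh_elt q l * be (j,0,j) = (0 :: 'k R1)" by (simp add: coh_elt_def)
qed

lemma be_coh_elt:
  assumes "b \<in> set basis" "(snd (snd b), fst b) \<in> R1_gens q"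
  shows "be b = (\<Sum>l<length (coh (idx q)). r1_scale (of_int (vcoeff b (dual (idx q) ! l))) (coh_elt q l :: 'k::field R1))"
proof -
  let ?L = "concat (map (\<lambda>l. vscale (vcoeff b (dual (idx q) ! l)) (coh (idx q) ! l)) [0..<length (coh (idx q))])"
  have "chk_span (idx q)" using chk_span idx_triple[of q] by (auto simp: list_all_iff)
  from bspec[OF this[unfolded chk_span_def list_all_iff] assms(1)]
  have "tzero ((-1,(0,0,0),b) # ?L)" using assms(2) by (simp only: R1_gens_def if_True)
  from ev_tzero[OF this, of "\<lambda>y. 1 :: 'k R1"] have "be b = (ev (\<lambda>y. 1) ?L :: 'k R1)" by simp
  also have "\<dots> = (\<Sum>l\<leftarrow>[0..<length (coh (idx q))]. r1_scale (of_int (vcoeff b (dual (idx q) ! l))) (coh_elt q l))"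
    by (simp add: ev_concat comp_def ev_vscale coh_elt_def)
  also have "\<dots> = (\<Sum>l<length (coh (idx q)). r1_scale (of_int (vcoeff b (dual (idx q) ! l))) (coh_elt q l))"
    by (simp only: interv_sum_list_conv_sum_set_nat set_upt atLeast0LessThan)
  finally show ?thesis .
qed

lemma coh_elt_span:
  fixes w :: "'k::field R1"
  assumes w: "w \<in> res.inv_space q"
  shows "\<exists>u. w = (\<Sum>l<length (coh (idx q)). r1_scale (u l) (coh_elt q l))"
proof -
  let ?N = "length (coh (idx q))"
  define S where "S = {b \<in> set basis. (snd (snd b), fst b) \<in> R1_gens q}"
  have z: "crd b w = 0" if b: "b \<in> set basis" "(snd (snd b), fst b) \<notin> R1_gens q" for b
  proof -
    note v = basis_ends[OF b(1)]
    have "be (snd (snd b),0,snd (snd b)) * w * be (fst b,0,fst b) = 0"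
      using w v b(2) unfolding res.inv_space_def by blast
    then have "crd b (be (snd (snd b),0,snd (snd b)) * w * be (fst b,0,fst b)) = 0"
      using crd_zero[where 'k = 'k, OF b(1)] by simp
    then show ?thesis using v by (simp only: crd_mult_vertex[OF b(1)] crd_vertex_mult[OF b(1)] simp_thms if_True)
  qed
  have "w = (\<Sum>b\<in>set basis. r1_scale (crd b w) (be b))" by (rule R1_expand)
  also have "\<dots> = (\<Sum>b\<in>S. r1_scale (crd b w) (be b))"
    unfolding S_def using z by (intro sum.mono_neutral_right) auto
  also have "\<dots> = (\<Sum>b\<in>S. \<Sum>l<?N. r1_scale (crd b w * of_int (vcoeff b (dual (idx q) ! l))) (coh_elt q l))"
  proof (rule sum.cong)
    fix b assume "b \<in> S"
    then have "be b = (\<Sum>l<?N. r1_scale (of_int (vcoeff b (dual (idx q) ! l))) (coh_elt q l :: 'k R1))"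
      unfolding S_def mem_Collect_eq by (intro be_coh_elt) simp_all
    then show "r1_scale (crd b w) (be b) = (\<Sum>l<?N. r1_scale (crd b w * of_int (vcoeff b (dual (idx q) ! l))) (coh_elt q l))"
      by (simp only: R.A.scale_sum_right R.A.scale_scale)
  qed simp
  also have "\<dots> = (\<Sum>l<?N. \<Sum>b\<in>S. r1_scale (crd b w * of_int (vcoeff b (dual (idx q) ! l))) (coh_elt q l))"
    by (rule sum.swap)
  also have "\<dots> = (\<Sum>l<?N. r1_scale (\<Sum>b\<in>S. crd b w * of_int (vcoeff b (dual (idx q) ! l))) (coh_elt q l))"
    by (simp only: R.A.scale_sum_left)
  finally show ?thesis by (rule exI[of _ "\<lambda>l. \<Sum>b\<in>S. crd b w * of_int (vcoeff b (dual (idx q) ! l))"])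
qed

text \<open>Pairing with the integral dual basis extracts each coefficient, whatever the
  field.\<close>

lemma coh_elt_independent:
  fixes u :: "nat \<Rightarrow> 'k::field"
  assumes z: "(\<Sum>l<length (coh (idx q)). r1_scale (u l) (coh_elt q l)) = 0"
  shows "\<forall>l<length (coh (idx q)). u l = 0"
proof (intro allI impI)
  let ?N = "length (coh (idx q))"
  fix k assume k: "k < ?N"
  have "chk_dual (idx q)" using chk_dual idx_triple[of q] by (auto simp: list_all_iff)
  then have p: "pairing (dual (idx q) ! k) (coh (idx q) ! l) = (if k = l then 1 else 0)" if "l < ?N" for l
    using k that unfolding chk_dual_def list_all_iff by simp
  have "0 = dual_val (dual (idx q) ! k) (\<Sum>l<?N. r1_scale (u l) (coh_elt q l))"
    unfolding z using dual_val_linear[OF coh_wf(2)[OF k], of u "\<lambda>l. 0 :: 'k R1" "{}"] by simp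
  also have "\<dots> = (\<Sum>l<?N. u l * dual_val (dual (idx q) ! k) (coh_elt q l))"
    by (rule dual_val_linear[OF coh_wf(2)[OF k]])
  also have "\<dots> = (\<Sum>l<?N. if k = l then u l else 0)"
    unfolding coh_elt_def using p by (intro sum.cong) (auto simp: dual_val_vval[OF coh_wf(2)[OF k] coh_wf(1)])
  also have "\<dots> = u k" using k by (simp only: sum.delta' finite_lessThan lessThan_iff if_True)
  finally show "u k = 0" by simp
qed

lemma coh_elt_sandwich:
  assumes l: "l < length (coh (idx q))"
  shows "res.sandwich (R1_bdry q) (coh_elt q l) = (if l < num_src (idx q)
    then r1_scale (of_int (divisor (idx q) l)) (coh_elt (Suc q) (num_src (idx (Suc q)) + l)) else (0 :: 'k::field R1))"
proof -
  have "chk_diag (idx q) (idx (Suc q))" using chk_diag idx_triple[of q] by (auto simp: list_all_iff)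
  then have "\<forall>l\<in>set [0..<length (coh (idx q))]. tzero (sandwich_list (flat (idx (Suc q))) (coh (idx q) ! l) @
     (if l < num_src (idx q) then vscale (- divisor (idx q) l) (coh (idx (Suc q)) ! (num_src (idx (Suc q)) + l)) else []))"
    unfolding chk_diag_def list_all_iff by (elim conjE)
  from bspec[OF this, of l]
  have "tzero (sandwich_list (flat (idx (Suc q))) (coh (idx q) ! l) @
     (if l < num_src (idx q) then vscale (- divisor (idx q) l) (coh (idx (Suc q)) ! (num_src (idx (Suc q)) + l)) else []))"
    using l by simp
  from ev_tzero[OF this, of "\<lambda>y. 1 :: 'k R1"] show ?thesis
    unfolding ev_simps(3) ev_sandwich_list[OF flat_wf(1) coh_wf(1)[OF l]]
    by (simp add: R1_bdry_def coh_elt_def ev_vscale split: if_splits)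
qed

lemma num_src_le: "num_src (idx (Suc q)) + num_src (idx q) \<le> length (coh (idx (Suc q)))"
proof -
  have "chk_diag (idx q) (idx (Suc q))" using chk_diag idx_triple[of q] by (auto simp: list_all_iff)
  then show ?thesis unfolding chk_diag_def by blast
qed

theorem HH_dim_R1:
  "HH_dim (r1_scale :: 'k::field \<Rightarrow> 'k R1 \<Rightarrow> 'k R1) r1_mult n =
    card {i. i < length (coh (idx n)) \<and> (i < num_src (idx n) \<longrightarrow> (of_int (divisor (idx n) i) :: 'k) = 0) \<and>
      (0 < n \<and> num_src (idx n) \<le> i \<and> i < num_src (idx n) + num_src (idx (n - 1)) \<longrightarrow>
         (of_int (divisor (idx (n - 1)) (i - num_src (idx n))) :: 'k) = 0)}"
proof -
  have "(*) = (r1_mult :: 'k R1 \<Rightarrow> 'k R1 \<Rightarrow> 'k R1)" by (simp add: fun_eq_iff times_R1_def)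
  then have "HH_dim (r1_scale :: 'k \<Rightarrow> 'k R1 \<Rightarrow> 'k R1) r1_mult n = HH_dim (r1_scale :: 'k \<Rightarrow> 'k R1 \<Rightarrow> 'k R1) (*) n" by simp
  also have "\<dots> = card {i. i < length (coh (idx n)) \<and> (i < num_src (idx n) \<longrightarrow> (of_int (divisor (idx n) i) :: 'k) = 0) \<and>
      (0 < n \<and> num_src (idx n) \<le> i \<and> i < num_src (idx n) + num_src (idx (n - 1)) \<longrightarrow>
         (of_int (divisor (idx (n - 1)) (i - num_src (idx n))) :: 'k) = 0)}"
  proof (rule res.HH_dim_monomial[of "\<lambda>q. length (coh (idx q))" coh_elt "\<lambda>q. num_src (idx q)" "\<lambda>q l. of_int (divisor (idx q) l)" n])
    \<comment> \<open>\<open>num_src_le\<close> speaks about successor degrees only; degree 22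
      stands in for degree 0 because both have index 0.\<close>
    show "num_src (idx 0) \<le> length (coh (idx 0))"
      using num_src_le[of 21] by (simp add: idx_def)
  qed (use coh_elt_independent in \<open>blast intro: coh_elt_inv_space coh_elt_span coh_elt_sandwich num_src_le\<close>)+
  finally show ?thesis .
qed

section \<open>Reading off the dimensions\<close>

lemma length_coh:
  "length (coh 0) = 8" "length (coh 1) = 7" "length (coh 2) = 2" "length (coh 3) = 8" "length (coh 4) = 9"
  "length (coh 5) = 8" "length (coh 6) = 11" "length (coh 7) = 8" "length (coh 8) = 6" "length (coh 9) = 5"
  "length (coh 10) = 8" "length (coh 11) = 8" "length (coh 12) = 5" "length (coh 13) = 6" "length (coh 14) = 8"
  "length (coh 15) = 11" "length (coh 16) = 8" "length (coh 17) = 9" "length (coh 18) = 8" "length (coh 19) = 2"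
  "length (coh 20) = 7" "length (coh 21) = 8"
  by code_simp+

text \<open>Indices that are neither source nor target always count. Among the sources, and among
  the targets, only the last one can count: \<open>P\<close> and \<open>Q\<close> say that the top
  divisor of the outgoing and of the incoming differential vanishes in the field.\<close>

lemma card_homology_indices:
  fixes N s r :: nat
  assumes "s + r \<le> N"
  shows "card {i. i < N \<and> (i < s \<longrightarrow> Suc i = s \<and> P) \<and> (s \<le> i \<and> i < s + r \<longrightarrow> Suc (i - s) = r \<and> Q)}
    = N - (s + r) + (if 0 < s \<and> P then 1 else 0) + (if 0 < r \<and> Q then 1 else 0)"
proof -
  let ?A = "if 0 < s \<and> P then {s - 1} else {}" and ?B = "if 0 < r \<and> Q then {s + r - 1} else {}"
  have "{i. i < N \<and> (i < s \<longrightarrow> Suc i = s \<and> P) \<and> (s \<le> i \<and> i < s + r \<longrightarrow> Suc (i - s) = r \<and> Q)}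
    = {s + r..<N} \<union> ?A \<union> ?B"
    using assms by (auto split: if_splits)
  also have "card \<dots> = card ({s + r..<N} \<union> ?A) + card ?B"
    by (rule card_Un_disjoint) (auto split: if_splits)
  also have "card ({s + r..<N} \<union> ?A) = card {s + r..<N} + card ?A"
    by (rule card_Un_disjoint) (auto split: if_splits)
  finally show ?thesis by simp
qed

text \<open>In degree 0 there is no incoming differential, hence \<open>r = 0\<close>. This is the
  one deviation from periodicity and the reason for the separate value in degree 0.\<close>

lemma HH_dim_R1_formula:
  fixes n :: nat
  defines "s \<equiv> num_src (idx n)" and "r \<equiv> (if n = 0 then 0 else num_src (idx (n - 1)))"
  shows "HH_dim (r1_scale :: 'k::field \<Rightarrow> 'k R1 \<Rightarrow> 'k R1) r1_mult n = length (coh (idx n)) - (s + r)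
    + (if 0 < s \<and> (of_int (top_divisor (idx n)) :: 'k) = 0 then 1 else 0)
    + (if 0 < r \<and> (of_int (top_divisor (idx (n - 1))) :: 'k) = 0 then 1 else 0)"
proof -
  have d: "(of_int (divisor q i) :: 'k) = 0 \<longleftrightarrow> Suc i = num_src q \<and> (of_int (top_divisor q) :: 'k) = 0" for q i
    by (simp add: divisor_def)
  have "s + r \<le> length (coh (idx n))"
    using num_src_le[of "n - 1"] num_src_le[of 21] by (cases n) (auto simp: s_def r_def idx_def)
  from card_homology_indices[OF this] show ?thesis
    unfolding HH_dim_R1 d s_def r_def by (cases n) simp_all
qed

theorem mainTheorem12:
  fixes t :: nat
  defines "l \<equiv> t div 11" and "r \<equiv> t mod 11"
  defines "m \<equiv> r div 2"
  defines "d \<equiv> HH_dim (r1_scale :: 'k::field \<Rightarrow> 'k R1 \<Rightarrow> 'k R1) r1_mult"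
  defines "P2 \<equiv> (r \<in> {0, 10} \<and> t > 0 \<and> even (l + m) \<and> CHAR('k) = 3)
              \<or> (r \<in> {4, 6} \<and> odd (l + m) \<and> CHAR('k) = 3)"
  defines "P1 \<equiv> (r \<in> {0, 10} \<and> t > 0 \<and> even (l + m) \<and> CHAR('k) \<noteq> 3)
              \<or> r \<in> {1, 9}
              \<or> (r \<in> {2, 8} \<and> even (l + m))
              \<or> (r = 3 \<and> (even (l + m) \<or> CHAR('k) = 2))
              \<or> (r \<in> {4, 6} \<and> even (l + m) \<and> CHAR('k) = 2)
              \<or> (r \<in> {4, 6} \<and> odd (l + m) \<and> CHAR('k) \<noteq> 3)
              \<or> (r = 5 \<and> CHAR('k) = 3)
              \<or> (r = 7 \<and> (odd (l + m) \<or> CHAR('k) = 2))"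
  shows "d 0 = 3
         \<and> (P2 \<longrightarrow> d t = 2)
         \<and> (P1 \<longrightarrow> d t = 1)
         \<and> (t > 0 \<and> \<not> P2 \<and> \<not> P1 \<longrightarrow> d t = 0)"
proof -
  \<comment> \<open>The characteristic of a field is not 1, so if it divides 2 or 3 it is that
    number.\<close>
  have char_dvd: "CHAR('k) dvd p \<longleftrightarrow> CHAR('k) = p" if "p = 2 \<or> p = 3" for p :: nat
  proof
    assume dvd: "CHAR('k) dvd p"
    then have "CHAR('k) \<le> p" using that by (auto dest: dvd_imp_le)
    moreover have "c \<le> p \<Longrightarrow> c = 0 \<or> c = Suc 0 \<or> c = 2 \<or> c = 3" for c using that by presburger
    ultimately have "CHAR('k) = 0 \<or> CHAR('k) = Suc 0 \<or> CHAR('k) = 2 \<or> CHAR('k) = 3" by blast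
    then show "CHAR('k) = p" using dvd that CHAR_not_1[where 'a = 'k] by auto
  qed simp
  have "(4 :: 'k) = 2 * 2" by simp
  then have "(4 :: 'k) = 0 \<longleftrightarrow> (2 :: 'k) = 0" by (simp only: mult_eq_0_iff disj_absorb)
  then have c4: "(4 :: 'k) = 0 \<longleftrightarrow> CHAR('k) = 2"
    using of_nat_eq_0_iff_char_dvd[of 2, where 'a = 'k] char_dvd[of 2] by simp
  have c3: "(3 :: 'k) = 0 \<longleftrightarrow> CHAR('k) = 3"
    using of_nat_eq_0_iff_char_dvd[of 3, where 'a = 'k] char_dvd[of 3] by simp
  have "d 0 = 3"
    unfolding d_def HH_dim_R1_formula by (simp add: idx_def num_src_def top_divisor_def length_coh)
  moreover have "(P2 \<longrightarrow> d t = 2) \<and> (P1 \<longrightarrow> d t = 1) \<and> (\<not> P2 \<and> \<not> P1 \<longrightarrow> d t = 0)" if "0 < t"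
  proof -
    \<comment> \<open>Degrees that differ by 22 have the same \<open>r\<close> and the same parity
      of \<open>l\<close>, so 22 cases decide everything for \<open>t > 0\<close>.\<close>
    define j where "j = t mod 22"
    have t: "t = 22 * (t div 22) + j" by (simp add: j_def)
    have r: "r = j mod 11" unfolding r_def j_def by (simp add: mod_mod_cancel)
    have "l = 2 * (t div 22) + j div 11" unfolding l_def by (subst t) simp
    then have "even l \<longleftrightarrow> even (2 * (t div 22) + j div 11)" by (rule arg_cong)
    then have l: "even l \<longleftrightarrow> even (j div 11)" by (simp only: even_add even_mult_iff even_numeral simp_thms)
    have i: "idx t = int j" "idx (t - 1) = (if j = 0 then 21 else int j - 1)"
    proof -
      obtain t' where t': "t = Suc t'" using \<open>0 < t\<close> by (cases t) auto
      show "idx t = int j" by (simp add: idx_def j_def)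
      show "idx (t - 1) = (if j = 0 then 21 else int j - 1)"
        unfolding idx_def j_def t' by (simp add: mod_Suc)
    qed
    have upt: "[0..<22] = [0,1,2,3,4,5,6,7,8,9,10,11,12,13,14,15,16,17,18,19,20,21::nat]" by code_simp
    have "j \<in> set [0..<22]" by (simp add: j_def)
    then have j: "j = 0 \<or> j = 1 \<or> j = 2 \<or> j = 3 \<or> j = 4 \<or> j = 5 \<or> j = 6 \<or> j = 7 \<or> j = 8 \<or> j = 9 \<or> j = 10
      \<or> j = 11 \<or> j = 12 \<or> j = 13 \<or> j = 14 \<or> j = 15 \<or> j = 16 \<or> j = 17 \<or> j = 18 \<or> j = 19 \<or> j = 20 \<or> j = 21"
      unfolding upt by simp
    define k where "k = (if j = 0 then 21 else int j - 1)"
    have D: "d t = length (coh (int j)) - (num_src (int j) + num_src k)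
      + (if 0 < num_src (int j) \<and> (of_int (top_divisor (int j)) :: 'k) = 0 then 1 else 0)
      + (if 0 < num_src k \<and> (of_int (top_divisor k) :: 'k) = 0 then 1 else 0)"
      unfolding d_def HH_dim_R1_formula i k_def[symmetric] using \<open>0 < t\<close> by simp
    have pos: "(0 < t) = True" using \<open>0 < t\<close> by simp
    show ?thesis
      unfolding P1_def P2_def m_def r D pos using j
      by (elim disjE; simp add: l k_def num_src_def top_divisor_def length_coh c3 c4)
  qed
  moreover have "\<not> P2 \<and> \<not> P1" if "t = 0" using that by (simp add: P1_def P2_def r_def)
  ultimately show ?thesis by (cases "t = 0") simp_all
qed

end
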